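(* Let $m\ge 1$, $N=1+m$, $\lambda\ge 1$, $0<\nu<1$, $Q=(m+1)+\lambda m$, $2^*_\lambda=\frac{2Q}{Q-2}$, let $\Omega\subset\mathbb{R}^{N}$ be a $\Lambda$-connected bounded open set, and let $f\in L^r(\Omega)$ with $r\ge\left(\frac{2^*_\lambda}{1-\nu}\right)'$ be a nonnegative function which is not identically zero. Let $u\in H^{1,\lambda}_0(\Omega)$ be the unique weak solution of $$-\Delta_\lambda u=\frac{f}{u^\nu}\ \text{ in }\Omega,\qquad u>0\ \text{ in }\Omega,\qquad u=0\ \text{ on }\partial\Omega.$$ Then: (i) if $r>\frac{Q}{2}$, then $u\in L^\infty(\Omega)$; (ii) if $\left(\frac{2^*_\lambda}{1-\nu}\right)'\le r<\frac{Q}{2}$, then $u\in L^s(\Omega)$ with $s=\frac{Qr(\nu+1)}{Q-2r}$.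
   Context: $p'=\frac{p}{p-1}$ denotes the Hölder conjugate of $p$. Points of $\mathbb{R}^N=\mathbb{R}^{1+m}$ are written $X=(x,y)$ with $x\in\mathbb{R}$, $y\in\mathbb{R}^m$. The Grushin operator is $\Delta_\lambda u=u_{xx}+|x|^{2\lambda}\Delta_y u=\operatorname{div}(A\nabla u)$, where $A(X)=\operatorname{diag}(1,|x|^{2\lambda}I_m)$. An open set $\Omega$ is $\Lambda$-connected if any two points of $\Omega$ can be joined by a continuous curve lying in $\Omega$ which is piecewise an integral curve of the vector fields $\pm\partial_x,\pm|x|^\lambda\partial_{y_1},\dots,\pm|x|^\lambda\partial_{y_m}$. $\Omega'\Subset\Omega$ means that $\overline{\Omega'}$ is a compact subset of $\Omega$. $C^1_0(\Omega)$ is the space of $C^1$ functions with compact support in $\Omega$. Function spaces: let $V_A(\Omega)$ be the set of $u\in C^1(\Omega)$ with $\|u\|^2:=\int_\Omega|u|^2dX+\int_\Omega\langle A\nabla u,\nabla u\rangle dX<\infty$. $H^{1,\lambda}(\Omega)$ is the completion of $(V_A(\Omega),\|\cdot\|)$, and $H^{1,\lambda}_0(\Omega)$ is the completion of $C^1_0(\Omega)$ under $\|u\|_0:=(\int_\Omega\langle A\nabla u,\nabla u\rangle dX)^{1/2}$ (equivalent to $\|\cdot\|$ on $C^1_0(\Omega)$ by a Poincaré inequality). An element represented by a Cauchy sequence $\{u_n\}$ is identified with $u=\lim u_n$ in $L^2(\Omega)$; setting $U=\lim\sqrt{A}\nabla u_n$ in $L^2(\Omega)^N$ (which is uniquely determined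 by $u$), the weak quasi-gradient is $\nabla^*u:=(\sqrt{A})^{-1}U$, defined a.e. in $\Omega$. Weak solution (for $\nu<1$): $u\in H^{1,\lambda}_0(\Omega)$ such that for every $\Omega'\Subset\Omega$ there is $C(\Omega')>0$ with $u\ge C(\Omega')$ a.e. in $\Omega'$, and $\int_\Omega\langle A\nabla^*u,\nabla v\rangle dX=\int_\Omega\frac{fv}{u^\nu}dX$ for all $v\in C^1_0(\Omega)$. It is known that, for nonnegative, not identically zero $f\in L^{(2^*_\lambda/(1-\nu))'}(\Omega)$, exactly one weak solution exists. *)

theory Defs
  imports "HOL-Analysis.Analysis"
begin

text \<open>
  Points of \<open>\<real>\<^sup>1\<^sup>+\<^sup>m\<close> are pairs \<open>X = (x, y)\<close> of type \<^typ>\<open>real \<times> (real ^ 'm)\<close>, with \<open>m = CARD('m) \<ge> 1\<close>.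
  A function on an open set \<open>\<Omega>\<close> is a total function whose values outside \<open>\<Omega>\<close> are never used.
  The exponent of the Grushin operator is written \<open>lam\<close>.
\<close>

definition holder_conjugate :: "real \<Rightarrow> real" where
  "holder_conjugate p = p / (p - 1)"

definition Lp :: "'a::euclidean_space set \<Rightarrow> ereal \<Rightarrow> ('a \<Rightarrow> 'b::euclidean_space) set" where
  "Lp \<Omega> p = {f. f \<in> borel_measurable (lebesgue_on \<Omega>) \<and>
     (if p = \<infinity> then \<exists>C. AE X in lebesgue_on \<Omega>. norm (f X) \<le> C
      else integrable (lebesgue_on \<Omega>) (\<lambda>X. norm (f X) powr real_of_ereal p))}"

definition L2_tendsto ::
  "'a::euclidean_space set \<Rightarrow> (nat \<Rightarrow> 'a \<Rightarrow> 'b::euclidean_space) \<Rightarrow> ('a \<Rightarrow> 'b) \<Rightarrow> bool" where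
  "L2_tendsto \<Omega> g G \<longleftrightarrow> (\<forall>n. g n \<in> Lp \<Omega> 2) \<and> G \<in> Lp \<Omega> 2 \<and>
     (\<lambda>n. LINT X|lebesgue_on \<Omega>. (norm (g n X - G X))\<^sup>2) \<longlonglongrightarrow> 0"

definition gradient :: "('a::euclidean_space \<Rightarrow> real) \<Rightarrow> 'a \<Rightarrow> 'a" where
  "gradient u X = (THE D. GDERIV u X :> D)"

definition C1_on :: "'a::euclidean_space set \<Rightarrow> ('a \<Rightarrow> real) set" where
  "C1_on \<Omega> = {u. (\<forall>X\<in>\<Omega>. u differentiable (at X)) \<and> continuous_on \<Omega> (gradient u)}"

definition C1_0 :: "'a::euclidean_space set \<Rightarrow> ('a \<Rightarrow> real) set" where
  "C1_0 \<Omega> = {u \<in> C1_on \<Omega>. compact (closure {X\<in>\<Omega>. u X \<noteq> 0}) \<and> closure {X\<in>\<Omega>. u X \<noteq> 0} \<subseteq> \<Omega>}"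

definition compactly_inside :: "'a::euclidean_space set \<Rightarrow> 'a set \<Rightarrow> bool" where
  "compactly_inside \<Omega>' \<Omega> \<longleftrightarrow> compact (closure \<Omega>') \<and> closure \<Omega>' \<subseteq> \<Omega>"

text \<open>The matrices \<open>A(X)\<close>, \<open>\<surd>A(X)\<close> and, off the null set \<open>x = 0\<close>, \<open>(\<surd>A(X))\<^sup>-\<^sup>1\<close>, as linear maps in \<open>Z\<close>.\<close>

definition grushin_A :: "real \<Rightarrow> real \<times> (real ^ 'm) \<Rightarrow> real \<times> (real ^ 'm) \<Rightarrow> real \<times> (real ^ 'm)" where
  "grushin_A lam X Z = (fst Z, (\<bar>fst X\<bar> powr (2 * lam)) *\<^sub>R snd Z)"

definition grushin_sqrtA :: "real \<Rightarrow> real \<times> (real ^ 'm) \<Rightarrow> real \<times> (real ^ 'm) \<Rightarrow> real \<times> (real ^ 'm)" where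
  "grushin_sqrtA lam X Z = (fst Z, (\<bar>fst X\<bar> powr lam) *\<^sub>R snd Z)"

definition grushin_sqrtA_inv :: "real \<Rightarrow> real \<times> (real ^ 'm) \<Rightarrow> real \<times> (real ^ 'm) \<Rightarrow> real \<times> (real ^ 'm)" where
  "grushin_sqrtA_inv lam X Z = (fst Z, (\<bar>fst X\<bar> powr (- lam)) *\<^sub>R snd Z)"

definition grushin_fields :: "real \<Rightarrow> (real \<times> (real ^ 'm) \<Rightarrow> real \<times> (real ^ 'm)) set" where
  "grushin_fields lam =
     {(\<lambda>X. (\<sigma>, 0)) | \<sigma>. \<sigma> \<in> {1, -1}} \<union>
     {(\<lambda>X. (0, (\<sigma> * \<bar>fst X\<bar> powr lam) *\<^sub>R axis i 1)) | \<sigma> i. \<sigma> \<in> {1, -1}}"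

text \<open>
  Integral curves carry their natural time parameter, so the curve runs over \<open>[0, T]\<close> with \<open>T\<close>
  arbitrary; \<open>\<tau>\<close> lists the break points, where only one-sided derivatives are required.
\<close>

definition Lambda_connected :: "real \<Rightarrow> (real \<times> (real ^ 'm)) set \<Rightarrow> bool" where
  "Lambda_connected lam \<Omega> \<longleftrightarrow>
     (\<forall>P\<in>\<Omega>. \<forall>R\<in>\<Omega>. \<exists>T \<gamma> (n::nat) \<tau>.
        continuous_on {0..T} \<gamma> \<and> \<gamma> ` {0..T} \<subseteq> \<Omega> \<and> \<gamma> 0 = P \<and> \<gamma> T = R \<and>
        \<tau> 0 = 0 \<and> \<tau> n = T \<and>
        (\<forall>i<n. \<tau> i < \<tau> (Suc i) \<and>
           (\<exists>V\<in>grushin_fields lam. \<forall>t\<in>{\<tau> i..\<tau> (Suc i)}.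
              (\<gamma> has_vector_derivative V (\<gamma> t)) (at t within {\<tau> i..\<tau> (Suc i)}))))"

definition H0_norm :: "real \<Rightarrow> (real \<times> (real ^ 'm)) set \<Rightarrow> (real \<times> (real ^ 'm) \<Rightarrow> real) \<Rightarrow> real" where
  "H0_norm lam \<Omega> u = sqrt (LINT X|lebesgue_on \<Omega>. grushin_A lam X (gradient u X) \<bullet> gradient u X)"

text \<open>\<open>\<phi>\<close> is a Cauchy sequence in \<open>(C\<^sup>1\<^sub>0(\<Omega>), \<parallel>\<cdot>\<parallel>\<^sub>0)\<close> whose class in the completion is identified with \<open>u\<close>.\<close>

definition H0_represents :: "real \<Rightarrow> (real \<times> (real ^ 'm)) set \<Rightarrow>
    (nat \<Rightarrow> real \<times> (real ^ 'm) \<Rightarrow> real) \<Rightarrow> (real \<times> (real ^ 'm) \<Rightarrow> real) \<Rightarrow> bool" where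
  "H0_represents lam \<Omega> \<phi> u \<longleftrightarrow>
     (\<forall>n. \<phi> n \<in> C1_0 \<Omega>) \<and>
     (\<forall>e>0. \<exists>M. \<forall>j\<ge>M. \<forall>k\<ge>M. H0_norm lam \<Omega> (\<lambda>X. \<phi> j X - \<phi> k X) < e) \<and>
     L2_tendsto \<Omega> \<phi> u"

definition H0_space :: "real \<Rightarrow> (real \<times> (real ^ 'm)) set \<Rightarrow> (real \<times> (real ^ 'm) \<Rightarrow> real) set" where
  "H0_space lam \<Omega> = {u. \<exists>\<phi>. H0_represents lam \<Omega> \<phi> u}"

text \<open>
  \<open>G\<close> is a version of the weak quasi-gradient \<open>\<nabla>\<^sup>*u\<close>. It exists for every \<open>u\<close> in \<^const>\<open>H0_space\<close> and
  is unique up to null sets, because \<open>U\<close> is determined by \<open>u\<close>.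
\<close>

definition has_quasi_gradient :: "real \<Rightarrow> (real \<times> (real ^ 'm)) set \<Rightarrow>
    (real \<times> (real ^ 'm) \<Rightarrow> real) \<Rightarrow> (real \<times> (real ^ 'm) \<Rightarrow> real \<times> (real ^ 'm)) \<Rightarrow> bool" where
  "has_quasi_gradient lam \<Omega> u G \<longleftrightarrow>
     (\<exists>\<phi> U. H0_represents lam \<Omega> \<phi> u \<and>
        L2_tendsto \<Omega> (\<lambda>n X. grushin_sqrtA lam X (gradient (\<phi> n) X)) U \<and>
        (AE X in lebesgue_on \<Omega>. G X = grushin_sqrtA_inv lam X (U X)))"

text \<open>
  Weak solutions of \<open>-div(A\<nabla>u) = f / u\<^sup>\<nu>\<close>, \<open>u > 0\<close> in \<open>\<Omega>\<close>, \<open>u = 0\<close> on \<open>\<partial>\<Omega>\<close>. The boundary condition is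
  membership in \<^const>\<open>H0_space\<close>, positivity is the local lower bound.
\<close>

definition weak_solution :: "real \<Rightarrow> real \<Rightarrow> (real \<times> (real ^ 'm)) set \<Rightarrow>
    (real \<times> (real ^ 'm) \<Rightarrow> real) \<Rightarrow> (real \<times> (real ^ 'm) \<Rightarrow> real) \<Rightarrow> bool" where
  "weak_solution lam \<nu> \<Omega> f u \<longleftrightarrow>
     u \<in> H0_space lam \<Omega> \<and>
     (\<forall>\<Omega>'. compactly_inside \<Omega>' \<Omega> \<longrightarrow>
        (\<exists>C>0. AE X in lebesgue_on \<Omega>. X \<in> \<Omega>' \<longrightarrow> C \<le> u X)) \<and>
     (\<exists>G. has_quasi_gradient lam \<Omega> u G \<and>
        (\<forall>v\<in>C1_0 \<Omega>.
           (LINT X|lebesgue_on \<Omega>. grushin_A lam X (G X) \<bullet> gradient v X) =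
           (LINT X|lebesgue_on \<Omega>. f X * v X / u X powr \<nu>)))"

end

theory Submission
  imports Defs
begin

text \<open>
  The proof rests on the Sobolev inequality with the critical exponent \<open>2* = 2Q/(Q-2)\<close> for the
  Grushin energy. It follows from the Faber-Krahn type bound
  \<open>\<integral> \<psi>\<^sup>2 \<le> C |{\<psi> \<noteq> 0}|^(2/Q) \<integral> |\<surd>A \<nabla>\<psi>|\<^sup>2\<close>: from every point one hops a distance of order
  \<open>\<rho>\<close> away from the degenerate set \<open>x = 0\<close> and then along the fibre, reaching
  a region of volume at least of order \<open>\<rho>\<^sup>Q\<close>, so that for \<open>\<rho>\<^sup>Q \<ge> 2 |{\<psi> \<noteq> 0}|\<close> at least half of the hops
  leave the set where \<open>\<psi> \<noteq> 0\<close>. Truncating \<open>\<psi>\<close> between the heights \<open>t\<close> and \<open>2t\<close> and integrating over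
  \<open>dt/t\<close> upgrades this to the Sobolev inequality.

  For a weak solution \<open>u\<close>, approximated by \<open>\<phi>\<^sub>n \<in> C\<^sup>1\<^sub>0(\<Omega>)\<close>, the functions \<open>h(\<phi>\<^sub>n)\<close> are admissible and
  lead to \<open>\<integral> h'(u) |U|\<^sup>2 = \<integral> f h(u) / u\<^sup>\<nu>\<close> for every \<open>C\<^sup>1\<close> Lipschitz \<open>h\<close> with \<open>h(0) = 0\<close>. Together with the
  Sobolev inequality for \<open>H(u)\<close>, \<open>H'\<^sup>2 \<le> h'\<close>, this gives (i) by Stampacchia's level set method and (ii)
  with \<open>H\<close> a bounded approximation of \<open>t\<^sup>\<gamma>\<close>, \<open>\<gamma> = s/2*\<close>.
\<close>

section \<open>Increments along curves\<close>

text \<open>Two obstacles shape the proof. The energy degenerates on x = 0, so moves along the fibre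
  have no uniform cost there. A hop with parameter (s, z) first secures |x| >= s and then moves by
  |x|^lam z, which costs order s + |z| everywhere. Parameters in a box of side rho have volume
  rho^(1+m), and the Jacobian enlarges this by rho^(lam m); the resulting exponent is Q. The second
  obstacle is f/u^\<nu>: its integrability is clear only on compact subsets, and the equation may be
  tested only with functions in \<open>C1_0\<close>, hence not with powers of u. The limit from
  h(\<phi>) to h(u) needs convergence in the space L^1 weighted by f/u^\<nu>, and this is extracted
  from the equation itself, with a rate in terms of the energy distance. All cut-offs are C^1 so
  that composition stays inside \<open>C1_0\<close>. The exponent in (ii) is forced: testing with
  the power 2 \<gamma> - 1, losing \<nu> to the singular factor and applying Hoelder with the
  conjugate r' of r must return the power s on the left, that is (2 \<gamma> - 1 - \<nu>) r' =
  s.\<close>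

lemma increment_square_le:
  fixes g g' :: "real \<Rightarrow> real"
  assumes d: "\<And>t. (g has_real_derivative g' t) (at t)" and c: "continuous_on UNIV g'"
  shows "ennreal ((g 1 - g 0)\<^sup>2) \<le> (\<integral>\<^sup>+t. indicator {0..1} t * ennreal ((g' t)\<^sup>2) \<partial>lborel)"
proof -
  define e where "e = g 1 - g 0"
  have cc: "continuous_on {0..1} g'" using c continuous_on_subset by blast
  have i1: "(g' has_integral e) {0..1}"
    unfolding e_def by (rule fundamental_theorem_of_calculus)
      (auto simp: has_real_derivative_iff_has_vector_derivative[symmetric] intro: d DERIV_subset)
  have "(\<lambda>t. (g' t)\<^sup>2) integrable_on {0..1}"
    by (intro integrable_continuous_real continuous_intros cc)
  then obtain J where J: "((\<lambda>t. (g' t)\<^sup>2) has_integral J) {0..1}" by auto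
  \<comment> \<open>Expanding the square of \<open>g' t - e\<close>, with \<open>e\<close> the mean
    of \<open>g'\<close>, takes the place of a Cauchy-Schwarz argument: its integral is
    \<open>J - e * e\<close>.\<close>
  have "((\<lambda>t. (g' t)\<^sup>2 - 2 * e * g' t + e\<^sup>2) has_integral J - 2 * e * e + e\<^sup>2) {0..1}"
    using has_integral_const_real[of "e\<^sup>2" 0 1]
    by (intro has_integral_add has_integral_diff J has_integral_mult_right i1) auto
  then have "0 \<le> J - 2 * e * e + e\<^sup>2"
  proof (rule has_integral_nonneg)
    fix t show "0 \<le> (g' t)\<^sup>2 - 2 * e * g' t + e\<^sup>2"
      using zero_le_power2[of "g' t - e"] by (simp add: power2_diff mult.commute mult.left_commute)
  qed
  then have "e\<^sup>2 \<le> J" by (simp add: power2_eq_square)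
  moreover have "(\<integral>\<^sup>+t. indicator {0..1} t * ennreal ((g' t)\<^sup>2) \<partial>lborel) = ennreal J"
    using nn_integral_has_integral_lebesgue[OF _ J] by (simp add: nn_integral_completion ennreal_mult'' ennreal_indicator)
  ultimately show ?thesis by (simp add: e_def ennreal_leI)
qed

section \<open>Substitutions in Lebesgue integrals and the cost of single moves\<close>

lemma nn_integral_lborel_translate:
  fixes F :: "'a::euclidean_space \<Rightarrow> ennreal"
  assumes [measurable]: "F \<in> borel_measurable borel"
  shows "(\<integral>\<^sup>+x. F (x + c) \<partial>lborel) = (\<integral>\<^sup>+x. F x \<partial>lborel)"
proof -
  have "(\<integral>\<^sup>+x. F x \<partial>lborel) = (\<integral>\<^sup>+x. F x \<partial>distr lborel borel ((+) c))" by (simp add: lborel_distr_plus)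
  also have "\<dots> = (\<integral>\<^sup>+x. F (c + x) \<partial>lborel)" by (subst nn_integral_distr) auto
  finally show ?thesis by (simp add: add.commute)
qed

lemma nn_integral_lborel_scale:
  fixes F :: "'a::euclidean_space \<Rightarrow> ennreal"
  assumes [measurable]: "F \<in> borel_measurable borel" and "c > 0"
  shows "(\<integral>\<^sup>+z. F (y + c *\<^sub>R z) \<partial>lborel) = ennreal (1 / c ^ DIM('a)) * (\<integral>\<^sup>+x. F x \<partial>lborel)"
proof -
  have "(\<integral>\<^sup>+x. F x \<partial>lborel) = (\<integral>\<^sup>+x. F x \<partial>density (distr lborel borel (\<lambda>x. y + c *\<^sub>R x)) (\<lambda>_. \<bar>c\<bar>^DIM('a)))"
    using lborel_affine[of c y] \<open>c > 0\<close> by simp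
  also have "\<dots> = (\<integral>\<^sup>+z. ennreal (c ^ DIM('a)) * F (y + c *\<^sub>R z) \<partial>lborel)"
    using \<open>c > 0\<close> by (subst nn_integral_density) (auto simp: nn_integral_distr)
  also have "\<dots> = ennreal (c ^ DIM('a)) * (\<integral>\<^sup>+z. F (y + c *\<^sub>R z) \<partial>lborel)"
    by (subst nn_integral_cmult) auto
  finally show ?thesis
    using \<open>c > 0\<close> by (simp add: mult.assoc[symmetric] ennreal_mult[symmetric])
qed

text \<open>A step away from 0, never across it, so |x| only grows on the way. The point 0 is sent
  to the right to make the map total; the jump there is harmless because differentiation takes place
  only along the segment from x to its image.\<close>

definition outward :: "real \<Rightarrow> real \<Rightarrow> real" where
  "outward s x = (if x \<ge> 0 then x + s else x - s)"

lemma outward_measurable [measurable (raw)]: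
  assumes [measurable]: "f \<in> borel_measurable M" "g \<in> borel_measurable M"
  shows "(\<lambda>w. outward (f w) (g w)) \<in> borel_measurable M"
  unfolding outward_def by measurable

lemma abs_outward: "s \<ge> 0 \<Longrightarrow> \<bar>outward s x\<bar> = \<bar>x\<bar> + s"
  by (auto simp: outward_def)

text \<open>Each half line is translated, and the images leave the gap between -a and a uncovered;
  hence an inequality and not an equality.\<close>

lemma nn_integral_outward_le:
  fixes F :: "real \<Rightarrow> ennreal"
  assumes [measurable]: "F \<in> borel_measurable borel" and a: "a \<ge> 0"
  shows "(\<integral>\<^sup>+x. F (outward a x) \<partial>lborel) \<le> (\<integral>\<^sup>+x. F x \<partial>lborel)"
proof -
  have "(\<integral>\<^sup>+x. F (outward a x) \<partial>lborel)
      = (\<integral>\<^sup>+x. indicator {a..} (x + a) * F (x + a) + indicator {..< -a} (x + - a) * F (x + - a) \<partial>lborel)"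
    by (rule nn_integral_cong) (auto simp: outward_def indicator_def)
  also have "\<dots> = (\<integral>\<^sup>+x. indicator {a..} (x + a) * F (x + a) \<partial>lborel)
               + (\<integral>\<^sup>+x. indicator {..< -a} (x + - a) * F (x + - a) \<partial>lborel)"
    by (rule nn_integral_add) auto
  also have "\<dots> = (\<integral>\<^sup>+x. indicator {a..} x * F x \<partial>lborel) + (\<integral>\<^sup>+x. indicator {..< -a} x * F x \<partial>lborel)"
    by (subst (1 2) nn_integral_lborel_translate[of "\<lambda>x. indicator _ x * F x"]) auto
  also have "\<dots> = (\<integral>\<^sup>+x. indicator {a..} x * F x + indicator {..< -a} x * F x \<partial>lborel)"
    by (rule nn_integral_add[symmetric]) auto
  also have "\<dots> \<le> (\<integral>\<^sup>+x. F x \<partial>lborel)"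
    using a by (intro nn_integral_mono) (auto simp: indicator_def)
  finally show ?thesis .
qed

lemma nn_integral_lborel_pair:
  fixes F :: "'a::euclidean_space \<times> 'b::euclidean_space \<Rightarrow> ennreal"
  assumes [measurable]: "F \<in> borel_measurable borel"
  shows "(\<integral>\<^sup>+X. F X \<partial>lborel) = (\<integral>\<^sup>+x. \<integral>\<^sup>+y. F (x, y) \<partial>lborel \<partial>lborel)"
    and "(\<integral>\<^sup>+X. F X \<partial>lborel) = (\<integral>\<^sup>+y. \<integral>\<^sup>+x. F (x, y) \<partial>lborel \<partial>lborel)"
proof -
  have m: "F \<in> borel_measurable (lborel \<Otimes>\<^sub>M lborel)" by (simp add: lborel_prod)
  show "(\<integral>\<^sup>+X. F X \<partial>lborel) = (\<integral>\<^sup>+x. \<integral>\<^sup>+y. F (x, y) \<partial>lborel \<partial>lborel)"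
    using lborel.nn_integral_fst[OF m] by (simp add: lborel_prod)
  show "(\<integral>\<^sup>+X. F X \<partial>lborel) = (\<integral>\<^sup>+y. \<integral>\<^sup>+x. F (x, y) \<partial>lborel \<partial>lborel)"
    using lborel_pair.nn_integral_snd[OF m] by (simp add: lborel_prod)
qed

lemma borel_measurable_fst_snd [measurable]:
  "fst \<in> borel_measurable (borel :: ('a::second_countable_topology \<times> 'b::second_countable_topology) measure)"
  "snd \<in> borel_measurable (borel :: ('a::second_countable_topology \<times> 'b::second_countable_topology) measure)"
  by (auto intro!: borel_measurable_continuous_onI continuous_intros)

lemma nn_integral_lborel_swap:
  fixes F :: "'a::euclidean_space \<Rightarrow> 'b::euclidean_space \<Rightarrow> ennreal"
  assumes "(\<lambda>p. F (fst p) (snd p)) \<in> borel_measurable borel"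
  shows "(\<integral>\<^sup>+x. \<integral>\<^sup>+y. F x y \<partial>lborel \<partial>lborel) = (\<integral>\<^sup>+y. \<integral>\<^sup>+x. F x y \<partial>lborel \<partial>lborel)"
  using nn_integral_lborel_pair[OF assms] by simp

lemma nn_integral_outward_fst_le:
  fixes F :: "real \<times> 'b::euclidean_space \<Rightarrow> ennreal"
  assumes [measurable]: "F \<in> borel_measurable borel" and "a \<ge> 0"
  shows "(\<integral>\<^sup>+X. F (outward a (fst X), snd X) \<partial>lborel) \<le> (\<integral>\<^sup>+X. F X \<partial>lborel)"
  by (simp add: nn_integral_lborel_pair(2)[of F]
      nn_integral_lborel_pair(2)[of "\<lambda>X. F (outward a (fst X), snd X)"]
      nn_integral_mono nn_integral_outward_le[of "\<lambda>x. F (x, _)"] \<open>a \<ge> 0\<close>)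

lemma GDERIV_line:
  assumes "\<And>X. GDERIV \<psi> X :> D X" and "(p has_vector_derivative v) (at t)"
  shows "((\<lambda>t. \<psi> (p t)) has_real_derivative (v \<bullet> D (p t))) (at t)"
proof -
  have "((\<lambda>t. \<psi> (p t)) has_derivative (\<lambda>h. (h *\<^sub>R v) \<bullet> D (p t))) (at t)"
    using has_derivative_compose[OF assms(2)[unfolded has_vector_derivative_def] assms(1)[unfolded gderiv_def]] .
  then show ?thesis by (simp add: has_field_derivative_def mult.commute[of _ "_ \<bullet> _"])
qed

lemma GDERIV_imp_continuous:
  assumes "\<And>X. GDERIV \<psi> X :> D X"
  shows "continuous_on UNIV \<psi>"
  using assms unfolding gderiv_def by (meson continuous_at_imp_continuous_on has_derivative_continuous)

text \<open>For fixed X the segment runs through the points given by \<open>outward (t * a)\<close>.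
  After exchanging the integrals over t and X, every intermediate position is again an outward map,
  which does not increase the integral.\<close>

lemma outward_increment_le:
  fixes \<psi> :: "real \<times> 'b::euclidean_space \<Rightarrow> real"
  assumes GD: "\<And>X. GDERIV \<psi> X :> D X" and cD: "continuous_on UNIV D" and a: "a \<ge> 0"
  shows "(\<integral>\<^sup>+X. ennreal ((\<psi> (outward a (fst X), snd X) - \<psi> X)\<^sup>2) \<partial>lborel)
      \<le> ennreal (a\<^sup>2) * (\<integral>\<^sup>+X. ennreal ((fst (D X))\<^sup>2) \<partial>lborel)"
proof -
  have [measurable]: "D \<in> borel_measurable borel" "\<psi> \<in> borel_measurable borel"
    using cD GDERIV_imp_continuous[OF GD] by (auto intro: borel_measurable_continuous_onI)
  define F where "F X = ennreal (a\<^sup>2) * ennreal ((fst (D X))\<^sup>2)" for X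
  have [measurable]: "F \<in> borel_measurable borel" unfolding F_def by measurable
  have pt: "ennreal ((\<psi> (outward a (fst X), snd X) - \<psi> X)\<^sup>2)
      \<le> (\<integral>\<^sup>+t. indicator {0..1} t * F (outward (t * a) (fst X), snd X) \<partial>lborel)" for X
  proof -
    obtain x y where X: "X = (x, y)" by (cases X)
    define e where "e = (if x \<ge> 0 then a else - a)"
    have o: "outward (t * a) x = x + t * e" for t by (auto simp: outward_def e_def)
    have "((\<lambda>t. \<psi> (x + t * e, y)) has_real_derivative ((e, 0) \<bullet> D (x + t * e, y))) (at t)" for t
      by (rule GDERIV_line[OF GD]) (auto intro!: derivative_eq_intros simp: has_vector_derivative_def)
    then have "ennreal ((\<psi> (x + 1 * e, y) - \<psi> (x + 0 * e, y))\<^sup>2)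
       \<le> (\<integral>\<^sup>+t. indicator {0..1} t * ennreal (((e, 0) \<bullet> D (x + t * e, y))\<^sup>2) \<partial>lborel)"
      by (rule increment_square_le) (intro continuous_intros continuous_on_compose2[OF cD] subset_UNIV)
    also have "\<dots> = (\<integral>\<^sup>+t. indicator {0..1} t * F (outward (t * a) x, y) \<partial>lborel)"
      by (rule nn_integral_cong) (auto simp: F_def o inner_prod_def power_mult_distrib e_def ennreal_mult)
    finally show ?thesis using o[of 1] by (simp add: X)
  qed
  have "(\<integral>\<^sup>+X. ennreal ((\<psi> (outward a (fst X), snd X) - \<psi> X)\<^sup>2) \<partial>lborel)
     \<le> (\<integral>\<^sup>+X. \<integral>\<^sup>+t. indicator {0..1} t * F (outward (t * a) (fst X), snd X) \<partial>lborel \<partial>lborel)"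
    by (intro nn_integral_mono pt)
  also have "\<dots> = (\<integral>\<^sup>+t. \<integral>\<^sup>+X. indicator {0..1} t * F (outward (t * a) (fst X), snd X) \<partial>lborel \<partial>lborel)"
    by (rule nn_integral_lborel_swap) measurable
  also have "\<dots> = (\<integral>\<^sup>+t. indicator {0..1} t * (\<integral>\<^sup>+X. F (outward (t * a) (fst X), snd X) \<partial>lborel) \<partial>lborel)"
    by (intro nn_integral_cong nn_integral_cmult) measurable
  also have "\<dots> \<le> (\<integral>\<^sup>+t. indicator {0..1::real} t * (\<integral>\<^sup>+X. F X \<partial>lborel) \<partial>lborel)"
    using a by (intro nn_integral_mono) (auto simp: indicator_def intro!: nn_integral_outward_fst_le)
  also have "\<dots> = (\<integral>\<^sup>+X. F X \<partial>lborel)" by (simp add: nn_integral_multc)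
  also have "\<dots> = ennreal (a\<^sup>2) * (\<integral>\<^sup>+X. ennreal ((fst (D X))\<^sup>2) \<partial>lborel)"
    unfolding F_def by (rule nn_integral_cmult) measurable
  finally show ?thesis .
qed

text \<open>On a single fibre the displacement is constant, hence a translation in y that preserves
  the integral; therefore \<open>c\<close> may be any measurable function of x. With c x = |x|^lam
  the right-hand side is the degenerate part of the energy.\<close>

lemma fibre_increment_le:
  fixes \<psi> :: "real \<times> 'b::euclidean_space \<Rightarrow> real"
  assumes GD: "\<And>X. GDERIV \<psi> X :> D X" and cD: "continuous_on UNIV D"
    and [measurable]: "c \<in> borel_measurable borel"
  shows "(\<integral>\<^sup>+X. ennreal ((\<psi> (fst X, snd X + c (fst X) *\<^sub>R z) - \<psi> X)\<^sup>2) \<partial>lborel)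
      \<le> ennreal ((norm z)\<^sup>2) * (\<integral>\<^sup>+X. ennreal ((norm (c (fst X) *\<^sub>R snd (D X)))\<^sup>2) \<partial>lborel)"
proof -
  have [measurable]: "D \<in> borel_measurable borel" "\<psi> \<in> borel_measurable borel"
    using cD GDERIV_imp_continuous[OF GD] by (auto intro: borel_measurable_continuous_onI)
  define F where "F X = ennreal ((norm z)\<^sup>2) * ennreal ((norm (c (fst X) *\<^sub>R snd (D X)))\<^sup>2)" for X
  have [measurable]: "F \<in> borel_measurable borel" unfolding F_def by measurable
  have pt: "ennreal ((\<psi> (x, y + c x *\<^sub>R z) - \<psi> (x, y))\<^sup>2)
      \<le> (\<integral>\<^sup>+t. indicator {0..1} t * F (x, y + (t * c x) *\<^sub>R z) \<partial>lborel)" for x y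
  proof -
    have "((\<lambda>t. \<psi> (x, y + (t * c x) *\<^sub>R z)) has_real_derivative ((0, c x *\<^sub>R z) \<bullet> D (x, y + (t * c x) *\<^sub>R z))) (at t)" for t
      by (rule GDERIV_line[OF GD]) (auto intro!: derivative_eq_intros simp: has_vector_derivative_def)
    then have "ennreal ((\<psi> (x, y + (1 * c x) *\<^sub>R z) - \<psi> (x, y + (0 * c x) *\<^sub>R z))\<^sup>2)
       \<le> (\<integral>\<^sup>+t. indicator {0..1} t * ennreal (((0, c x *\<^sub>R z) \<bullet> D (x, y + (t * c x) *\<^sub>R z))\<^sup>2) \<partial>lborel)"
      by (rule increment_square_le) (intro continuous_intros continuous_on_compose2[OF cD] subset_UNIV)
    also have "\<dots> \<le> (\<integral>\<^sup>+t. indicator {0..1} t * F (x, y + (t * c x) *\<^sub>R z) \<partial>lborel)"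
    proof (intro nn_integral_mono mult_left_mono)
      fix t
      have "((0, c x *\<^sub>R z) \<bullet> D (x, y + (t * c x) *\<^sub>R z))\<^sup>2 = (z \<bullet> (c x *\<^sub>R snd (D (x, y + (t * c x) *\<^sub>R z))))\<^sup>2"
        by (simp add: inner_prod_def)
      also have "\<dots> \<le> (norm z * norm (c x *\<^sub>R snd (D (x, y + (t * c x) *\<^sub>R z))))\<^sup>2"
        using Cauchy_Schwarz_ineq2[of z "c x *\<^sub>R snd (D (x, y + (t * c x) *\<^sub>R z))"]
        by (metis abs_ge_zero abs_le_square_iff abs_of_nonneg order_trans)
      finally show "ennreal (((0, c x *\<^sub>R z) \<bullet> D (x, y + (t * c x) *\<^sub>R z))\<^sup>2) \<le> F (x, y + (t * c x) *\<^sub>R z)"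
        by (simp add: F_def ennreal_mult[symmetric] power_mult_distrib del: norm_scaleR)
    qed auto
    finally show ?thesis by simp
  qed
  have "(\<integral>\<^sup>+X. ennreal ((\<psi> (fst X, snd X + c (fst X) *\<^sub>R z) - \<psi> X)\<^sup>2) \<partial>lborel)
     = (\<integral>\<^sup>+x. \<integral>\<^sup>+y. ennreal ((\<psi> (x, y + c x *\<^sub>R z) - \<psi> (x, y))\<^sup>2) \<partial>lborel \<partial>lborel)"
    by (subst nn_integral_lborel_pair(1)) auto
  also have "\<dots> \<le> (\<integral>\<^sup>+x. \<integral>\<^sup>+y. \<integral>\<^sup>+t. indicator {0..1} t * F (x, y + (t * c x) *\<^sub>R z) \<partial>lborel \<partial>lborel \<partial>lborel)"
    by (intro nn_integral_mono pt)
  also have "\<dots> = (\<integral>\<^sup>+x. \<integral>\<^sup>+t. \<integral>\<^sup>+y. indicator {0..1} t * F (x, y + (t * c x) *\<^sub>R z) \<partial>lborel \<partial>lborel \<partial>lborel)"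
    by (intro nn_integral_cong nn_integral_lborel_swap) measurable
  also have "\<dots> = (\<integral>\<^sup>+x. \<integral>\<^sup>+t. indicator {0..1::real} t * (\<integral>\<^sup>+y. F (x, y) \<partial>lborel) \<partial>lborel \<partial>lborel)"
    by (intro nn_integral_cong, subst nn_integral_cmult, measurable)
       (auto intro!: arg_cong2[where f="(*)"] nn_integral_lborel_translate[of "\<lambda>y. F (_, y)"])
  also have "\<dots> = (\<integral>\<^sup>+x. \<integral>\<^sup>+y. F (x, y) \<partial>lborel \<partial>lborel)" by (simp add: nn_integral_multc)
  also have "\<dots> = (\<integral>\<^sup>+X. F X \<partial>lborel)" by (subst nn_integral_lborel_pair(1)) auto
  also have "\<dots> = ennreal ((norm z)\<^sup>2) * (\<integral>\<^sup>+X. ennreal ((norm (c (fst X) *\<^sub>R snd (D X)))\<^sup>2) \<partial>lborel)"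
    unfolding F_def by (rule nn_integral_cmult) measurable
  finally show ?thesis .
qed

section \<open>A Faber-Krahn inequality for the Grushin energy\<close>

text \<open>
  First away from \<open>x = 0\<close> by \<open>s\<close>, which makes the weight at least \<open>s\<close> to the power \<open>lam\<close>, then by \<open>z\<close>
  along the rescaled fibre. The hop costs an increment of order \<open>s + |z|\<close>, independently of \<open>X\<close>.
\<close>
definition hop :: "real \<Rightarrow> real \<times> 'b::euclidean_space \<Rightarrow> real \<times> 'b \<Rightarrow> real \<times> 'b" where
  "hop lam p X = (outward (fst p) (fst X), snd X + (\<bar>outward (fst p) (fst X)\<bar> powr lam) *\<^sub>R snd p)"

lemma hop_measurable [measurable (raw)]:
  fixes f g :: "'a \<Rightarrow> real \<times> 'b::euclidean_space"
  assumes [measurable]: "f \<in> borel_measurable M" "g \<in> borel_measurable M"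
  shows "(\<lambda>w. hop lam (f w) (g w)) \<in> borel_measurable M"
  unfolding hop_def by measurable

lemma norm_grushin_sqrtA:
  "(norm (grushin_sqrtA lam X Z))\<^sup>2 = (fst Z)\<^sup>2 + (norm ((\<bar>fst X\<bar> powr lam) *\<^sub>R snd Z))\<^sup>2"
  by (simp add: grushin_sqrtA_def norm_prod_def)

lemma grushin_sqrtA_measurable [measurable (raw)]:
  assumes [measurable]: "f \<in> borel_measurable M" "g \<in> borel_measurable M"
  shows "(\<lambda>w. grushin_sqrtA lam (f w) (g w)) \<in> borel_measurable M"
  unfolding grushin_sqrtA_def by measurable

text \<open>The hop is split at the point reached by the outward step. The fibre step starts there,
  so its cost is evaluated at moved points, and the outward substitution brings it back to X without
  loss.\<close>

lemma hop_increment_le: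
  fixes \<psi> :: "real \<times> (real ^ 'm) \<Rightarrow> real"
  assumes GD: "\<And>X. GDERIV \<psi> X :> D X" and cD: "continuous_on UNIV D" and s: "s \<ge> 0"
  shows "(\<integral>\<^sup>+X. ennreal ((\<psi> X - \<psi> (hop lam (s, z) X))\<^sup>2) \<partial>lborel)
     \<le> ennreal (2 * (s\<^sup>2 + (norm z)\<^sup>2)) * (\<integral>\<^sup>+X. ennreal ((norm (grushin_sqrtA lam X (D X)))\<^sup>2) \<partial>lborel)"
proof -
  have [measurable]: "D \<in> borel_measurable borel" "\<psi> \<in> borel_measurable borel"
    using cD GDERIV_imp_continuous[OF GD] by (auto intro: borel_measurable_continuous_onI)
  define c where "c = (\<lambda>x::real. \<bar>x\<bar> powr lam)"
  have [measurable]: "c \<in> borel_measurable borel" unfolding c_def by measurable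
  let ?o = "\<lambda>X. (outward s (fst X), snd X)"
  define K where "K X = ennreal ((\<psi> (fst X, snd X + c (fst X) *\<^sub>R z) - \<psi> X)\<^sup>2)" for X
  have [measurable]: "K \<in> borel_measurable borel" unfolding K_def by measurable
  define A where "A = (\<integral>\<^sup>+X. ennreal ((fst (D X))\<^sup>2) \<partial>lborel)"
  define B where "B = (\<integral>\<^sup>+X. ennreal ((norm (c (fst X) *\<^sub>R snd (D X)))\<^sup>2) \<partial>lborel)"
  have AB: "(\<integral>\<^sup>+X. ennreal ((norm (grushin_sqrtA lam X (D X)))\<^sup>2) \<partial>lborel) = A + B"
    unfolding norm_grushin_sqrtA A_def B_def c_def
    by (subst nn_integral_add[symmetric]) (auto simp del: norm_scaleR intro!: nn_integral_cong)
  have "(\<integral>\<^sup>+X. ennreal ((\<psi> X - \<psi> (hop lam (s, z) X))\<^sup>2) \<partial>lborel)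
     \<le> (\<integral>\<^sup>+X. 2 * ennreal ((\<psi> (?o X) - \<psi> X)\<^sup>2) + 2 * K (?o X) \<partial>lborel)"
  proof (rule nn_integral_mono)
    fix X :: "real \<times> (real ^ 'm)"
    have "(a - b)\<^sup>2 \<le> 2 * (d - a)\<^sup>2 + 2 * (b - d)\<^sup>2" for a b d :: real
      using zero_le_power2[of "(d - a) - (b - d)"] by (simp add: power2_eq_square algebra_simps)
    then show "ennreal ((\<psi> X - \<psi> (hop lam (s, z) X))\<^sup>2) \<le> 2 * ennreal ((\<psi> (?o X) - \<psi> X)\<^sup>2) + 2 * K (?o X)"
      unfolding K_def by (simp add: hop_def c_def ennreal_mult'[symmetric] ennreal_plus[symmetric]
         ennreal_numeral[symmetric] ennreal_leI del: ennreal_plus ennreal_numeral)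
  qed
  also have "\<dots> = 2 * (\<integral>\<^sup>+X. ennreal ((\<psi> (?o X) - \<psi> X)\<^sup>2) \<partial>lborel) + 2 * (\<integral>\<^sup>+X. K (?o X) \<partial>lborel)"
    by (subst nn_integral_add) (auto simp: nn_integral_cmult)
  also have "\<dots> \<le> 2 * (ennreal (s\<^sup>2) * A) + 2 * (ennreal ((norm z)\<^sup>2) * B)"
    using nn_integral_outward_fst_le[of K s] fibre_increment_le[OF GD cD, of c z]
    unfolding A_def B_def
    by (intro add_mono mult_left_mono outward_increment_le[OF GD cD s] order_trans[OF nn_integral_outward_fst_le])
       (auto simp: K_def s)
  also have "\<dots> \<le> ennreal (2 * (s\<^sup>2 + (norm z)\<^sup>2)) * A + ennreal (2 * (s\<^sup>2 + (norm z)\<^sup>2)) * B"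
    by (intro add_mono) (auto simp: ennreal_mult' mult.assoc distrib_right)
  finally show ?thesis by (simp add: AB distrib_left)
qed

text \<open>A change of variables in the parameter with X fixed. In s the map is x + s or x - s and
  preserves measure; in z it is a dilation by at least rho^lam, because the outward step has already
  secured |x| >= rho.\<close>

lemma hop_hits_le:
  fixes S :: "(real \<times> 'b::euclidean_space) set"
  assumes [measurable]: "S \<in> sets borel" and "\<rho> > 0" "lam \<ge> 0"
  shows "(\<integral>\<^sup>+p. indicator ({\<rho>..2*\<rho>} \<times> C) p * indicator S (hop lam p X) \<partial>lborel)
     \<le> ennreal (1 / (\<rho> powr lam) ^ DIM('b)) * emeasure lborel S"
proof -
  obtain x y where X: "X = (x, y)" by (cases X)
  define h where "h x' = (\<integral>\<^sup>+w. indicator S (x', w) \<partial>(lborel :: 'b measure))" for x' :: real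
  have [measurable]: "h \<in> borel_measurable borel" unfolding h_def by measurable
  let ?k = "ennreal (1 / (\<rho> powr lam) ^ DIM('b))"
  have "(\<integral>\<^sup>+p. indicator ({\<rho>..2*\<rho>} \<times> C) p * indicator S (hop lam p X) \<partial>lborel)
     \<le> (\<integral>\<^sup>+p. indicator {\<rho>..2*\<rho>} (fst p) * indicator S (hop lam p X) \<partial>lborel)"
    by (intro nn_integral_mono mult_right_mono) (auto simp: indicator_def)
  also have "\<dots> = (\<integral>\<^sup>+s. indicator {\<rho>..2*\<rho>} s *
       (\<integral>\<^sup>+z. indicator S (outward s x, y + (\<bar>outward s x\<bar> powr lam) *\<^sub>R z) \<partial>lborel) \<partial>lborel)"
    by (subst nn_integral_lborel_pair(1)) (auto simp: hop_def X nn_integral_cmult)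
  also have "\<dots> \<le> (\<integral>\<^sup>+s. ?k * h (outward s x) \<partial>lborel)"
  proof (rule nn_integral_mono)
    fix s
    show "indicator {\<rho>..2*\<rho>} s * (\<integral>\<^sup>+z. indicator S (outward s x, y + (\<bar>outward s x\<bar> powr lam) *\<^sub>R z) \<partial>lborel)
       \<le> ?k * h (outward s x)"
    proof (cases "s \<in> {\<rho>..2*\<rho>}")
      case True
      then have "\<rho> \<le> \<bar>outward s x\<bar>" using \<open>\<rho> > 0\<close> by (subst abs_outward) auto
      then have le: "\<rho> powr lam \<le> \<bar>outward s x\<bar> powr lam" using assms by (intro powr_mono2) auto
      have pos: "\<rho> powr lam > 0" using assms by simp
      have "(\<integral>\<^sup>+z. indicator S (outward s x, y + (\<bar>outward s x\<bar> powr lam) *\<^sub>R z) \<partial>lborel)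
        = ennreal (1 / (\<bar>outward s x\<bar> powr lam) ^ DIM('b)) * h (outward s x)"
        unfolding h_def using le pos
        by (intro nn_integral_lborel_scale[of "\<lambda>w. indicator S (outward s x, w)"]) (measurable, linarith)
      also have "\<dots> \<le> ?k * h (outward s x)"
        using le pos by (intro mult_right_mono ennreal_leI divide_left_mono power_mono mult_pos_pos zero_less_power) auto
      finally show ?thesis using True by simp
    qed simp
  qed
  also have "\<dots> = ?k * (\<integral>\<^sup>+s. h (outward s x) \<partial>lborel)" by (rule nn_integral_cmult) measurable
  also have "(\<integral>\<^sup>+s. h (outward s x) \<partial>lborel) = (\<integral>\<^sup>+s. h s \<partial>lborel)"
    using nn_integral_real_affine[of h "if x \<ge> 0 then 1 else - 1" x]
    by (auto simp: outward_def split: if_splits)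
  also have "\<dots> = emeasure lborel S"
    unfolding h_def by (subst nn_integral_lborel_pair(1)[symmetric, of "indicator S"]) auto
  finally show ?thesis .
qed

lemma emeasure_cube:
  assumes "\<rho> > 0"
  shows "emeasure lborel ({\<rho>..2*\<rho>} \<times> cbox 0 (\<rho> *\<^sub>R One :: 'b::euclidean_space)) = ennreal (\<rho> ^ (1 + DIM('b)))"
proof -
  have "emeasure lborel ({\<rho>..2*\<rho>} \<times> cbox 0 (\<rho> *\<^sub>R One :: 'b)) = emeasure lborel {\<rho>..2*\<rho>} * emeasure lborel (cbox 0 (\<rho> *\<^sub>R One :: 'b))"
    unfolding lborel_prod[symmetric] by (rule lborel.emeasure_pair_measure_Times) auto
  then show ?thesis using assms by (simp add: ennreal_mult[symmetric])
qed

text \<open>Average over the box \<open>P\<close> of parameters. Where the hop lands in a zero of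
  \<psi>, the increment is \<psi> X itself, and this happens for at least half of \<open>P\<close>,
  which costs a factor 2. In \<open>P\<close> one has s <= 2 rho and |z| <= m rho, so one hop costs
  at most 2 (4 + m^2) rho^2 times the energy.\<close>

lemma faber_krahn:
  fixes \<psi> :: "real \<times> (real ^ 'm) \<Rightarrow> real"
  assumes GD: "\<And>X. GDERIV \<psi> X :> D X" and cD: "continuous_on UNIV D"
    and lam: "lam \<ge> 0" and \<rho>: "\<rho> > 0"
    and small: "2 * emeasure lborel {X. \<psi> X \<noteq> 0} \<le> ennreal (\<rho> powr (1 + real CARD('m) + lam * real CARD('m)))"
  shows "(\<integral>\<^sup>+X. ennreal ((\<psi> X)\<^sup>2) \<partial>lborel)
     \<le> ennreal (4 * (4 + (real CARD('m))\<^sup>2) * \<rho>\<^sup>2) * (\<integral>\<^sup>+X. ennreal ((norm (grushin_sqrtA lam X (D X)))\<^sup>2) \<partial>lborel)"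
proof -
  have [measurable]: "D \<in> borel_measurable borel" "\<psi> \<in> borel_measurable borel"
    using cD GDERIV_imp_continuous[OF GD] by (auto intro: borel_measurable_continuous_onI)
  define S where "S = {X. \<psi> X \<noteq> 0}"
  have [measurable]: "S \<in> sets borel" unfolding S_def by measurable
  define P where "P = {\<rho>..2*\<rho>} \<times> cbox 0 (\<rho> *\<^sub>R One :: real ^ 'm)"
  have [measurable]: "P \<in> sets borel" unfolding P_def by (intro borel_closed closed_Times) auto
  define v where "v = \<rho> ^ (1 + CARD('m))"
  have v: "v > 0" "emeasure lborel P = ennreal v"
    using \<rho> emeasure_cube[of \<rho>, where 'b="real^'m"] by (auto simp: v_def P_def)
  define E where "E = (\<integral>\<^sup>+X. ennreal ((norm (grushin_sqrtA lam X (D X)))\<^sup>2) \<partial>lborel)"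
  let ?k = "ennreal (1 / (\<rho> powr lam) ^ CARD('m))"
  have eq: "\<rho> powr (1 + real CARD('m) + lam * real CARD('m)) = v * (\<rho> powr lam) ^ CARD('m)"
    using \<rho> by (simp add: v_def powr_add powr_powr powr_realpow[symmetric])
  \<comment> \<open>rho^Q is the volume \<open>v\<close> of the box times rho^(lam m). Dividing the
    smallness hypothesis by the latter bounds the parameters that hit \<open>S\<close> by half of
    \<open>v\<close>.\<close>
  have "2 * (?k * emeasure lborel S) \<le> ?k * ennreal (v * (\<rho> powr lam) ^ CARD('m))"
    using mult_left_mono[OF small, of ?k] by (simp add: eq S_def mult_ac)
  also have "\<dots> = ennreal v" using \<rho> v(1) by (simp add: ennreal_mult[symmetric])
  finally have hit: "2 * (?k * emeasure lborel S) \<le> ennreal v" .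
  define I where "I X = (\<integral>\<^sup>+p. indicator P p * ennreal ((\<psi> X - \<psi> (hop lam p X))\<^sup>2) \<partial>lborel)" for X
  have ptw: "ennreal v * ennreal ((\<psi> X)\<^sup>2) \<le> 2 * I X" for X
  proof -
    define c where "c = v / 2 * (\<psi> X)\<^sup>2"
    have c0: "c \<ge> 0" using v by (simp add: c_def)
    let ?h = "(\<integral>\<^sup>+p. indicator P p * indicator S (hop lam p X) \<partial>lborel)"
    have "?h \<le> ?k * emeasure lborel S"
      using hop_hits_le[of S \<rho> lam "cbox 0 (\<rho> *\<^sub>R One)" X] \<rho> lam by (simp add: P_def)
    then have "2 * ?h \<le> ennreal v" using hit by (meson mult_left_mono order_trans zero_le)
    then have "?h \<le> ennreal (v / 2)"
      using v ennreal_mult_le_mult_iff[of 2 ?h "ennreal (v / 2)"]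
      by (simp add: ennreal_mult'[symmetric] ennreal_numeral[symmetric] del: ennreal_numeral)
    then have "?h * ennreal ((\<psi> X)\<^sup>2) \<le> ennreal (v / 2) * ennreal ((\<psi> X)\<^sup>2)"
      by (rule mult_right_mono) simp
    then have 1: "?h * ennreal ((\<psi> X)\<^sup>2) \<le> ennreal c"
      using v by (simp add: c_def ennreal_mult[symmetric])
    have "ennreal v * ennreal ((\<psi> X)\<^sup>2) = (\<integral>\<^sup>+p. indicator P p * ennreal ((\<psi> X)\<^sup>2) \<partial>lborel)"
      by (simp add: nn_integral_multc v)
    also have "\<dots> \<le> (\<integral>\<^sup>+p. indicator P p * ennreal ((\<psi> X - \<psi> (hop lam p X))\<^sup>2)
                     + indicator P p * indicator S (hop lam p X) * ennreal ((\<psi> X)\<^sup>2) \<partial>lborel)"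
      by (rule nn_integral_mono) (auto simp: indicator_def S_def)
    also have "\<dots> = I X + ?h * ennreal ((\<psi> X)\<^sup>2)"
      unfolding I_def by (subst nn_integral_add) (auto simp: nn_integral_multc)
    also have "\<dots> \<le> I X + ennreal c" by (intro add_left_mono 1)
    \<comment> \<open>\<open>c\<close> is half of the left-hand side and finite, so one copy can be
      cancelled.\<close>
    finally have "ennreal c + ennreal c \<le> I X + ennreal c"
      using c0 v by (simp add: c_def ennreal_mult[symmetric] ennreal_plus[symmetric] del: ennreal_plus)
    then have "ennreal c \<le> I X" by (simp add: add.commute ennreal_add_left_cancel_le)
    then have "2 * ennreal c \<le> 2 * I X" by (rule mult_left_mono) simp
    then show ?thesis using v c0
      by (simp add: c_def ennreal_mult[symmetric] ennreal_mult'[symmetric] ennreal_numeral[symmetric] del: ennreal_numeral)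
  qed
  have nz: "(norm z)\<^sup>2 \<le> (real CARD('m))\<^sup>2 * \<rho>\<^sup>2" if "z \<in> cbox 0 (\<rho> *\<^sub>R One)" for z :: "real ^ 'm"
  proof -
    have "norm z \<le> (\<Sum>b\<in>Basis. \<bar>z \<bullet> b\<bar>)" by (rule norm_le_l1)
    also have "\<dots> \<le> (\<Sum>b\<in>(Basis :: (real ^ 'm) set). \<rho>)"
      using that by (intro sum_mono) (auto simp: mem_box)
    also have "\<dots> = real CARD('m) * \<rho>" by simp
    finally have "norm z \<le> real CARD('m) * \<rho>" .
    then show ?thesis using power_mono[of "norm z" _ 2] by (metis norm_ge_zero power_mult_distrib)
  qed
  have "ennreal v * (\<integral>\<^sup>+X. ennreal ((\<psi> X)\<^sup>2) \<partial>lborel) = (\<integral>\<^sup>+X. ennreal v * ennreal ((\<psi> X)\<^sup>2) \<partial>lborel)"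
    by (rule nn_integral_cmult[symmetric]) measurable
  also have "\<dots> \<le> (\<integral>\<^sup>+X. 2 * I X \<partial>lborel)" by (intro nn_integral_mono ptw)
  also have "\<dots> = 2 * (\<integral>\<^sup>+X. I X \<partial>lborel)"
    unfolding I_def by (rule nn_integral_cmult) measurable
  also have "(\<integral>\<^sup>+X. I X \<partial>lborel) = (\<integral>\<^sup>+p. \<integral>\<^sup>+X. indicator P p * ennreal ((\<psi> X - \<psi> (hop lam p X))\<^sup>2) \<partial>lborel \<partial>lborel)"
    unfolding I_def by (rule nn_integral_lborel_swap) measurable
  also have "\<dots> = (\<integral>\<^sup>+p. indicator P p * (\<integral>\<^sup>+X. ennreal ((\<psi> X - \<psi> (hop lam p X))\<^sup>2) \<partial>lborel) \<partial>lborel)"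
    by (intro nn_integral_cong nn_integral_cmult) measurable
  also have "\<dots> \<le> (\<integral>\<^sup>+p. indicator P p * (ennreal (2 * (4 + (real CARD('m))\<^sup>2) * \<rho>\<^sup>2) * E) \<partial>lborel)"
  proof (intro nn_integral_mono)
    fix p :: "real \<times> (real ^ 'm)"
    obtain s z where p: "p = (s, z)" by (cases p)
    show "indicator P p * (\<integral>\<^sup>+X. ennreal ((\<psi> X - \<psi> (hop lam p X))\<^sup>2) \<partial>lborel)
      \<le> indicator P p * (ennreal (2 * (4 + (real CARD('m))\<^sup>2) * \<rho>\<^sup>2) * E)"
    proof (cases "p \<in> P")
      case True
      then have s: "\<rho> \<le> s" "s \<le> 2 * \<rho>" and z: "z \<in> cbox 0 (\<rho> *\<^sub>R One)" by (auto simp: P_def p)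
      have "s\<^sup>2 \<le> 4 * \<rho>\<^sup>2" using s \<rho> power_mono[of s "2 * \<rho>" 2] by (simp add: power_mult_distrib)
      then have "2 * (s\<^sup>2 + (norm z)\<^sup>2) \<le> 2 * (4 + (real CARD('m))\<^sup>2) * \<rho>\<^sup>2" using nz[OF z] by (simp add: algebra_simps)
      then have "(\<integral>\<^sup>+X. ennreal ((\<psi> X - \<psi> (hop lam p X))\<^sup>2) \<partial>lborel) \<le> ennreal (2 * (4 + (real CARD('m))\<^sup>2) * \<rho>\<^sup>2) * E"
        using hop_increment_le[OF GD cD, of s lam z] s \<rho> unfolding p E_def
        by (meson ennreal_leI less_imp_le mult_right_mono order_trans zero_le)
      then show ?thesis by (rule mult_left_mono) simp
    qed simp
  qed
  also have "\<dots> = ennreal v * (ennreal (2 * (4 + (real CARD('m))\<^sup>2) * \<rho>\<^sup>2) * E)"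
    by (simp add: nn_integral_multc v)
  finally have "ennreal v * (\<integral>\<^sup>+X. ennreal ((\<psi> X)\<^sup>2) \<partial>lborel)
     \<le> ennreal v * (2 * (ennreal (2 * (4 + (real CARD('m))\<^sup>2) * \<rho>\<^sup>2) * E))"
    by (simp add: mult_left_mono mult.left_commute)
  then have "(\<integral>\<^sup>+X. ennreal ((\<psi> X)\<^sup>2) \<partial>lborel) \<le> 2 * (ennreal (2 * (4 + (real CARD('m))\<^sup>2) * \<rho>\<^sup>2) * E)"
    using v by (subst (asm) ennreal_mult_le_mult_iff) auto
  also have "\<dots> = ennreal (4 * (4 + (real CARD('m))\<^sup>2) * \<rho>\<^sup>2) * E"
    by (simp add: mult.assoc[symmetric] ennreal_mult'[symmetric] ennreal_numeral[symmetric] del: ennreal_numeral)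
  finally show ?thesis unfolding E_def .
qed

section \<open>Truncation and the Sobolev inequality\<close>

text \<open>The squared positive part is C^1: at the kink the difference quotient is at most |h|.
  Linear combinations of it give \<open>trunc\<close> and, in the boundedness proof, a smoothed (t -
  k)^+.\<close>

lemma DERIV_sqplus:
  fixes a s :: real
  shows "((\<lambda>s. (max 0 (s - a))\<^sup>2) has_real_derivative 2 * max 0 (s - a)) (at s)"
proof -
  consider "s < a" | "s > a" | "s = a" by linarith
  then show ?thesis
  proof cases
    case 1
    have "((\<lambda>s. 0) has_real_derivative 0) (at s)" by simp
    then show ?thesis using 1
      by (simp add: max_def) (rule has_field_derivative_transform_within_open[where S = "{..<a}"], auto)
  next
    case 2
    have "((\<lambda>s. (s - a)\<^sup>2) has_real_derivative 2 * (s - a)) (at s)" by (auto intro!: derivative_eq_intros)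
    then show ?thesis using 2
      by (simp add: max_def) (rule has_field_derivative_transform_within_open[where S = "{a<..}"], auto)
  next
    case 3
    have "((\<lambda>h. (max 0 h)\<^sup>2 / h) \<longlongrightarrow> 0) (at (0::real))"
    proof (rule Lim_null_comparison)
      show "\<forall>\<^sub>F h in at 0. norm ((max 0 h)\<^sup>2 / h) \<le> \<bar>h\<bar>"
        by (intro always_eventually) (auto simp: max_def power2_eq_square)
      show "((\<lambda>h. \<bar>h\<bar>) \<longlongrightarrow> 0) (at (0::real))"
        using tendsto_rabs[OF tendsto_ident_at, of "0::real"] by simp
    qed
    then show ?thesis unfolding DERIV_def by (simp add: 3)
  qed
qed

text \<open>A \<open>C\<^sup>1\<close> version of truncation between the heights \<open>t\<close> and \<open>2t\<close>; the plateau has height \<open>t/2\<close>.\<close>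
definition trunc :: "real \<Rightarrow> real \<Rightarrow> real" where
  "trunc t s = ((max 0 (s - t))\<^sup>2 - 2 * (max 0 (s - 3/2 * t))\<^sup>2 + (max 0 (s - 2 * t))\<^sup>2) / t"

text \<open>A tent of height 1 over the interval from t to 2t with peak at 3t/2; its area is the
  plateau height t/2.\<close>

definition trunc' :: "real \<Rightarrow> real \<Rightarrow> real" where
  "trunc' t s = (2 * max 0 (s - t) - 4 * max 0 (s - 3/2 * t) + 2 * max 0 (s - 2 * t)) / t"

lemma DERIV_trunc: "(trunc t has_real_derivative trunc' t s) (at s)"
proof -
  have "((\<lambda>s. ((max 0 (s - t))\<^sup>2 - 2 * (max 0 (s - 3/2 * t))\<^sup>2 + (max 0 (s - 2 * t))\<^sup>2) / t) has_real_derivative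
    (2 * max 0 (s - t) - 2 * (2 * max 0 (s - 3/2 * t)) + 2 * max 0 (s - 2 * t)) / t) (at s)"
    by (intro DERIV_cdivide DERIV_add DERIV_diff DERIV_cmult DERIV_sqplus)
  then show ?thesis unfolding trunc_def[abs_def] trunc'_def by simp
qed

lemma trunc_eq:
  assumes "t > 0"
  shows "s \<le> t \<Longrightarrow> trunc t s = 0" "s \<ge> 2 * t \<Longrightarrow> trunc t s = t / 2"
    "s \<le> t \<Longrightarrow> trunc' t s = 0" "s \<ge> 2 * t \<Longrightarrow> trunc' t s = 0"
    "0 \<le> trunc' t s" "trunc' t s \<le> 1"
  using assms by (auto simp: trunc_def trunc'_def max_def field_simps power2_eq_square)

lemma continuous_on_trunc': "t > 0 \<Longrightarrow> continuous_on A (trunc' t)"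
  unfolding trunc'_def by (intro continuous_intros) auto

text \<open>Faber-Krahn for \<open>trunc t (\<psi> X)\<close>: it lives on {\<psi> > t}, equals t/2
  on {\<psi> > 2t}, and its gradient sees only the band in between. The radius is the least one
  allowed, rho^Q = 2a, whence 2 powr (2 / Q). The 16 is the 4 of Faber-Krahn times the 4 from
  squaring t/2.\<close>

lemma level_set_decay:
  fixes \<psi> :: "real \<times> (real ^ 'm) \<Rightarrow> real"
  assumes GD: "\<And>X. GDERIV \<psi> X :> D X" and cD: "continuous_on UNIV D" and lam: "lam \<ge> 0"
    and Q: "Q = 1 + real CARD('m) + lam * real CARD('m)"
    and fin: "emeasure lborel {X. \<psi> X \<noteq> 0} < \<infinity>" and t: "t > 0"
    and c: "c = 16 * (4 + (real CARD('m))\<^sup>2) * 2 powr (2 / Q)"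
  shows "ennreal (t\<^sup>2 * measure lborel {X. 2 * t < \<psi> X})
     \<le> ennreal (c * measure lborel {X. t < \<psi> X} powr (2 / Q)) *
        (\<integral>\<^sup>+X. indicator {X. t < \<psi> X \<and> \<psi> X < 2 * t} X * ennreal ((norm (grushin_sqrtA lam X (D X)))\<^sup>2) \<partial>lborel)"
    (is "_ \<le> _ * ?E")
proof -
  have [measurable]: "D \<in> borel_measurable borel" "\<psi> \<in> borel_measurable borel"
    using cD GDERIV_imp_continuous[OF GD] by (auto intro: borel_measurable_continuous_onI)
  have Q0: "Q > 0" using lam unfolding Q by (simp add: add_pos_nonneg)
  have fin': "emeasure lborel {X. b < \<psi> X} < \<infinity>" if "b \<ge> 0" for b
  proof -
    have "emeasure lborel {X. b < \<psi> X} \<le> emeasure lborel {X. \<psi> X \<noteq> 0}" using that by (intro emeasure_mono) auto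
    then show ?thesis using fin by (rule le_less_trans)
  qed
  define a where "a = measure lborel {X. t < \<psi> X}"
  have a: "emeasure lborel {X. t < \<psi> X} = ennreal a" "a \<ge> 0"
    using fin'[of t] t by (auto simp: a_def emeasure_eq_ennreal_measure)
  define b where "b = measure lborel {X. 2 * t < \<psi> X}"
  have b: "emeasure lborel {X. 2 * t < \<psi> X} = ennreal b" "b \<ge> 0"
    using fin'[of "2 * t"] t by (auto simp: b_def emeasure_eq_ennreal_measure)
  have "ennreal b \<le> ennreal a" unfolding a(1)[symmetric] b(1)[symmetric] using t by (intro emeasure_mono) auto
  then have ba: "b \<le> a" using a(2) by simp
  show ?thesis
  \<comment> \<open>The radius must be positive, which excludes a = 0; in that case b = 0 as well
    and the left-hand side vanishes.\<close>
  proof (cases "a = 0")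
    case True then show ?thesis using ba b(2) by (simp add: b_def[symmetric])
  next
    case False
    define \<rho> where "\<rho> = (2 * a) powr (1 / Q)"
    have \<rho>: "\<rho> > 0" using False a(2) by (simp add: \<rho>_def)
    have \<rho>Q: "\<rho> powr Q = 2 * a" using False a(2) Q0 by (simp add: \<rho>_def powr_powr)
    have \<rho>2: "\<rho>\<^sup>2 = 2 powr (2 / Q) * a powr (2 / Q)"
      using False a(2) Q0 by (simp add: \<rho>_def powr_powr powr_mult powr_realpow[symmetric] del: powr_realpow power_numeral powr_numeral)
    define D' where "D' X = trunc' t (\<psi> X) *\<^sub>R D X" for X
    have GD': "GDERIV (\<lambda>X. trunc t (\<psi> X)) X :> D' X" for X
      unfolding D'_def by (rule GDERIV_DERIV_compose[OF GD DERIV_trunc])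
    have cD': "continuous_on UNIV D'"
      unfolding D'_def by (intro continuous_intros cD continuous_on_compose2[OF continuous_on_trunc'[OF t, of UNIV]] GDERIV_imp_continuous[OF GD]) auto
    have "2 * emeasure lborel {X. trunc t (\<psi> X) \<noteq> 0} \<le> 2 * ennreal a"
      unfolding a(1)[symmetric] using trunc_eq(1)[OF t] by (intro mult_left_mono emeasure_mono) (auto simp: not_le[symmetric])
    then have small: "2 * emeasure lborel {X. trunc t (\<psi> X) \<noteq> 0} \<le> ennreal (\<rho> powr (1 + real CARD('m) + lam * real CARD('m)))"
      using a(2) by (simp add: Q[symmetric] \<rho>Q ennreal_mult)
    have "ennreal (t\<^sup>2 / 4 * b) = (\<integral>\<^sup>+X. ennreal (t\<^sup>2 / 4) * indicator {X. 2 * t < \<psi> X} X \<partial>lborel)"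
      using b by (subst nn_integral_cmult_indicator) (auto simp: ennreal_mult[symmetric])
    also have "\<dots> \<le> (\<integral>\<^sup>+X. ennreal ((trunc t (\<psi> X))\<^sup>2) \<partial>lborel)"
      by (intro nn_integral_mono) (auto simp: indicator_def power_divide trunc_eq(2)[OF t, OF less_imp_le])
    also have "\<dots> \<le> ennreal (4 * (4 + (real CARD('m))\<^sup>2) * \<rho>\<^sup>2) * (\<integral>\<^sup>+X. ennreal ((norm (grushin_sqrtA lam X (D' X)))\<^sup>2) \<partial>lborel)"
      by (rule faber_krahn[OF GD' cD' lam \<rho> small])
    also have "\<dots> \<le> ennreal (4 * (4 + (real CARD('m))\<^sup>2) * \<rho>\<^sup>2) * ?E"
    proof (intro mult_left_mono nn_integral_mono)
      fix X
      have "grushin_sqrtA lam X (D' X) = trunc' t (\<psi> X) *\<^sub>R grushin_sqrtA lam X (D X)"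
        by (simp add: grushin_sqrtA_def D'_def)
      then have eq: "(norm (grushin_sqrtA lam X (D' X)))\<^sup>2 = (trunc' t (\<psi> X))\<^sup>2 * (norm (grushin_sqrtA lam X (D X)))\<^sup>2"
        by (simp add: power_mult_distrib)
      show "ennreal ((norm (grushin_sqrtA lam X (D' X)))\<^sup>2) \<le> indicator {X. t < \<psi> X \<and> \<psi> X < 2 * t} X * ennreal ((norm (grushin_sqrtA lam X (D X)))\<^sup>2)"
      proof (cases "t < \<psi> X \<and> \<psi> X < 2 * t")
        case True
        have "(trunc' t (\<psi> X))\<^sup>2 \<le> 1" using trunc_eq(5,6)[OF t, of "\<psi> X"] by (simp add: power_le_one)
        then show ?thesis using True unfolding eq by (auto intro!: ennreal_leI mult_left_le_one_le)
      next
        case False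
        then have "trunc' t (\<psi> X) = 0" using trunc_eq(3,4)[OF t, of "\<psi> X"] by linarith
        then show ?thesis unfolding eq by simp
      qed
    qed simp
    finally have "ennreal (t\<^sup>2 / 4 * b) \<le> ennreal (4 * (4 + (real CARD('m))\<^sup>2) * \<rho>\<^sup>2) * ?E" .
    then have "4 * ennreal (t\<^sup>2 / 4 * b) \<le> 4 * (ennreal (4 * (4 + (real CARD('m))\<^sup>2) * \<rho>\<^sup>2) * ?E)"
      by (rule mult_left_mono) simp
    then show ?thesis
      unfolding a_def[symmetric] b_def[symmetric]
      using b(2) by (simp add: c \<rho>2 mult.assoc[symmetric] ennreal_mult'[symmetric] ennreal_numeral[symmetric] del: ennreal_numeral)
  qed
qed

lemma nn_integral_indicator_mult_le:
  fixes f :: "real \<Rightarrow> ennreal"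
  assumes "\<And>t. t \<in> {a<..<b} \<Longrightarrow> f t \<le> c" and "a \<le> b"
  shows "(\<integral>\<^sup>+t. indicator {a<..<b} t * f t \<partial>lborel) \<le> c * ennreal (b - a)"
proof -
  have "(\<integral>\<^sup>+t. indicator {a<..<b} t * f t \<partial>lborel) \<le> (\<integral>\<^sup>+t. c * indicator {a<..<b} t \<partial>lborel)"
    using assms(1) by (intro nn_integral_mono) (auto simp: indicator_def)
  also have "\<dots> = c * ennreal (b - a)" using assms(2) by (subst nn_integral_cmult_indicator) auto
  finally show ?thesis .
qed

text \<open>\<open>\<beta> t\<close> is the weak L^p quantity t^p |{\<psi> > t}|. The decay estimate
  first bounds its supremum B by 2^p c E B^(2/Q). It is then integrated against t^(p-3) dt, with
  B^(2/Q) in place of the measure factor, which upgrades the weak bound to a strong one. K serves to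
  make B finite; the constant is independent of it.\<close>

lemma sobolev_pos_part:
  fixes \<psi> :: "real \<times> (real ^ 'm) \<Rightarrow> real"
  assumes GD: "\<And>X. GDERIV \<psi> X :> D X" and cD: "continuous_on UNIV D" and lam: "lam \<ge> 0"
    and Q: "Q = 1 + real CARD('m) + lam * real CARD('m)" and Q2: "Q > 2" and p: "p = 2 * Q / (Q - 2)"
    and fin: "emeasure lborel {X. \<psi> X \<noteq> 0} < \<infinity>" and K: "K > 0" "\<And>X. \<psi> X \<le> K"
    and c: "c = 16 * (4 + (real CARD('m))\<^sup>2) * 2 powr (2 / Q)"
    and E: "(\<integral>\<^sup>+X. ennreal ((norm (grushin_sqrtA lam X (D X)))\<^sup>2) \<partial>lborel) = ennreal E" "E \<ge> 0"
  shows "(\<integral>\<^sup>+X. ennreal (max 0 (\<psi> X) powr p) \<partial>lborel)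
     \<le> ennreal (4 powr p * c * (2 powr p * c) powr (2 / (Q - 2)) * E powr (p / 2))"
proof -
  have [measurable]: "D \<in> borel_measurable borel" "\<psi> \<in> borel_measurable borel"
    using cD GDERIV_imp_continuous[OF GD] by (auto intro: borel_measurable_continuous_onI)
  have c0: "c > 0" unfolding c by (simp add: add_pos_nonneg)
  have p2: "p > 2" using Q2 unfolding p by (simp add: field_simps)
  \<comment> \<open>Criticality of p: by this identity t^(p-2) a(t)^(2/Q) is a power of
    \<open>\<beta> t\<close>, so the decay estimate is scale invariant.\<close>
  have pQ: "p * (2 / Q) = p - 2" using Q2 unfolding p by (simp add: field_simps)
  define N where "N X = ennreal ((norm (grushin_sqrtA lam X (D X)))\<^sup>2)" for X
  have [measurable]: "N \<in> borel_measurable borel" unfolding N_def by measurable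
  define a where "a t = measure lborel {X. t < \<psi> X}" for t
  define e where "e t = (\<integral>\<^sup>+X. indicator {X. t < \<psi> X \<and> \<psi> X < 2 * t} X * N X \<partial>lborel)" for t
  have fin': "emeasure lborel {X. b < \<psi> X} = ennreal (a b)" if "b \<ge> 0" for b
  proof -
    have "emeasure lborel {X. b < \<psi> X} \<le> emeasure lborel {X. \<psi> X \<noteq> 0}" using that by (intro emeasure_mono) auto
    then have "emeasure lborel {X. b < \<psi> X} < \<infinity>" using fin by (rule le_less_trans)
    then show ?thesis by (auto simp: a_def emeasure_eq_ennreal_measure)
  qed
  have a0: "a t \<ge> 0" for t by (simp add: a_def)
  have amono: "a t \<le> a 0" if "t > 0" for t
  proof -
    have "ennreal (a t) \<le> ennreal (a 0)"
      unfolding fin'[OF less_imp_le[OF that], symmetric] fin'[OF order_refl, symmetric]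
      using that by (intro emeasure_mono) auto
    then show ?thesis using a0 by simp
  qed
  have decay: "ennreal (t\<^sup>2 * a (2 * t)) \<le> ennreal (c * a t powr (2 / Q)) * e t" if "t > 0" for t
    using level_set_decay[OF GD cD lam Q fin that c] unfolding a_def e_def N_def .
  have eE: "e t \<le> ennreal E" for t
    unfolding e_def E(1)[symmetric] N_def by (intro nn_integral_mono) (auto simp: indicator_def)
  define \<beta> where "\<beta> t = t powr p * a t" for t
  have \<beta>0: "\<beta> t \<ge> 0" for t using a0 by (simp add: \<beta>_def)
  have \<beta>K: "\<beta> t \<le> K powr p * a 0" if "t > 0" for t
  proof (cases "t < K")
    case True then show ?thesis unfolding \<beta>_def using that amono a0 p2 by (intro mult_mono powr_mono2) auto
  next
    case False
    then have "{X. t < \<psi> X} = {}" using K(2) by (auto simp: not_less intro: order_trans)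
    then have "a t = 0" unfolding a_def by (simp only: measure_empty)
    then show ?thesis using a0 by (simp add: \<beta>_def)
  qed
  define B where "B = (SUP t\<in>{0<..}. \<beta> t)"
  have bdd: "bdd_above (\<beta> ` {0<..})" using \<beta>K by (intro bdd_aboveI2) auto
  have \<beta>B: "\<beta> t \<le> B" if "t > 0" for t unfolding B_def using bdd that by (intro cSUP_upper) auto
  have B0: "B \<ge> 0" using \<beta>B[of 1] \<beta>0[of 1] by simp
  have pw: "t powr (p - 2) * a t powr (2 / Q) = \<beta> t powr (2 / Q)" if "t > 0" for t
    using that a0 unfolding pQ[symmetric] by (simp add: \<beta>_def powr_mult powr_powr)
  have BE: "B \<le> 2 powr p * c * E * B powr (2 / Q)" unfolding B_def[symmetric]
  proof (subst B_def, rule cSUP_least)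
    fix s :: real assume "s \<in> {0<..}"
    define t where "t = s / 2"
    have t: "t > 0" "s = 2 * t" using \<open>s \<in> {0<..}\<close> by (auto simp: t_def)
    have "ennreal (t\<^sup>2 * a (2 * t)) \<le> ennreal (c * a t powr (2 / Q)) * ennreal E"
      using decay[OF t(1)] eE by (meson mult_left_mono order_trans zero_le)
    then have "t\<^sup>2 * a (2 * t) \<le> c * a t powr (2 / Q) * E" using c0 E(2) by (simp add: ennreal_mult[symmetric])
    then have "t powr (p - 2) * (t\<^sup>2 * a (2 * t)) \<le> t powr (p - 2) * (c * a t powr (2 / Q) * E)"
      by (rule mult_left_mono) simp
    also have "t powr (p - 2) * (t\<^sup>2 * a (2 * t)) = t powr p * a (2 * t)"
      using t by (simp add: powr_diff powr_realpow)
    also have "t powr (p - 2) * (c * a t powr (2 / Q) * E) = c * E * \<beta> t powr (2 / Q)"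
      by (simp add: pw[OF t(1), symmetric])
    also have "\<dots> \<le> c * E * B powr (2 / Q)"
      using c0 E(2) \<beta>B[OF t(1)] \<beta>0 Q2 by (intro mult_left_mono powr_mono2) auto
    finally have "2 powr p * (t powr p * a (2 * t)) \<le> 2 powr p * (c * E * B powr (2 / Q))"
      by (rule mult_left_mono) simp
    then show "\<beta> s \<le> 2 powr p * c * E * B powr (2 / Q)"
      using t by (simp add: \<beta>_def powr_mult mult.assoc)
  qed simp
  \<comment> \<open>B is finite and 1 - 2/Q > 0, so the power of B on the right can be
    absorbed.\<close>
  have BQ: "B powr (2 / Q) \<le> (2 powr p * c * E) powr (2 / (Q - 2))"
  proof (cases "B = 0")
    case False
    then have "B powr (1 - 2 / Q) \<le> 2 powr p * c * E"
      using BE B0 by (simp add: powr_diff divide_le_eq)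
    then have "(B powr (1 - 2 / Q)) powr (2 / (Q - 2)) \<le> (2 powr p * c * E) powr (2 / (Q - 2))"
      using Q2 by (intro powr_mono2) auto
    moreover have "(1 - 2 / Q) * (2 / (Q - 2)) = 2 / Q" using Q2 by (simp add: field_simps)
    ultimately show ?thesis by (simp add: powr_powr)
  qed simp
  \<comment> \<open>Layer cake with only the window from s/4 to s/2 kept. There t^(p-1) is at least
    (s/4)^(p-1), and the window has length s/4; this produces 4^p.\<close>
  have low: "ennreal (max 0 s powr p) \<le> ennreal (4 powr p) * (\<integral>\<^sup>+t. indicator {0<..} t * ennreal (t powr (p - 1)) * indicator {t. 2 * t < s} t \<partial>lborel)" for s
  proof (cases "s > 0")
    case True
    have "ennreal ((s / 4) powr p) = (\<integral>\<^sup>+t. ennreal ((s / 4) powr (p - 1)) * indicator {s/4<..<s/2} t \<partial>lborel)"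
      using True by (subst nn_integral_cmult_indicator) (auto simp: ennreal_mult[symmetric] powr_diff)
    also have "\<dots> \<le> (\<integral>\<^sup>+t. indicator {0<..} t * ennreal (t powr (p - 1)) * indicator {t. 2 * t < s} t \<partial>lborel)"
      using True p2 by (intro nn_integral_mono) (auto simp: indicator_def intro!: powr_mono2)
    finally have "ennreal (4 powr p) * ennreal ((s / 4) powr p) \<le> ennreal (4 powr p) * \<dots>" by (rule mult_left_mono) simp
    then show ?thesis using True by (simp add: ennreal_mult[symmetric] powr_divide)
  qed simp
  \<comment> \<open>A point at height s lies in the band exactly for t between s/2 and s, an
    interval of dt/t-mass log 2, for which the bound 1 is enough. Hence the energies of the
    overlapping bands add up to at most the total energy.\<close>
  have up: "(\<integral>\<^sup>+t. indicator {0<..} t * ennreal (1 / t) * indicator {t. t < s \<and> s < 2 * t} t \<partial>lborel) \<le> 1" for s :: real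
  proof (cases "s > 0")
    case True
    have "(\<integral>\<^sup>+t. indicator {0<..} t * ennreal (1 / t) * indicator {t. t < s \<and> s < 2 * t} t \<partial>lborel)
       = (\<integral>\<^sup>+t. indicator {s/2<..<s} t * ennreal (1 / t) \<partial>lborel)"
      using True by (intro nn_integral_cong) (auto simp: indicator_def)
    also have "\<dots> \<le> ennreal (2 / s) * ennreal (s - s / 2)"
      using True by (intro nn_integral_indicator_mult_le ennreal_leI) (auto simp: field_simps)
    also have "\<dots> = 1" using True by (simp add: ennreal_mult[symmetric])
    finally show ?thesis .
  next
    case False
    then have "(\<integral>\<^sup>+t. indicator {0<..} t * ennreal (1 / t) * indicator {t. t < s \<and> s < 2 * t} t \<partial>lborel) = (\<integral>\<^sup>+t. 0 \<partial>(lborel :: real measure))"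
      by (intro nn_integral_cong) (auto simp: indicator_def)
    then show ?thesis by simp
  qed
  have "(\<integral>\<^sup>+X. ennreal (max 0 (\<psi> X) powr p) \<partial>lborel)
     \<le> (\<integral>\<^sup>+X. ennreal (4 powr p) * (\<integral>\<^sup>+t. indicator {0<..} t * ennreal (t powr (p - 1)) * indicator {t. 2 * t < \<psi> X} t \<partial>lborel) \<partial>lborel)"
    by (intro nn_integral_mono low)
  also have "\<dots> = ennreal (4 powr p) * (\<integral>\<^sup>+X. \<integral>\<^sup>+t. indicator {0<..} t * ennreal (t powr (p - 1)) * indicator {p. 2 * snd p < \<psi> (fst p)} (X, t) \<partial>lborel \<partial>lborel)"
    by (subst nn_integral_cmult[symmetric]) (auto intro!: nn_integral_cong simp: indicator_def)
  also have "(\<integral>\<^sup>+X. \<integral>\<^sup>+t. indicator {0<..} t * ennreal (t powr (p - 1)) * indicator {p. 2 * snd p < \<psi> (fst p)} (X, t) \<partial>lborel \<partial>lborel)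
     = (\<integral>\<^sup>+t. \<integral>\<^sup>+X. indicator {0<..} t * ennreal (t powr (p - 1)) * indicator {p. 2 * snd p < \<psi> (fst p)} (X, t) \<partial>lborel \<partial>lborel)"
    by (rule nn_integral_lborel_swap) simp
  also have "\<dots> = (\<integral>\<^sup>+t. indicator {0<..} t * ennreal (t powr (p - 1)) * ennreal (a (2 * t)) \<partial>lborel)"
  proof (rule nn_integral_cong)
    fix t
    have "(\<integral>\<^sup>+X. indicator {0<..} t * ennreal (t powr (p - 1)) * indicator {p. 2 * snd p < \<psi> (fst p)} (X, t) \<partial>lborel)
       = (\<integral>\<^sup>+X. (indicator {0<..} t * ennreal (t powr (p - 1))) * indicator {X. 2 * t < \<psi> X} X \<partial>lborel)"
      by (intro nn_integral_cong) (auto simp: indicator_def)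
    also have "\<dots> = (indicator {0<..} t * ennreal (t powr (p - 1))) * emeasure lborel {X. 2 * t < \<psi> X}"
      by (rule nn_integral_cmult_indicator) simp
    finally show "(\<integral>\<^sup>+X. indicator {0<..} t * ennreal (t powr (p - 1)) * indicator {p. 2 * snd p < \<psi> (fst p)} (X, t) \<partial>lborel)
      = indicator {0<..} t * ennreal (t powr (p - 1)) * ennreal (a (2 * t))"
      using fin'[of "2 * t"] by (auto simp: indicator_def)
  qed
  also have "\<dots> \<le> (\<integral>\<^sup>+t. ennreal (c * B powr (2 / Q)) * (indicator {0<..} t * ennreal (1 / t) * e t) \<partial>lborel)"
  proof (rule nn_integral_mono)
    fix t :: real
    show "indicator {0<..} t * ennreal (t powr (p - 1)) * ennreal (a (2 * t)) \<le> ennreal (c * B powr (2 / Q)) * (indicator {0<..} t * ennreal (1 / t) * e t)"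
    proof (cases "t > 0")
      case True
      \<comment> \<open>The decay estimate needs the factor t^2; what remains, t^(p-3), is t^(p-2)
        for the exponent identity times the 1/t of the band integral.\<close>
      have e1: "t powr (p - 1) = t powr (p - 3) * t\<^sup>2"
        using True powr_add[of t "p - 3" 2] by (simp add: powr_realpow)
      have e2: "t powr (p - 3) = t powr (p - 2) * (1 / t)"
        using True powr_add[of t "p - 2" "- 1"] by (simp add: powr_minus_divide)
      have "ennreal (t powr (p - 1)) * ennreal (a (2 * t)) = ennreal (t powr (p - 3)) * ennreal (t\<^sup>2 * a (2 * t))"
        using a0 by (simp add: e1 ennreal_mult[symmetric] mult.assoc)
      also have "\<dots> \<le> ennreal (t powr (p - 3)) * (ennreal (c * a t powr (2 / Q)) * e t)"
        by (intro mult_left_mono decay True) simp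
      also have "\<dots> = ennreal (c * \<beta> t powr (2 / Q)) * (ennreal (1 / t) * e t)"
        using c0 True unfolding e2 pw[OF True, symmetric]
        by (simp add: mult.assoc[symmetric] ennreal_mult[symmetric]) (simp add: mult_ac)
      also have "\<dots> \<le> ennreal (c * B powr (2 / Q)) * (ennreal (1 / t) * e t)"
        using c0 \<beta>B[OF True] \<beta>0 Q2 by (intro mult_right_mono ennreal_leI mult_left_mono powr_mono2) auto
      finally show ?thesis using True by simp
    qed simp
  qed
  also have "\<dots> = ennreal (c * B powr (2 / Q)) * (\<integral>\<^sup>+t. \<integral>\<^sup>+X. indicator {0<..} t * ennreal (1 / t) * indicator {p. fst p < \<psi> (snd p) \<and> \<psi> (snd p) < 2 * fst p} (t, X) * N X \<partial>lborel \<partial>lborel)"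
  proof -
    have "(indicator {0<..} t * ennreal (1 / t) * e t) = (\<integral>\<^sup>+X. indicator {0<..} t * ennreal (1 / t) * indicator {p. fst p < \<psi> (snd p) \<and> \<psi> (snd p) < 2 * fst p} (t, X) * N X \<partial>lborel)" for t
      unfolding e_def by (subst nn_integral_cmult[symmetric]) (auto intro!: nn_integral_cong simp: indicator_def)
    then show ?thesis by (subst nn_integral_cmult[symmetric]) auto
  qed
  also have "(\<integral>\<^sup>+t. \<integral>\<^sup>+X. indicator {0<..} t * ennreal (1 / t) * indicator {p. fst p < \<psi> (snd p) \<and> \<psi> (snd p) < 2 * fst p} (t, X) * N X \<partial>lborel \<partial>lborel)
     = (\<integral>\<^sup>+X. \<integral>\<^sup>+t. indicator {0<..} t * ennreal (1 / t) * indicator {p. fst p < \<psi> (snd p) \<and> \<psi> (snd p) < 2 * fst p} (t, X) * N X \<partial>lborel \<partial>lborel)"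
    by (rule nn_integral_lborel_swap) simp
  also have "\<dots> = (\<integral>\<^sup>+X. (\<integral>\<^sup>+t. indicator {0<..} t * ennreal (1 / t) * indicator {t. t < \<psi> X \<and> \<psi> X < 2 * t} t \<partial>lborel) * N X \<partial>lborel)"
    by (intro nn_integral_cong, subst nn_integral_multc[symmetric]) (auto intro!: nn_integral_cong simp: indicator_def)
  also have "\<dots> \<le> (\<integral>\<^sup>+X. 1 * N X \<partial>lborel)" by (intro nn_integral_mono mult_right_mono up) simp
  also have "\<dots> = ennreal E" by (simp add: N_def E(1))
  finally have "(\<integral>\<^sup>+X. ennreal (max 0 (\<psi> X) powr p) \<partial>lborel) \<le> ennreal (4 powr p) * (ennreal (c * B powr (2 / Q)) * ennreal E)"
    by (simp add: mult_left_mono)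
  also have "\<dots> = ennreal (4 powr p * (c * B powr (2 / Q) * E))" using c0 E(2) by (simp add: ennreal_mult)
  also have "\<dots> \<le> ennreal (4 powr p * (c * (2 powr p * c * E) powr (2 / (Q - 2)) * E))"
    using c0 E(2) BQ by (intro ennreal_leI mult_left_mono mult_right_mono) auto
  \<comment> \<open>Homogeneity in the energy: 1 + 2/(Q - 2) = p/2.\<close>
  also have "(2 powr p * c * E) powr (2 / (Q - 2)) * E = (2 powr p * c) powr (2 / (Q - 2)) * E powr (p / 2)"
  proof (cases "E = 0")
    case False
    have "p / 2 = 2 / (Q - 2) + 1" using Q2 unfolding p by (simp add: field_simps)
    then show ?thesis using False E(2) c0 by (simp only: powr_mult powr_add) (simp add: powr_mult)
  qed simp
  then have "4 powr p * (c * (2 powr p * c * E) powr (2 / (Q - 2)) * E) = 4 powr p * c * (2 powr p * c) powr (2 / (Q - 2)) * E powr (p / 2)"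
    by (simp add: mult.assoc)
  finally show ?thesis .
qed

section \<open>Functions in \<open>C\<^sup>1\<^sub>0(\<Omega>)\<close>\<close>

lemma gradient_eq:
  assumes "GDERIV u X :> D"
  shows "gradient u X = D"
  unfolding gradient_def
proof (rule the_equality[where P = "\<lambda>D. GDERIV u X :> D", OF assms])
  fix D' assume "GDERIV u X :> D'"
  then have "(\<lambda>h. h \<bullet> D') = (\<lambda>h. h \<bullet> D)"
    using assms unfolding gderiv_def by (rule has_derivative_unique)
  then show "D' = D" by (metis inner_commute vector_eq_ldot)
qed

lemma differentiable_imp_GDERIV:
  fixes u :: "'a::euclidean_space \<Rightarrow> real"
  assumes "u differentiable (at X)"
  shows "GDERIV u X :> gradient u X"
proof -
  obtain f' where f': "(u has_derivative f') (at X)" using assms by (auto simp: differentiable_def)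
  then interpret linear f' by (rule has_derivative_linear)
  have "f' h = h \<bullet> (\<Sum>b\<in>Basis. f' b *\<^sub>R b)" for h
  proof -
    have "f' h = f' (\<Sum>b\<in>Basis. (h \<bullet> b) *\<^sub>R b)" by (simp add: euclidean_representation)
    also have "\<dots> = (\<Sum>b\<in>Basis. (h \<bullet> b) * f' b)" by (simp add: sum scale)
    finally show ?thesis by (simp add: inner_sum_right mult.commute)
  qed
  then have "f' = (\<lambda>h. h \<bullet> (\<Sum>b\<in>Basis. f' b *\<^sub>R b))" by (rule ext)
  with f' have "GDERIV u X :> (\<Sum>b\<in>Basis. f' b *\<^sub>R b)" unfolding gderiv_def by metis
  then show ?thesis using gradient_eq by metis
qed

lemma GDERIV_differentiable: "GDERIV u X :> D \<Longrightarrow> u differentiable (at X)"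
  unfolding gderiv_def differentiable_def by blast

lemma C1_0_D:
  assumes "\<phi> \<in> C1_0 \<Omega>"
  shows "X \<in> \<Omega> \<Longrightarrow> GDERIV \<phi> X :> gradient \<phi> X" "continuous_on \<Omega> (gradient \<phi>)"
    "continuous_on \<Omega> \<phi>"
    "compact (closure {X\<in>\<Omega>. \<phi> X \<noteq> 0})" "closure {X\<in>\<Omega>. \<phi> X \<noteq> 0} \<subseteq> \<Omega>"
proof -
  have d: "\<forall>X\<in>\<Omega>. \<phi> differentiable (at X)" using assms unfolding C1_0_def C1_on_def by simp
  then show "X \<in> \<Omega> \<Longrightarrow> GDERIV \<phi> X :> gradient \<phi> X" by (blast intro: differentiable_imp_GDERIV)
  show "continuous_on \<Omega> \<phi>"
    using d differentiable_at_imp_differentiable_on differentiable_imp_continuous_on by metis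
qed (use assms in \<open>unfold C1_0_def C1_on_def, simp_all\<close>)

text \<open>Any compact set inside \<Omega> that contains the support will do, so closures of
  supports of composite functions need not be computed.\<close>

lemma C1_0_I:
  assumes "\<And>X. X \<in> \<Omega> \<Longrightarrow> GDERIV u X :> D X" "continuous_on \<Omega> D"
    and "{X\<in>\<Omega>. u X \<noteq> 0} \<subseteq> K" "compact K" "K \<subseteq> \<Omega>"
  shows "u \<in> C1_0 \<Omega>"
proof -
  have "continuous_on \<Omega> (gradient u)"
    using assms(2) by (rule continuous_on_cong[THEN iffD1, rotated -1]) (auto simp: gradient_eq[OF assms(1)])
  moreover have "closure {X\<in>\<Omega>. u X \<noteq> 0} \<subseteq> K" by (rule closure_minimal[OF assms(3) compact_imp_closed[OF assms(4)]])
  moreover have "compact (closure {X\<in>\<Omega>. u X \<noteq> 0})"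
    using compact_Int_closed[OF assms(4) closed_closure] calculation(2) by (metis inf.absorb2)
  moreover have "\<forall>X\<in>\<Omega>. u differentiable (at X)" using GDERIV_differentiable[OF assms(1)] by simp
  ultimately show ?thesis using assms(5) unfolding C1_0_def C1_on_def by simp
qed

lemma C1_0_compose:
  assumes "\<phi> \<in> C1_0 \<Omega>" and h: "\<And>t. (h has_real_derivative h' t) (at t)" and c: "continuous_on UNIV h'" and "h 0 = 0"
  shows "(\<lambda>X. h (\<phi> X)) \<in> C1_0 \<Omega>"
    and "X \<in> \<Omega> \<Longrightarrow> gradient (\<lambda>X. h (\<phi> X)) X = h' (\<phi> X) *\<^sub>R gradient \<phi> X"
proof -
  note \<phi> = C1_0_D[OF assms(1)]
  have G: "GDERIV (\<lambda>X. h (\<phi> X)) X :> h' (\<phi> X) *\<^sub>R gradient \<phi> X" if "X \<in> \<Omega>" for X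
    by (rule GDERIV_DERIV_compose[OF \<phi>(1)[OF that] h])
  then show "X \<in> \<Omega> \<Longrightarrow> gradient (\<lambda>X. h (\<phi> X)) X = h' (\<phi> X) *\<^sub>R gradient \<phi> X" by (rule gradient_eq)
  show "(\<lambda>X. h (\<phi> X)) \<in> C1_0 \<Omega>"
  proof (rule C1_0_I[OF G])
    show "continuous_on \<Omega> (\<lambda>X. h' (\<phi> X) *\<^sub>R gradient \<phi> X)"
      by (intro continuous_intros \<phi> continuous_on_compose2[OF c]) auto
    show "{X\<in>\<Omega>. h (\<phi> X) \<noteq> 0} \<subseteq> closure {X\<in>\<Omega>. \<phi> X \<noteq> 0}"
      using \<open>h 0 = 0\<close> by (intro subsetI subsetD[OF closure_subset]) auto
  qed (use \<phi> in auto)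
qed

lemma C1_0_diff:
  assumes "\<phi> \<in> C1_0 \<Omega>" "\<eta> \<in> C1_0 \<Omega>"
  shows "(\<lambda>X. \<phi> X - \<eta> X) \<in> C1_0 \<Omega>"
    and "X \<in> \<Omega> \<Longrightarrow> gradient (\<lambda>X. \<phi> X - \<eta> X) X = gradient \<phi> X - gradient \<eta> X"
proof -
  note \<phi> = C1_0_D[OF assms(1)] and \<eta> = C1_0_D[OF assms(2)]
  have G: "GDERIV (\<lambda>X. \<phi> X - \<eta> X) X :> gradient \<phi> X - gradient \<eta> X" if "X \<in> \<Omega>" for X
    by (rule GDERIV_diff[OF \<phi>(1)[OF that] \<eta>(1)[OF that]])
  then show "X \<in> \<Omega> \<Longrightarrow> gradient (\<lambda>X. \<phi> X - \<eta> X) X = gradient \<phi> X - gradient \<eta> X" by (rule gradient_eq)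
  show "(\<lambda>X. \<phi> X - \<eta> X) \<in> C1_0 \<Omega>"
  proof (rule C1_0_I[OF G])
    show "continuous_on \<Omega> (\<lambda>X. gradient \<phi> X - gradient \<eta> X)" by (intro continuous_intros \<phi> \<eta>)
    show "{X\<in>\<Omega>. \<phi> X - \<eta> X \<noteq> 0} \<subseteq> closure {X\<in>\<Omega>. \<phi> X \<noteq> 0} \<union> closure {X\<in>\<Omega>. \<eta> X \<noteq> 0}"
    proof
      fix X assume "X \<in> {X\<in>\<Omega>. \<phi> X - \<eta> X \<noteq> 0}"
      then have "X \<in> {X\<in>\<Omega>. \<phi> X \<noteq> 0} \<or> X \<in> {X\<in>\<Omega>. \<eta> X \<noteq> 0}" by auto
      then show "X \<in> closure {X\<in>\<Omega>. \<phi> X \<noteq> 0} \<union> closure {X\<in>\<Omega>. \<eta> X \<noteq> 0}"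
        by (elim disjE) (rule UnI1 UnI2, rule subsetD[OF closure_subset], assumption)+
    qed
  qed (use \<phi> \<eta> in auto)
qed

text \<open>Values outside \<Omega> are arbitrary, whereas the inequalities above live on the whole
  space. The extension by zero is C^1 because \<Omega> and the complement of K are open and cover
  the space: a boundary point of \<Omega> lies in the latter, where the extension vanishes
  identically.\<close>

lemma C1_0_extend:
  fixes \<phi> :: "'a::euclidean_space \<Rightarrow> real"
  assumes "\<phi> \<in> C1_0 \<Omega>" and "open \<Omega>"
  defines "\<psi> \<equiv> \<lambda>X. if X \<in> \<Omega> then \<phi> X else 0" and "D \<equiv> \<lambda>X. if X \<in> \<Omega> then gradient \<phi> X else 0"
  shows "\<exists>K. compact K \<and> K \<subseteq> \<Omega> \<and> (\<forall>X. X \<notin> K \<longrightarrow> \<psi> X = 0 \<and> D X = 0)"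
    and "GDERIV \<psi> X :> D X" and "continuous_on UNIV D"
proof -
  note \<phi> = C1_0_D[OF assms(1)]
  define K where "K = closure {X\<in>\<Omega>. \<phi> X \<noteq> 0}"
  have K: "compact K" "K \<subseteq> \<Omega>" unfolding K_def by (rule \<phi>)+
  have oK: "open (- K)" using K(1) by (simp add: compact_imp_closed open_Compl)
  have z: "\<psi> X = 0" if "X \<notin> K" for X
    using that closure_subset[of "{X\<in>\<Omega>. \<phi> X \<noteq> 0}"] by (auto simp: \<psi>_def K_def)
  have G1: "GDERIV \<psi> X :> D X" if "X \<in> \<Omega>" for X
    using \<phi>(1)[OF that] unfolding gderiv_def
    by (rule has_derivative_transform_within_open[OF _ \<open>open \<Omega>\<close> that, THEN has_derivative_eq_rhs])
       (auto simp: \<psi>_def D_def that)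
  have G2: "GDERIV \<psi> X :> 0" if "X \<notin> K" for X
  proof -
    have "GDERIV (\<lambda>X. 0) X :> 0" by (rule GDERIV_const)
    then show ?thesis unfolding gderiv_def
      by (rule has_derivative_transform_within_open[OF _ oK]) (use that z in auto)
  qed
  have zD: "D X = 0" if "X \<notin> K" for X
  proof (cases "X \<in> \<Omega>")
    case True
    show ?thesis using gradient_eq[OF G1[OF True]] gradient_eq[OF G2[OF that]] by simp
  qed (simp add: D_def)
  show "GDERIV \<psi> X :> D X" using G1[of X] G2[of X] zD[of X] K(2) by (cases "X \<in> K") auto
  show "continuous_on UNIV D"
  proof -
    have "continuous_on (\<Omega> \<union> - K) D"
    proof (rule continuous_on_open_Un[OF \<open>open \<Omega>\<close> oK])
      show "continuous_on \<Omega> D" using \<phi>(2) by (rule continuous_on_cong[THEN iffD1, rotated -1]) (auto simp: D_def)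
      show "continuous_on (- K) D" by (rule continuous_on_cong[THEN iffD1, OF refl _ continuous_on_const[of _ 0]]) (auto simp: zD)
    qed
    moreover have "\<Omega> \<union> - K = UNIV" using K(2) by auto
    ultimately show ?thesis by simp
  qed
  show "\<exists>K. compact K \<and> K \<subseteq> \<Omega> \<and> (\<forall>X. X \<notin> K \<longrightarrow> \<psi> X = 0 \<and> D X = 0)"
    using K z zD by (intro exI[of _ K]) simp
qed

lemma nn_integral_lebesgue_on:
  assumes "\<Omega> \<in> sets lebesgue"
  shows "(\<integral>\<^sup>+X. g X \<partial>lebesgue_on \<Omega>) = (\<integral>\<^sup>+X. g X * indicator \<Omega> X \<partial>lborel)"
  using assms by (simp add: nn_integral_restrict_space nn_integral_completion)

abbreviation quasi_grad :: "real \<Rightarrow> (real \<times> (real ^ 'm) \<Rightarrow> real) \<Rightarrow> real \<times> (real ^ 'm) \<Rightarrow> real \<times> (real ^ 'm)" where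
  "quasi_grad lam \<phi> X \<equiv> grushin_sqrtA lam X (gradient \<phi> X)"

lemma continuous_on_grushin_sqrtA:
  assumes "lam > 0" and D: "continuous_on A D"
  shows "continuous_on A (\<lambda>X. grushin_sqrtA lam X (D X))"
proof -
  have "continuous_on A (\<lambda>X. \<bar>fst X\<bar> powr lam)"
    using \<open>lam > 0\<close> by (intro continuous_on_powr' continuous_intros) auto
  then show ?thesis unfolding grushin_sqrtA_def
    by (intro continuous_on_Pair continuous_on_scaleR continuous_on_fst continuous_on_snd D)
qed

text \<open>Everything is continuous and vanishes off a compact subset of \<Omega>;
  \<open>lam > 0\<close> makes |x|^lam continuous across x = 0.\<close>

lemma C1_0_energy_integrable:
  assumes "\<phi> \<in> C1_0 \<Omega>" and "open \<Omega>" and "lam > 0"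
  shows "quasi_grad lam \<phi> \<in> borel_measurable (lebesgue_on \<Omega>)"
    and "integrable (lebesgue_on \<Omega>) (\<lambda>X. (norm (quasi_grad lam \<phi> X))\<^sup>2)"
    and "\<phi> \<in> borel_measurable (lebesgue_on \<Omega>)" and "\<exists>B. \<forall>X\<in>\<Omega>. \<bar>\<phi> X\<bar> \<le> B"
proof -
  have \<Omega>: "\<Omega> \<in> sets lebesgue" using \<open>open \<Omega>\<close> by simp
  note \<phi> = C1_0_D[OF assms(1)]
  show 1: "quasi_grad lam \<phi> \<in> borel_measurable (lebesgue_on \<Omega>)"
    by (rule continuous_imp_measurable_on_sets_lebesgue[OF continuous_on_grushin_sqrtA[OF \<open>lam > 0\<close> \<phi>(2)] \<Omega>])
  show "\<phi> \<in> borel_measurable (lebesgue_on \<Omega>)"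
    by (rule continuous_imp_measurable_on_sets_lebesgue[OF \<phi>(3) \<Omega>])
  obtain K where K: "compact K" "K \<subseteq> \<Omega>" "\<And>X. X \<notin> K \<Longrightarrow> (if X \<in> \<Omega> then \<phi> X else 0) = 0"
    "\<And>X. X \<notin> K \<Longrightarrow> (if X \<in> \<Omega> then gradient \<phi> X else 0) = 0"
    using C1_0_extend(1)[OF assms(1,2)] by auto
  have "bounded (\<phi> ` K)" by (intro compact_imp_bounded compact_continuous_image continuous_on_subset[OF \<phi>(3)] K(1,2))
  then obtain B where B: "\<And>X. X \<in> K \<Longrightarrow> \<bar>\<phi> X\<bar> \<le> B" by (auto simp: bounded_iff)
  show "\<exists>B. \<forall>X\<in>\<Omega>. \<bar>\<phi> X\<bar> \<le> B"
  proof (intro exI ballI)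
    fix X assume "X \<in> \<Omega>" then show "\<bar>\<phi> X\<bar> \<le> max B 0" using B[of X] K(3)[of X] by (cases "X \<in> K") auto
  qed
  have "bounded ((\<lambda>X. (norm (quasi_grad lam \<phi> X))\<^sup>2) ` K)"
    by (intro compact_imp_bounded compact_continuous_image continuous_on_power continuous_on_norm
       continuous_on_grushin_sqrtA continuous_on_subset[OF \<phi>(2)] K(1,2) \<open>lam > 0\<close>)
  then obtain B' where B': "\<And>X. X \<in> K \<Longrightarrow> (norm (quasi_grad lam \<phi> X))\<^sup>2 \<le> B'" by (auto simp: bounded_iff)
  have Ks: "K \<in> sets (lebesgue_on \<Omega>)" using K \<Omega> by (auto simp: sets_restrict_space compact_imp_closed)
  show "integrable (lebesgue_on \<Omega>) (\<lambda>X. (norm (quasi_grad lam \<phi> X))\<^sup>2)"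
  proof (rule Bochner_Integration.integrable_bound)
    have "emeasure (lebesgue_on \<Omega>) K = emeasure lborel K"
      using K \<Omega> by (simp add: emeasure_restrict_space compact_imp_closed)
    also have "\<dots> < \<infinity>" using K(1) emeasure_compact_finite by auto
    finally show "integrable (lebesgue_on \<Omega>) (\<lambda>X. B' * indicat_real K X)"
      using Ks by (intro integrable_mult_right integrable_real_indicator) auto
    show "AE X in lebesgue_on \<Omega>. norm ((norm (quasi_grad lam \<phi> X))\<^sup>2) \<le> norm (B' * indicat_real K X)"
    proof (rule AE_I2)
      fix X assume "X \<in> space (lebesgue_on \<Omega>)"
      then have "X \<in> \<Omega>" by (simp add: space_restrict_space)
      then show "norm ((norm (quasi_grad lam \<phi> X))\<^sup>2) \<le> norm (B' * indicat_real K X)"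
        using B'[of X] K(4)[of X] by (cases "X \<in> K") (auto simp: grushin_sqrtA_def zero_prod_def[symmetric])
    qed
  qed (use 1 in measurable)
qed

text \<open>The estimate for positive parts is applied to the zero extension and to its negative,
  which gives the two halves of the integral and the factor 2.\<close>

lemma sobolev_C1_0:
  fixes \<Omega> :: "(real \<times> (real ^ 'm)) set"
  assumes "open \<Omega>" and lam: "lam > 0"
    and Q: "Q = 1 + real CARD('m) + lam * real CARD('m)" and Q2: "Q > 2" and p: "p = 2 * Q / (Q - 2)"
  obtains C where "C > 0" "\<And>\<phi>. \<phi> \<in> C1_0 \<Omega> \<Longrightarrow>
     (\<integral>\<^sup>+X. ennreal (\<bar>\<phi> X\<bar> powr p) \<partial>lebesgue_on \<Omega>)
       \<le> ennreal (C * (LINT X|lebesgue_on \<Omega>. (norm (quasi_grad lam \<phi> X))\<^sup>2) powr (p / 2))"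
proof -
  have \<Omega>: "\<Omega> \<in> sets lebesgue" using \<open>open \<Omega>\<close> by simp
  define c where "c = 16 * (4 + (real CARD('m))\<^sup>2) * 2 powr (2 / Q)"
  have c0: "c > 0" unfolding c_def by (simp add: add_pos_nonneg)
  define C where "C = 4 powr p * c * (2 powr p * c) powr (2 / (Q - 2))"
  have C0: "C > 0" using c0 by (simp add: C_def)
  have "(\<integral>\<^sup>+X. ennreal (\<bar>\<phi> X\<bar> powr p) \<partial>lebesgue_on \<Omega>)
       \<le> ennreal (2 * C * (LINT X|lebesgue_on \<Omega>. (norm (quasi_grad lam \<phi> X))\<^sup>2) powr (p / 2))"
    if \<phi>: "\<phi> \<in> C1_0 \<Omega>" for \<phi>
  proof -
    define \<psi> where "\<psi> = (\<lambda>X. if X \<in> \<Omega> then \<phi> X else 0)"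
    define D where "D = (\<lambda>X. if X \<in> \<Omega> then gradient \<phi> X else 0)"
    obtain K where K: "compact K" "K \<subseteq> \<Omega>" "\<And>X. X \<notin> K \<Longrightarrow> \<psi> X = 0" "\<And>X. X \<notin> K \<Longrightarrow> D X = 0"
      using C1_0_extend(1)[OF \<phi> \<open>open \<Omega>\<close>] unfolding \<psi>_def D_def by auto
    have GD: "\<And>X. GDERIV \<psi> X :> D X" and cD: "continuous_on UNIV D"
      using C1_0_extend(2,3)[OF \<phi> \<open>open \<Omega>\<close>] unfolding \<psi>_def D_def .
    define E where "E = (LINT X|lebesgue_on \<Omega>. (norm (quasi_grad lam \<phi> X))\<^sup>2)"
    have E0: "E \<ge> 0" by (simp add: E_def)
    have "ennreal E = (\<integral>\<^sup>+X. ennreal ((norm (quasi_grad lam \<phi> X))\<^sup>2) \<partial>lebesgue_on \<Omega>)"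
      unfolding E_def by (rule nn_integral_eq_integral[symmetric, OF C1_0_energy_integrable(2)[OF \<phi> \<open>open \<Omega>\<close> lam]]) simp
    also have "\<dots> = (\<integral>\<^sup>+X. ennreal ((norm (grushin_sqrtA lam X (D X)))\<^sup>2) \<partial>lborel)"
      unfolding nn_integral_lebesgue_on[OF \<Omega>]
      by (intro nn_integral_cong) (auto simp: D_def indicator_def grushin_sqrtA_def zero_prod_def[symmetric])
    finally have E: "(\<integral>\<^sup>+X. ennreal ((norm (grushin_sqrtA lam X (D X)))\<^sup>2) \<partial>lborel) = ennreal E" by simp
    have "emeasure lborel {X. \<psi> X \<noteq> 0} \<le> emeasure lborel K" using K compact_imp_closed[OF K(1)] by (intro emeasure_mono) auto
    also have "\<dots> < \<infinity>" using K(1) emeasure_compact_finite by auto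
    finally have fin: "emeasure lborel {X. \<psi> X \<noteq> 0} < \<infinity>" .
    obtain B where B: "\<And>X. X \<in> \<Omega> \<Longrightarrow> \<bar>\<phi> X\<bar> \<le> B" using C1_0_energy_integrable(4)[OF \<phi> \<open>open \<Omega>\<close> lam] by blast
    have B': "\<bar>\<psi> X\<bar> \<le> \<bar>B\<bar> + 1" for X using B[of X] by (auto simp: \<psi>_def)
    have GD': "GDERIV (\<lambda>X. - \<psi> X) X :> - D X" for X by (rule GDERIV_minus[OF GD])
    have cD': "continuous_on UNIV (\<lambda>X. - D X)" by (intro continuous_intros cD)
    have E': "(\<integral>\<^sup>+X. ennreal ((norm (grushin_sqrtA lam X (- D X)))\<^sup>2) \<partial>lborel) = ennreal E"
      unfolding E[symmetric] by (intro nn_integral_cong) (simp add: grushin_sqrtA_def norm_prod_def)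
    have [measurable]: "\<psi> \<in> borel_measurable borel"
      using GDERIV_imp_continuous[OF GD] by (auto intro: borel_measurable_continuous_onI)
    have "(\<integral>\<^sup>+X. ennreal (\<bar>\<phi> X\<bar> powr p) \<partial>lebesgue_on \<Omega>)
       = (\<integral>\<^sup>+X. ennreal (max 0 (\<psi> X) powr p) + ennreal (max 0 (- \<psi> X) powr p) \<partial>lborel)"
      unfolding nn_integral_lebesgue_on[OF \<Omega>]
      by (intro nn_integral_cong) (auto simp: \<psi>_def indicator_def max_def)
    also have "\<dots> = (\<integral>\<^sup>+X. ennreal (max 0 (\<psi> X) powr p) \<partial>lborel) + (\<integral>\<^sup>+X. ennreal (max 0 (- \<psi> X) powr p) \<partial>lborel)"
      by (rule nn_integral_add) measurable
    also have "\<dots> \<le> ennreal (C * E powr (p / 2)) + ennreal (C * E powr (p / 2))"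
      unfolding C_def
    proof (intro add_mono)
      show "(\<integral>\<^sup>+X. ennreal (max 0 (\<psi> X) powr p) \<partial>lborel) \<le> ennreal (4 powr p * c * (2 powr p * c) powr (2 / (Q - 2)) * E powr (p / 2))"
        by (rule sobolev_pos_part[OF GD cD _ Q Q2 p fin _ _ c_def E E0, of "\<bar>B\<bar> + 1"])
           (use lam B' abs_le_D1 in auto)
      show "(\<integral>\<^sup>+X. ennreal (max 0 (- \<psi> X) powr p) \<partial>lborel) \<le> ennreal (4 powr p * c * (2 powr p * c) powr (2 / (Q - 2)) * E powr (p / 2))"
        by (rule sobolev_pos_part[OF GD' cD' _ Q Q2 p _ _ _ c_def E' E0, of "\<bar>B\<bar> + 1"])
           (use lam B' abs_le_D2 fin in auto)
    qed
    also have "\<dots> = ennreal (2 * C * E powr (p / 2))"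
      using C0 by (subst ennreal_plus[symmetric]) auto
    finally show ?thesis unfolding E_def .
  qed
  then show thesis using C0 that[of "2 * C"] by simp
qed

section \<open>Energy estimates for weak solutions\<close>

lemma Hoelder_integral:
  fixes f g :: "'a \<Rightarrow> real"
  assumes [measurable]: "f \<in> borel_measurable M" "g \<in> borel_measurable M"
    and nn: "AE x in M. 0 \<le> f x" "AE x in M. 0 \<le> g x"
    and pq: "p > 1" "q > 1" "1 / p + 1 / q = 1"
    and I: "integrable M (\<lambda>x. f x powr p)" "integrable M (\<lambda>x. g x powr q)"
  shows "integrable M (\<lambda>x. f x * g x)"
    and "(LINT x|M. f x * g x) \<le> (LINT x|M. f x powr p) powr (1 / p) * (LINT x|M. g x powr q) powr (1 / q)"
proof -
  show int: "integrable M (\<lambda>x. f x * g x)"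
  proof (rule Bochner_Integration.integrable_bound)
    show "integrable M (\<lambda>x. f x powr p / p + g x powr q / q)" using I by auto
    show "AE x in M. norm (f x * g x) \<le> norm (f x powr p / p + g x powr q / q)"
      using nn by eventually_elim (use pq Youngs_inequality[of p q] in \<open>auto simp: abs_of_nonneg\<close>)
  qed measurable
  define A where "A = (LINT x|M. f x powr p)"
  define B where "B = (LINT x|M. g x powr q)"
  have A0: "A \<ge> 0" and B0: "B \<ge> 0" by (simp_all add: A_def B_def)
  show "(LINT x|M. f x * g x) \<le> A powr (1 / p) * B powr (1 / q)"
  \<comment> \<open>Young's inequality is applied to f and g divided by their norms. If a norm is 0,
    one factor vanishes almost everywhere and with it the product.\<close>
  proof (cases "A = 0 \<or> B = 0")
    case True
    have "AE x in M. f x powr p = 0 \<or> g x powr q = 0"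
      using True integral_nonneg_eq_0_iff_AE[OF I(1)] integral_nonneg_eq_0_iff_AE[OF I(2)]
      by (auto simp: A_def B_def)
    then have "AE x in M. f x * g x = 0" by eventually_elim auto
    then have "(LINT x|M. f x * g x) = 0" by (rule integral_eq_zero_AE)
    then show ?thesis using True pq by auto
  next
    case False
    then have AB: "A > 0" "B > 0" using A0 B0 by auto
    define a where "a = A powr (1 / p)"
    define b where "b = B powr (1 / q)"
    have ab: "a > 0" "b > 0" using AB by (auto simp: a_def b_def)
    have ap: "a powr p = A" "b powr q = B" using AB pq by (auto simp: a_def b_def powr_powr)
    have "(LINT x|M. f x * g x) \<le> (LINT x|M. a * b * (f x powr p / (p * A) + g x powr q / (q * B)))"
    proof (rule integral_mono_AE[OF int])
      show "integrable M (\<lambda>x. a * b * (f x powr p / (p * A) + g x powr q / (q * B)))" using I by auto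
      show "AE x in M. f x * g x \<le> a * b * (f x powr p / (p * A) + g x powr q / (q * B))"
        using nn
      proof eventually_elim
        fix x assume x: "0 \<le> f x" "0 \<le> g x"
        have "f x / a * (g x / b) \<le> (f x / a) powr p / p + (g x / b) powr q / q"
          by (rule Youngs_inequality) (use pq x ab in auto)
        also have "\<dots> = f x powr p / (p * A) + g x powr q / (q * B)"
          using x ab by (simp add: powr_divide ap mult.commute)
        finally have "a * b * (f x / a * (g x / b)) \<le> a * b * (f x powr p / (p * A) + g x powr q / (q * B))"
          using ab by (intro mult_left_mono) auto
        then show "f x * g x \<le> a * b * (f x powr p / (p * A) + g x powr q / (q * B))" using ab by simp
      qed
    qed
    also have "\<dots> = a * b * (A / (p * A) + B / (q * B))"
      using I by (simp add: A_def B_def)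
    also have "\<dots> = a * b" using AB pq by simp
    finally show ?thesis by (simp add: a_def b_def)
  qed
qed

lemma L2_product:
  fixes a :: "'a \<Rightarrow> 'b::euclidean_space" and b :: "'a \<Rightarrow> 'c::euclidean_space"
  assumes [measurable]: "a \<in> borel_measurable M" "b \<in> borel_measurable M"
    and I: "integrable M (\<lambda>x. (norm (a x))\<^sup>2)" "integrable M (\<lambda>x. (norm (b x))\<^sup>2)"
  shows "integrable M (\<lambda>x. norm (a x) * norm (b x))"
    and "(LINT x|M. norm (a x) * norm (b x)) \<le> sqrt (LINT x|M. (norm (a x))\<^sup>2) * sqrt (LINT x|M. (norm (b x))\<^sup>2)"
proof -
  have e: "(\<lambda>x. norm (a x) powr 2) = (\<lambda>x. (norm (a x))\<^sup>2)" "(\<lambda>x. norm (b x) powr 2) = (\<lambda>x. (norm (b x))\<^sup>2)"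
    by (auto simp: fun_eq_iff)
  show "integrable M (\<lambda>x. norm (a x) * norm (b x))"
    by (rule Hoelder_integral(1)[where p = 2 and q = 2]) (use I e in auto)
  have "(LINT x|M. norm (a x) * norm (b x)) \<le> (LINT x|M. norm (a x) powr 2) powr (1 / 2) * (LINT x|M. norm (b x) powr 2) powr (1 / 2)"
    by (rule Hoelder_integral(2)) (use I e in auto)
  then show "(LINT x|M. norm (a x) * norm (b x)) \<le> sqrt (LINT x|M. (norm (a x))\<^sup>2) * sqrt (LINT x|M. (norm (b x))\<^sup>2)"
    by (simp add: e powr_half_sqrt)
qed

lemma L2_diff:
  fixes a b :: "'a \<Rightarrow> 'b::euclidean_space"
  assumes [measurable]: "a \<in> borel_measurable M" "b \<in> borel_measurable M"
    and I: "integrable M (\<lambda>x. (norm (a x))\<^sup>2)" "integrable M (\<lambda>x. (norm (b x))\<^sup>2)"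
  shows "integrable M (\<lambda>x. (norm (a x - b x))\<^sup>2)"
    and "(LINT x|M. (norm (a x - b x))\<^sup>2) \<le> 2 * (LINT x|M. (norm (a x))\<^sup>2) + 2 * (LINT x|M. (norm (b x))\<^sup>2)"
proof -
  have le: "(norm (a x - b x))\<^sup>2 \<le> 2 * (norm (a x))\<^sup>2 + 2 * (norm (b x))\<^sup>2" for x
  proof -
    have "(norm (a x - b x))\<^sup>2 \<le> (norm (a x) + norm (b x))\<^sup>2"
      by (intro power_mono norm_triangle_ineq4) simp
    also have "\<dots> \<le> 2 * (norm (a x))\<^sup>2 + 2 * (norm (b x))\<^sup>2"
      using zero_le_power2[of "norm (a x) - norm (b x)"] by (simp add: power2_eq_square algebra_simps)
    finally show ?thesis .
  qed
  show int: "integrable M (\<lambda>x. (norm (a x - b x))\<^sup>2)"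
    by (rule Bochner_Integration.integrable_bound[of M "\<lambda>x. 2 * (norm (a x))\<^sup>2 + 2 * (norm (b x))\<^sup>2"])
       (use I le in auto)
  have "(LINT x|M. (norm (a x - b x))\<^sup>2) \<le> (LINT x|M. 2 * (norm (a x))\<^sup>2 + 2 * (norm (b x))\<^sup>2)"
    using I by (intro integral_mono int le) auto
  then show "(LINT x|M. (norm (a x - b x))\<^sup>2) \<le> 2 * (LINT x|M. (norm (a x))\<^sup>2) + 2 * (LINT x|M. (norm (b x))\<^sup>2)"
    using I by simp
qed

lemma Lp_2_iff:
  "f \<in> Lp \<Omega> 2 \<longleftrightarrow> f \<in> borel_measurable (lebesgue_on \<Omega>) \<and> integrable (lebesgue_on \<Omega>) (\<lambda>X. (norm (f X))\<^sup>2)"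
proof -
  have "(2::ereal) \<noteq> \<infinity>" by simp
  moreover have "real_of_ereal 2 = 2" by simp
  moreover have "(\<lambda>X. norm (f X) powr 2) = (\<lambda>X. (norm (f X))\<^sup>2)" by (auto simp: fun_eq_iff)
  ultimately show ?thesis unfolding Lp_def by simp
qed

text \<open>Fatou with bounds that may vary with n as long as they converge. Estimates for the
  approximating functions pass to u in this way.\<close>

lemma nn_integral_limit_le:
  fixes g :: "nat \<Rightarrow> 'a \<Rightarrow> ennreal"
  assumes [measurable]: "\<And>n. g n \<in> borel_measurable M"
    and lim: "AE x in M. (\<lambda>n. g n x) \<longlonglongrightarrow> G x"
    and le: "\<And>n. (\<integral>\<^sup>+x. g n x \<partial>M) \<le> ennreal (c n)" and c: "c \<longlonglongrightarrow> C"
  shows "(\<integral>\<^sup>+x. G x \<partial>M) \<le> ennreal C"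
proof -
  have "(\<integral>\<^sup>+x. G x \<partial>M) = (\<integral>\<^sup>+x. liminf (\<lambda>n. g n x) \<partial>M)"
    using lim by (intro nn_integral_cong_AE) (auto elim!: eventually_mono dest: lim_imp_Liminf[OF sequentially_bot])
  also have "\<dots> \<le> liminf (\<lambda>n. \<integral>\<^sup>+x. g n x \<partial>M)" by (rule nn_integral_liminf) measurable
  also have "\<dots> \<le> liminf (\<lambda>n. ennreal (c n))" by (intro Liminf_mono always_eventually allI le)
  also have "\<dots> = ennreal C" by (rule lim_imp_Liminf[OF sequentially_bot tendsto_ennrealI[OF c]])
  finally show ?thesis .
qed

text \<open>A weak solution with an approximating sequence and \<open>U\<close> fixed. Writing the
  equation with \<open>U\<close> and \<open>quasi_grad\<close> removes the inverse weight, and the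
  sequence is taken to converge almost everywhere, so that Fatou and dominated convergence apply.
  Here f is merely integrable; the exponent r enters with the regularity proofs.\<close>

locale grushin_weak_solution =
  fixes lam \<nu> :: real and \<Omega> :: "(real \<times> (real ^ 'm)) set"
    and f u :: "real \<times> (real ^ 'm) \<Rightarrow> real"
    and \<phi> :: "nat \<Rightarrow> real \<times> (real ^ 'm) \<Rightarrow> real"
    and U :: "real \<times> (real ^ 'm) \<Rightarrow> real \<times> (real ^ 'm)"
  assumes opn: "open \<Omega>" and bdd: "bounded \<Omega>" and lam: "lam \<ge> 1" and nu: "0 < \<nu>" "\<nu> < 1"
    and f_int: "integrable (lebesgue_on \<Omega>) f" and f_nn: "AE X in lebesgue_on \<Omega>. 0 \<le> f X"
    and \<phi>: "\<And>n. \<phi> n \<in> C1_0 \<Omega>"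
    and u_meas [measurable]: "u \<in> borel_measurable (lebesgue_on \<Omega>)"
    and \<phi>_lim: "AE X in lebesgue_on \<Omega>. (\<lambda>n. \<phi> n X) \<longlonglongrightarrow> u X"
    and U_meas [measurable]: "U \<in> borel_measurable (lebesgue_on \<Omega>)"
    and U_int: "integrable (lebesgue_on \<Omega>) (\<lambda>X. (norm (U X))\<^sup>2)"
    and U_lim: "(\<lambda>n. LINT X|lebesgue_on \<Omega>. (norm (quasi_grad lam (\<phi> n) X - U X))\<^sup>2) \<longlonglongrightarrow> 0"
    and u_pos: "AE X in lebesgue_on \<Omega>. 0 < u X"
    and u_low: "\<And>\<Omega>'. compactly_inside \<Omega>' \<Omega> \<Longrightarrow> \<exists>C>0. AE X in lebesgue_on \<Omega>. X \<in> \<Omega>' \<longrightarrow> C \<le> u X"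
    and weak: "\<And>v. v \<in> C1_0 \<Omega> \<Longrightarrow> (LINT X|lebesgue_on \<Omega>. U X \<bullet> quasi_grad lam v X)
       = (LINT X|lebesgue_on \<Omega>. f X / u X powr \<nu> * v X)"
begin

abbreviation M where "M \<equiv> lebesgue_on \<Omega>"

definition w where "w X = f X / u X powr \<nu>"

definition U2 where "U2 = (LINT X|M. (norm (U X))\<^sup>2)"

text \<open>Squared energy distance from \<open>\<phi> n\<close> to u, in terms of which the errors
  of the passages to the limit are measured.\<close>

definition d where "d n = (LINT X|M. (norm (quasi_grad lam (\<phi> n) X - U X))\<^sup>2)"

lemma space_M: "space M = \<Omega>" by (simp add: space_restrict_space)

lemma f_meas [measurable]: "f \<in> borel_measurable M" using f_int by (rule borel_measurable_integrable)

lemma w_meas [measurable]: "w \<in> borel_measurable M" unfolding w_def by measurable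

lemma w_nn: "AE X in M. 0 \<le> w X" using f_nn by eventually_elim (simp add: w_def)

lemma U2_nn: "U2 \<ge> 0" by (simp add: U2_def)

lemma d_nn: "d n \<ge> 0" by (simp add: d_def)

lemma d_lim: "d \<longlonglongrightarrow> 0" using U_lim unfolding d_def .

lemmas C1_0_meas = C1_0_energy_integrable(1)[OF _ opn, of _ lam] C1_0_energy_integrable(3)[OF _ opn, of _ 1]
lemmas C1_0_int = C1_0_energy_integrable(2)[OF _ opn, of _ lam]

lemma lam0: "lam > 0" using lam by simp

lemma \<phi>_meas [measurable]: "\<phi> n \<in> borel_measurable M" "quasi_grad lam (\<phi> n) \<in> borel_measurable M"
  using C1_0_meas[OF \<phi>] lam0 by auto

text \<open>On the support of v the solution is at least some C > 0, so |w| is at most |f|/C^\<nu>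
  there, and v is bounded.\<close>

lemma w_mult_integrable:
  assumes v: "v \<in> C1_0 \<Omega>"
  shows "integrable M (\<lambda>X. w X * v X)"
proof -
  have [measurable]: "v \<in> borel_measurable M" using C1_0_meas(2)[OF v] by simp
  have "compactly_inside {X\<in>\<Omega>. v X \<noteq> 0} \<Omega>"
    using C1_0_D(4,5)[OF v] by (simp add: compactly_inside_def)
  from u_low[OF this] obtain C where C: "C > 0" "AE X in M. X \<in> {X\<in>\<Omega>. v X \<noteq> 0} \<longrightarrow> C \<le> u X" by blast
  obtain B where B: "\<And>X. X \<in> \<Omega> \<Longrightarrow> \<bar>v X\<bar> \<le> B"
    using C1_0_energy_integrable(4)[OF v opn, of 1] by auto
  show ?thesis
  proof (rule Bochner_Integration.integrable_bound)
    show "integrable M (\<lambda>X. f X * (\<bar>B\<bar> / C powr \<nu>))" using f_int by simp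
    show "AE X in M. norm (w X * v X) \<le> norm (f X * (\<bar>B\<bar> / C powr \<nu>))"
      using C(2) AE_space
    proof eventually_elim
      case (elim X)
      show ?case
      proof (cases "v X = 0")
        case False
        then have "X \<in> \<Omega>" "C \<le> u X" using elim by (auto simp: space_M)
        then have le: "C powr \<nu> \<le> u X powr \<nu>" "C powr \<nu> > 0" and v: "\<bar>v X\<bar> \<le> \<bar>B\<bar>"
          using C(1) nu B[of X] by (auto intro!: powr_mono2)
        then have "u X powr \<nu> * C powr \<nu> > 0" by (intro mult_pos_pos) linarith+
        have "\<bar>f X\<bar> / u X powr \<nu> * \<bar>v X\<bar> \<le> \<bar>f X\<bar> / C powr \<nu> * \<bar>B\<bar>"
          using le v \<open>u X powr \<nu> * C powr \<nu> > 0\<close> by (intro mult_mono divide_left_mono) auto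
        then show ?thesis by (simp add: w_def abs_mult)
      qed simp
    qed
  qed measurable
qed

text \<open>
  Testing with \<open>\<surd>(v\<^sup>2 + \<epsilon>\<^sup>2) - \<epsilon>\<close> shows that the energy space embeds into
  \<open>L\<^sup>1(f/u\<^sup>\<nu> dX)\<close>, although \<open>f/u\<^sup>\<nu>\<close> itself need not be integrable up to the boundary.
\<close>
lemma weighted_L1_bound:
  assumes v: "v \<in> C1_0 \<Omega>"
  shows "(\<integral>\<^sup>+X. ennreal (w X * \<bar>v X\<bar>) \<partial>M) \<le> ennreal (sqrt U2 * sqrt (LINT X|M. (norm (quasi_grad lam v X))\<^sup>2))"
proof -
  have [measurable]: "v \<in> borel_measurable M" "quasi_grad lam v \<in> borel_measurable M"
    using C1_0_meas[OF v] lam0 by auto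
  note Sv = C1_0_int[OF v lam0]
  define e where "e n = 1 / real (Suc n)" for n
  have e0: "e n > 0" for n by (simp add: e_def)
  have elim: "e \<longlonglongrightarrow> 0" unfolding e_def using LIMSEQ_inverse_real_of_nat by (simp add: divide_inverse)
  define h where "h n t = sqrt (t\<^sup>2 + (e n)\<^sup>2) - e n" for n t
  define h' where "h' n t = t / sqrt (t\<^sup>2 + (e n)\<^sup>2)" for n t
  have pos: "t\<^sup>2 + (e n)\<^sup>2 > 0" for n t using e0[of n] by (simp add: add_nonneg_pos)
  have D: "(h n has_real_derivative h' n t) (at t)" for n t
    unfolding h_def h'_def using pos[of t n]
    by (auto intro!: derivative_eq_intros simp: divide_simps)
  have c: "continuous_on UNIV (h' n)" for n
    unfolding h'_def using pos less_imp_neq[OF e0, THEN not_sym] by (intro continuous_intros) auto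
  have h0: "h n 0 = 0" for n using e0[of n] by (simp add: h_def)
  have hnn: "h n t \<ge> 0" for n t using e0[of n] real_le_rsqrt[of "e n" "t\<^sup>2 + (e n)\<^sup>2"] by (simp add: h_def)
  have h'1: "\<bar>h' n t\<bar> \<le> 1" for n t
  proof -
    have "\<bar>t\<bar> \<le> sqrt (t\<^sup>2 + (e n)\<^sup>2)" by (rule real_le_rsqrt) simp
    then show ?thesis using pos[of t n] by (simp add: h'_def abs_divide divide_le_eq)
  qed
  have vn: "(\<lambda>X. h n (v X)) \<in> C1_0 \<Omega>" for n by (rule C1_0_compose(1)[OF v D c h0])
  have [measurable]: "h n \<in> borel_measurable borel" for n unfolding h_def by measurable
  \<comment> \<open>\<open>h n 0 = 0\<close> keeps the support compact, and |h'| <= 1 makes the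
    bound independent of n, which is what Fatou needs when the regularisation is removed.\<close>
  have step: "(\<integral>\<^sup>+X. ennreal (w X * h n (v X)) \<partial>M) \<le> ennreal (sqrt U2 * sqrt (LINT X|M. (norm (quasi_grad lam v X))\<^sup>2))" for n
  proof -
    have "(\<integral>\<^sup>+X. ennreal (w X * h n (v X)) \<partial>M) = ennreal (LINT X|M. w X * h n (v X))"
    proof (intro nn_integral_eq_integral w_mult_integrable[OF vn])
      show "AE X in M. 0 \<le> w X * h n (v X)" using w_nn by eventually_elim (simp add: hnn)
    qed
    also have "(LINT X|M. w X * h n (v X)) = (LINT X|M. U X \<bullet> quasi_grad lam (\<lambda>X. h n (v X)) X)"
      using weak[OF vn[of n]] by (simp add: w_def)
    also have "\<dots> \<le> (LINT X|M. norm (U X) * norm (quasi_grad lam v X))"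
    proof (rule integral_mono')
      show "integrable M (\<lambda>X. norm (U X) * norm (quasi_grad lam v X))"
        by (rule L2_product(1)) (use U_int Sv in auto)
      fix X assume "X \<in> space M"
      then have "quasi_grad lam (\<lambda>X. h n (v X)) X = h' n (v X) *\<^sub>R quasi_grad lam v X"
        using C1_0_compose(2)[OF v D c h0] by (simp add: space_M grushin_sqrtA_def)
      then have "U X \<bullet> quasi_grad lam (\<lambda>X. h n (v X)) X \<le> norm (U X) * (\<bar>h' n (v X)\<bar> * norm (quasi_grad lam v X))"
        using norm_cauchy_schwarz[of "U X" "quasi_grad lam (\<lambda>X. h n (v X)) X"] by simp
      also have "\<dots> \<le> norm (U X) * norm (quasi_grad lam v X)"
        using h'1 by (intro mult_left_mono mult_left_le_one_le) auto
      finally show "U X \<bullet> quasi_grad lam (\<lambda>X. h n (v X)) X \<le> norm (U X) * norm (quasi_grad lam v X)" .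
    qed simp
    also have "\<dots> \<le> sqrt U2 * sqrt (LINT X|M. (norm (quasi_grad lam v X))\<^sup>2)"
      unfolding U2_def by (rule L2_product(2)) (use U_int Sv in auto)
    finally show ?thesis by (simp add: ennreal_leI)
  qed
  show ?thesis
  proof (rule nn_integral_limit_le[OF _ _ step tendsto_const])
    show "(\<lambda>X. ennreal (w X * h n (v X))) \<in> borel_measurable M" for n by measurable
    show "AE X in M. (\<lambda>n. ennreal (w X * h n (v X))) \<longlonglongrightarrow> ennreal (w X * \<bar>v X\<bar>)"
    proof (intro AE_I2 tendsto_ennrealI tendsto_mult tendsto_const)
      fix X
      have "(\<lambda>n. sqrt ((v X)\<^sup>2 + (e n)\<^sup>2) - e n) \<longlonglongrightarrow> sqrt ((v X)\<^sup>2 + 0\<^sup>2) - 0"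
        by (intro tendsto_intros elim)
      then show "(\<lambda>n. h n (v X)) \<longlonglongrightarrow> \<bar>v X\<bar>" by (simp add: h_def)
    qed
  qed
qed

text \<open>The weighted bound is applied to the difference of \<open>\<phi> n\<close> and
  \<open>\<phi> k\<close>, and k tends to infinity with n fixed. The factor 2 comes from splitting
  the squared difference of the gradients at \<open>U\<close>.\<close>

lemma weighted_L1_rate:
  shows "integrable M (\<lambda>X. w X * \<bar>\<phi> n X - u X\<bar>)"
    and "(LINT X|M. w X * \<bar>\<phi> n X - u X\<bar>) \<le> sqrt U2 * sqrt (2 * d n)"
proof -
  have nn: "AE X in M. 0 \<le> w X * \<bar>\<phi> n X - u X\<bar>" using w_nn by eventually_elim simp
  \<comment> \<open>\<open>2 * 0\<close> is the limit of \<open>2 * d k\<close>, left in the shape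
    in which the limit rules produce it.\<close>
  have le: "(\<integral>\<^sup>+X. ennreal (w X * \<bar>\<phi> n X - u X\<bar>) \<partial>M) \<le> ennreal (sqrt U2 * sqrt (2 * d n + 2 * 0))"
  proof (rule nn_integral_limit_le)
    show "(\<lambda>X. ennreal (w X * \<bar>\<phi> n X - \<phi> k X\<bar>)) \<in> borel_measurable M" for k by measurable
    show "AE X in M. (\<lambda>k. ennreal (w X * \<bar>\<phi> n X - \<phi> k X\<bar>)) \<longlonglongrightarrow> ennreal (w X * \<bar>\<phi> n X - u X\<bar>)"
      using \<phi>_lim by eventually_elim (intro tendsto_intros)
    show "(\<lambda>k. sqrt U2 * sqrt (2 * d n + 2 * d k)) \<longlonglongrightarrow> sqrt U2 * sqrt (2 * d n + 2 * 0)"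
      by (intro tendsto_intros d_lim)
    fix k
    have "(\<integral>\<^sup>+X. ennreal (w X * \<bar>\<phi> n X - \<phi> k X\<bar>) \<partial>M)
      \<le> ennreal (sqrt U2 * sqrt (LINT X|M. (norm (quasi_grad lam (\<lambda>X. \<phi> n X - \<phi> k X) X))\<^sup>2))"
      by (rule weighted_L1_bound[OF C1_0_diff(1)[OF \<phi> \<phi>]])
    also have "(LINT X|M. (norm (quasi_grad lam (\<lambda>X. \<phi> n X - \<phi> k X) X))\<^sup>2)
       = (LINT X|M. (norm ((quasi_grad lam (\<phi> n) X - U X) - (quasi_grad lam (\<phi> k) X - U X)))\<^sup>2)"
      by (rule Bochner_Integration.integral_cong)
         (simp_all add: space_M C1_0_diff(2)[OF \<phi> \<phi>] grushin_sqrtA_def scaleR_diff_right)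
    also have "sqrt U2 * sqrt \<dots> \<le> sqrt U2 * sqrt (2 * d n + 2 * d k)"
      unfolding d_def
      by (intro mult_left_mono real_sqrt_le_mono L2_diff(2) L2_diff(1)[OF _ _ C1_0_int[OF \<phi> lam0] U_int]) (auto simp: U2_nn)
    finally show "(\<integral>\<^sup>+X. ennreal (w X * \<bar>\<phi> n X - \<phi> k X\<bar>) \<partial>M) \<le> ennreal (sqrt U2 * sqrt (2 * d n + 2 * d k))"
      by (simp add: ennreal_leI)
  qed
  show int: "integrable M (\<lambda>X. w X * \<bar>\<phi> n X - u X\<bar>)"
  proof (rule integrableI_bounded)
    have "(\<integral>\<^sup>+X. ennreal (norm (w X * \<bar>\<phi> n X - u X\<bar>)) \<partial>M) = (\<integral>\<^sup>+X. ennreal (w X * \<bar>\<phi> n X - u X\<bar>) \<partial>M)"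
    proof (rule nn_integral_cong_AE)
      show "AE X in M. ennreal (norm (w X * \<bar>\<phi> n X - u X\<bar>)) = ennreal (w X * \<bar>\<phi> n X - u X\<bar>)"
        using nn by eventually_elim simp
    qed
    also have "\<dots> < \<infinity>" by (rule le_less_trans[OF le]) simp
    finally show "(\<integral>\<^sup>+X. ennreal (norm (w X * \<bar>\<phi> n X - u X\<bar>)) \<partial>M) < \<infinity>" .
  qed measurable
  show "(LINT X|M. w X * \<bar>\<phi> n X - u X\<bar>) \<le> sqrt U2 * sqrt (2 * d n)"
    using le unfolding nn_integral_eq_integral[OF int nn]
    by (subst (asm) ennreal_le_iff) (auto simp: U2_nn d_nn)
qed

text \<open>Dominated convergence with L |U|^2 as dominating function. It is used with k = h' in the
  energy identity and with k the square of h' in the Sobolev inequality.\<close>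

lemma bounded_weight:
  fixes k :: "real \<Rightarrow> real"
  assumes c: "continuous_on UNIV k" and L: "\<And>t. \<bar>k t\<bar> \<le> L"
  shows "integrable M (\<lambda>X. k (\<phi> n X) * (norm (U X))\<^sup>2)" "integrable M (\<lambda>X. k (u X) * (norm (U X))\<^sup>2)"
    and "(\<lambda>n. LINT X|M. k (\<phi> n X) * (norm (U X))\<^sup>2) \<longlonglongrightarrow> (LINT X|M. k (u X) * (norm (U X))\<^sup>2)"
proof -
  have [measurable]: "k \<in> borel_measurable borel" using c by (rule borel_measurable_continuous_onI)
  show "integrable M (\<lambda>X. k (\<phi> n X) * (norm (U X))\<^sup>2)" "integrable M (\<lambda>X. k (u X) * (norm (U X))\<^sup>2)"
    by (rule Bochner_Integration.integrable_bound[OF integrable_mult_right[OF U_int, of L]];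
        force simp: abs_mult intro!: mult_right_mono L order_trans[OF L abs_ge_self])+
  show "(\<lambda>n. LINT X|M. k (\<phi> n X) * (norm (U X))\<^sup>2) \<longlonglongrightarrow> (LINT X|M. k (u X) * (norm (U X))\<^sup>2)"
  proof (rule integral_dominated_convergence)
    show "integrable M (\<lambda>X. L * (norm (U X))\<^sup>2)" using U_int by simp
    have k: "isCont k t" for t using c by (simp add: continuous_on_eq_continuous_at)
    show "AE X in M. (\<lambda>n. k (\<phi> n X) * (norm (U X))\<^sup>2) \<longlonglongrightarrow> k (u X) * (norm (U X))\<^sup>2"
      using \<phi>_lim by eventually_elim (intro tendsto_mult tendsto_const isCont_tendsto_compose[OF k])
    show "AE X in M. norm (k (\<phi> n X) * (norm (U X))\<^sup>2) \<le> L * (norm (U X))\<^sup>2" for n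
      using L by (auto simp: abs_mult intro!: mult_right_mono)
  qed measurable
qed

context
  fixes h h' :: "real \<Rightarrow> real" and L :: real
  assumes D: "\<And>t. (h has_real_derivative h' t) (at t)" and c: "continuous_on UNIV h'"
    and L: "\<And>t. \<bar>h' t\<bar> \<le> L" and h0: "h 0 = 0"
begin

lemma h_Lipschitz: "\<bar>h s - h t\<bar> \<le> L * \<bar>s - t\<bar>"
proof -
  have "norm (h s - h t) \<le> L * norm (s - t)"
    by (rule field_differentiable_bound[where S = UNIV and f' = h']) (use D L in auto)
  then show ?thesis by simp
qed

lemma h_borel [measurable]: "h \<in> borel_measurable borel" "h' \<in> borel_measurable borel"
  using c D by (auto intro!: borel_measurable_continuous_onI continuous_at_imp_continuous_on DERIV_isCont)

text \<open>h(u) itself need not be an admissible test function, so the equation is tested with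
  h(\<phi> n). On the right, Lipschitz continuity turns the weighted L^1 rate into convergence. On
  the left, replacing the gradient of \<phi> n by \<open>U\<close> costs a Cauchy-Schwarz error of
  order sqrt(d n).\<close>

lemma energy_identity:
  shows "integrable M (\<lambda>X. w X * h (u X))"
    and "(LINT X|M. h' (u X) * (norm (U X))\<^sup>2) = (LINT X|M. w X * h (u X))"
proof -
  have hn: "(\<lambda>X. h (\<phi> n X)) \<in> C1_0 \<Omega>" for n by (rule C1_0_compose(1)[OF \<phi> D c h0])
  have diff_le: "AE X in M. \<bar>w X * h (\<phi> n X) - w X * h (u X)\<bar> \<le> L * (w X * \<bar>\<phi> n X - u X\<bar>)" for n
    using w_nn
  proof eventually_elim
    case (elim X)
    have "\<bar>w X * h (\<phi> n X) - w X * h (u X)\<bar> = w X * \<bar>h (\<phi> n X) - h (u X)\<bar>"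
      using elim by (simp add: right_diff_distrib[symmetric] abs_mult)
    also have "\<dots> \<le> w X * (L * \<bar>\<phi> n X - u X\<bar>)" using elim h_Lipschitz by (intro mult_left_mono)
    finally show ?case by (simp add: mult.left_commute)
  qed
  have idiff: "integrable M (\<lambda>X. w X * h (\<phi> n X) - w X * h (u X))" for n
    by (rule Bochner_Integration.integrable_bound[OF integrable_mult_right[OF weighted_L1_rate(1), of L n]])
       (measurable, use diff_le[of n] in \<open>auto elim!: eventually_mono\<close>)
  \<comment> \<open>Any index would do in place of 0: the first term is integrable by compact
    support, the bracket because w |\<phi> 0 - u| is.\<close>
  have "integrable M (\<lambda>X. w X * h (\<phi> 0 X) - (w X * h (\<phi> 0 X) - w X * h (u X)))"
    using w_mult_integrable[OF hn] idiff by (rule Bochner_Integration.integrable_diff)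
  then show int: "integrable M (\<lambda>X. w X * h (u X))" by simp
  have L0: "L \<ge> 0" using L[of 0] by simp
  have R: "(\<lambda>n. LINT X|M. w X * h (\<phi> n X)) \<longlonglongrightarrow> (LINT X|M. w X * h (u X))"
  proof (rule LIM_zero_cancel, rule Lim_null_comparison)
    show "\<forall>\<^sub>F n in sequentially. norm ((LINT X|M. w X * h (\<phi> n X)) - (LINT X|M. w X * h (u X))) \<le> L * (sqrt U2 * sqrt (2 * d n))"
    proof (intro always_eventually allI)
      fix n
      have "norm ((LINT X|M. w X * h (\<phi> n X)) - (LINT X|M. w X * h (u X))) = norm (LINT X|M. w X * h (\<phi> n X) - w X * h (u X))"
        by (simp add: Bochner_Integration.integral_diff[OF w_mult_integrable[OF hn] int])
      also have "\<dots> \<le> (LINT X|M. L * (w X * \<bar>\<phi> n X - u X\<bar>))"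
        using diff_le[of n] weighted_L1_rate(1)[of n] idiff[of n]
        by (intro order_trans[OF Bochner_Integration.integral_norm_bound] integral_mono_AE) auto
      also have "\<dots> \<le> L * (sqrt U2 * sqrt (2 * d n))" using weighted_L1_rate(2) L0 by (simp add: mult_left_mono)
      finally show "norm ((LINT X|M. w X * h (\<phi> n X)) - (LINT X|M. w X * h (u X))) \<le> L * (sqrt U2 * sqrt (2 * d n))" .
    qed
    have "(\<lambda>n. L * (sqrt U2 * sqrt (2 * d n))) \<longlonglongrightarrow> L * (sqrt U2 * sqrt (2 * 0))" by (intro tendsto_intros d_lim)
    then show "(\<lambda>n. L * (sqrt U2 * sqrt (2 * d n))) \<longlonglongrightarrow> 0" by simp
  qed
  have iprod: "integrable M (\<lambda>X. norm (U X) * norm (quasi_grad lam (\<phi> n) X - U X))" for n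
    by (rule L2_product(1)) (use U_int L2_diff(1)[OF _ _ C1_0_int[OF \<phi> lam0] U_int] in auto)
  have icross: "integrable M (\<lambda>X. h' (\<phi> n X) * (U X \<bullet> (quasi_grad lam (\<phi> n) X - U X)))" for n
    by (rule Bochner_Integration.integrable_bound[OF integrable_mult_right[OF iprod, of L n]])
       (measurable, use L L0 in \<open>auto simp: abs_mult intro!: mult_mono Cauchy_Schwarz_ineq2\<close>)
  have Z: "(\<lambda>n. LINT X|M. h' (\<phi> n X) * (U X \<bullet> (quasi_grad lam (\<phi> n) X - U X))) \<longlonglongrightarrow> 0"
  proof (rule Lim_null_comparison)
    show "\<forall>\<^sub>F n in sequentially. norm (LINT X|M. h' (\<phi> n X) * (U X \<bullet> (quasi_grad lam (\<phi> n) X - U X))) \<le> L * (sqrt U2 * sqrt (d n))"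
    proof (intro always_eventually allI)
      fix n
      have "norm (LINT X|M. h' (\<phi> n X) * (U X \<bullet> (quasi_grad lam (\<phi> n) X - U X))) \<le> (LINT X|M. L * (norm (U X) * norm (quasi_grad lam (\<phi> n) X - U X)))"
        using L L0 iprod by (intro Bochner_Integration.integral_norm_bound_integral[OF icross])
          (auto simp: abs_mult intro!: mult_mono Cauchy_Schwarz_ineq2)
      also have "\<dots> \<le> L * (sqrt U2 * sqrt (d n))"
        using L0 L2_product(2)[OF U_meas _ U_int, of "\<lambda>X. quasi_grad lam (\<phi> n) X - U X"]
          L2_diff(1)[OF _ _ C1_0_int[OF \<phi> lam0] U_int, of n]
        by (auto simp: U2_def d_def intro!: mult_left_mono)
      finally show "norm (LINT X|M. h' (\<phi> n X) * (U X \<bullet> (quasi_grad lam (\<phi> n) X - U X))) \<le> L * (sqrt U2 * sqrt (d n))" .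
    qed
    have "(\<lambda>n. L * (sqrt U2 * sqrt (d n))) \<longlonglongrightarrow> L * (sqrt U2 * sqrt 0)" by (intro tendsto_intros d_lim)
    then show "(\<lambda>n. L * (sqrt U2 * sqrt (d n))) \<longlonglongrightarrow> 0" by simp
  qed
  have "(LINT X|M. w X * h (\<phi> n X)) = (LINT X|M. h' (\<phi> n X) * (norm (U X))\<^sup>2) + (LINT X|M. h' (\<phi> n X) * (U X \<bullet> (quasi_grad lam (\<phi> n) X - U X)))" for n
  proof -
    have "(LINT X|M. w X * h (\<phi> n X)) = (LINT X|M. U X \<bullet> quasi_grad lam (\<lambda>X. h (\<phi> n X)) X)"
      using weak[OF hn[of n]] by (simp add: w_def)
    also have "\<dots> = (LINT X|M. h' (\<phi> n X) * (norm (U X))\<^sup>2 + h' (\<phi> n X) * (U X \<bullet> (quasi_grad lam (\<phi> n) X - U X)))"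
    proof (rule Bochner_Integration.integral_cong)
      fix X assume "X \<in> space M"
      then have "quasi_grad lam (\<lambda>X. h (\<phi> n X)) X = h' (\<phi> n X) *\<^sub>R quasi_grad lam (\<phi> n) X"
        using C1_0_compose(2)[OF \<phi> D c h0] by (simp add: space_M grushin_sqrtA_def)
      then show "U X \<bullet> quasi_grad lam (\<lambda>X. h (\<phi> n X)) X = h' (\<phi> n X) * (norm (U X))\<^sup>2 + h' (\<phi> n X) * (U X \<bullet> (quasi_grad lam (\<phi> n) X - U X))"
        by (simp add: inner_diff_right power2_norm_eq_inner algebra_simps)
    qed simp
    also have "\<dots> = (LINT X|M. h' (\<phi> n X) * (norm (U X))\<^sup>2) + (LINT X|M. h' (\<phi> n X) * (U X \<bullet> (quasi_grad lam (\<phi> n) X - U X)))"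
      by (rule Bochner_Integration.integral_add[OF bounded_weight(1)[OF c L] icross])
    finally show ?thesis .
  qed
  then have "(\<lambda>n. LINT X|M. w X * h (\<phi> n X)) \<longlonglongrightarrow> (LINT X|M. h' (u X) * (norm (U X))\<^sup>2) + 0"
    using tendsto_add[OF bounded_weight(3)[OF c L] Z] by simp
  with R show "(LINT X|M. h' (u X) * (norm (U X))\<^sup>2) = (LINT X|M. w X * h (u X))"
    by (simp add: LIMSEQ_unique)
qed


text \<open>The Sobolev inequality for h(\<phi> n): the left-hand side passes to the limit by Fatou,
  while the energies on the right really converge.\<close>

lemma sobolev_compose:
  assumes C: "C > 0" and p: "p > 0"
    and S: "\<And>v. v \<in> C1_0 \<Omega> \<Longrightarrow> (\<integral>\<^sup>+X. ennreal (\<bar>v X\<bar> powr p) \<partial>M)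
       \<le> ennreal (C * (LINT X|M. (norm (quasi_grad lam v X))\<^sup>2) powr (p / 2))"
  shows "(\<integral>\<^sup>+X. ennreal (\<bar>h (u X)\<bar> powr p) \<partial>M) \<le> ennreal (C * (LINT X|M. (h' (u X))\<^sup>2 * (norm (U X))\<^sup>2) powr (p / 2))"
proof -
  have hn: "(\<lambda>X. h (\<phi> n X)) \<in> C1_0 \<Omega>" for n by (rule C1_0_compose(1)[OF \<phi> D c h0])
  have c2: "continuous_on UNIV (\<lambda>t. (h' t)\<^sup>2)" by (intro continuous_intros c)
  have L2: "\<bar>(h' t)\<^sup>2\<bar> \<le> L\<^sup>2" for t using power_mono[OF L[of t], of 2] by simp
  note bw = bounded_weight[OF c2 L2]
  define e where "e n = (LINT X|M. (norm (quasi_grad lam (\<lambda>X. h (\<phi> n X)) X))\<^sup>2)" for n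
  let ?S = "\<lambda>n. quasi_grad lam (\<phi> n)"
  note Sint = C1_0_int[OF \<phi> lam0]
  note dint = L2_diff(1)[OF _ U_meas Sint U_int]
  have e: "e n = (LINT X|M. (h' (\<phi> n X))\<^sup>2 * (norm (?S n X))\<^sup>2)" for n
    unfolding e_def
  proof (rule Bochner_Integration.integral_cong)
    fix X assume "X \<in> space M"
    then have "quasi_grad lam (\<lambda>X. h (\<phi> n X)) X = h' (\<phi> n X) *\<^sub>R ?S n X"
      using C1_0_compose(2)[OF \<phi> D c h0] by (simp add: space_M grushin_sqrtA_def)
    then show "(norm (quasi_grad lam (\<lambda>X. h (\<phi> n X)) X))\<^sup>2 = (h' (\<phi> n X))\<^sup>2 * (norm (?S n X))\<^sup>2"
      by (simp add: power_mult_distrib)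
  qed simp
  have iS: "integrable M (\<lambda>X. (h' (\<phi> n X))\<^sup>2 * (norm (?S n X))\<^sup>2)" for n
    by (rule Bochner_Integration.integrable_bound[OF integrable_mult_right[OF Sint, of "L\<^sup>2" n]])
       (measurable, use L2 in \<open>auto simp: abs_mult intro!: mult_right_mono\<close>)
  have idom: "integrable M (\<lambda>X. (norm (?S n X - U X))\<^sup>2 + 2 * (norm (?S n X - U X) * norm (U X)))" for n
    using L2_product(1)[OF _ U_meas dint U_int] dint by auto
  \<comment> \<open>Two changes in succession: first the gradient is replaced by \<open>U\<close>
    under the unchanged weight h'(\<phi> n)^2, then \<open>bounded_weight\<close> moves the weight
    to u.\<close>
  have "(\<lambda>n. e n - (LINT X|M. (h' (\<phi> n X))\<^sup>2 * (norm (U X))\<^sup>2)) \<longlonglongrightarrow> 0"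
  proof (rule Lim_null_comparison)
    show "\<forall>\<^sub>F n in sequentially. norm (e n - (LINT X|M. (h' (\<phi> n X))\<^sup>2 * (norm (U X))\<^sup>2)) \<le> L\<^sup>2 * (d n + 2 * (sqrt (d n) * sqrt U2))"
    proof (intro always_eventually allI)
      fix n
      have "norm (e n - (LINT X|M. (h' (\<phi> n X))\<^sup>2 * (norm (U X))\<^sup>2)) = norm (LINT X|M. (h' (\<phi> n X))\<^sup>2 * ((norm (?S n X))\<^sup>2 - (norm (U X))\<^sup>2))"
        unfolding e by (simp add: Bochner_Integration.integral_diff[OF iS bw(1), symmetric] right_diff_distrib)
      also have "\<dots> \<le> (LINT X|M. L\<^sup>2 * ((norm (?S n X - U X))\<^sup>2 + 2 * (norm (?S n X - U X) * norm (U X))))"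
      proof (rule Bochner_Integration.integral_norm_bound_integral)
        show "integrable M (\<lambda>X. (h' (\<phi> n X))\<^sup>2 * ((norm (?S n X))\<^sup>2 - (norm (U X))\<^sup>2))"
          using Bochner_Integration.integrable_diff[OF iS bw(1)] by (simp add: right_diff_distrib)
        show "integrable M (\<lambda>X. L\<^sup>2 * ((norm (?S n X - U X))\<^sup>2 + 2 * (norm (?S n X - U X) * norm (U X))))"
          using idom by simp
        fix X
        have "\<bar>(norm a)\<^sup>2 - (norm b)\<^sup>2\<bar> \<le> (norm (a - b))\<^sup>2 + 2 * (norm (a - b) * norm b)" for a b :: "real \<times> (real ^ 'm)"
        proof -
          have "(norm a)\<^sup>2 - (norm b)\<^sup>2 = (norm (a - b))\<^sup>2 + 2 * ((a - b) \<bullet> b)"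
            by (simp add: power2_norm_eq_inner inner_diff inner_commute algebra_simps)
          moreover have "\<bar>(a - b) \<bullet> b\<bar> \<le> norm (a - b) * norm b" by (rule Cauchy_Schwarz_ineq2)
          ultimately show ?thesis using zero_le_power2[of "norm (a - b)"] by linarith
        qed
        then show "norm ((h' (\<phi> n X))\<^sup>2 * ((norm (?S n X))\<^sup>2 - (norm (U X))\<^sup>2)) \<le> L\<^sup>2 * ((norm (?S n X - U X))\<^sup>2 + 2 * (norm (?S n X - U X) * norm (U X)))"
          unfolding real_norm_def abs_mult using L2[of "\<phi> n X"] by (intro mult_mono) auto
      qed
      also have "\<dots> = L\<^sup>2 * (d n + 2 * (LINT X|M. norm (?S n X - U X) * norm (U X)))"
        using L2_product(1)[OF _ U_meas dint U_int, of n] dint[of n] by (simp add: d_def)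
      also have "\<dots> \<le> L\<^sup>2 * (d n + 2 * (sqrt (d n) * sqrt U2))"
        unfolding d_def U2_def using L2_product(2)[OF _ U_meas dint U_int, of n]
        by (intro mult_left_mono add_left_mono) auto
      finally show "norm (e n - (LINT X|M. (h' (\<phi> n X))\<^sup>2 * (norm (U X))\<^sup>2)) \<le> L\<^sup>2 * (d n + 2 * (sqrt (d n) * sqrt U2))" .
    qed
    have "(\<lambda>n. L\<^sup>2 * (d n + 2 * (sqrt (d n) * sqrt U2))) \<longlonglongrightarrow> L\<^sup>2 * (0 + 2 * (sqrt 0 * sqrt U2))" by (intro tendsto_intros d_lim)
    then show "(\<lambda>n. L\<^sup>2 * (d n + 2 * (sqrt (d n) * sqrt U2))) \<longlonglongrightarrow> 0" by simp
  qed
  from tendsto_add[OF this bw(3)]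
  have elim: "e \<longlonglongrightarrow> (LINT X|M. (h' (u X))\<^sup>2 * (norm (U X))\<^sup>2)" by simp
  show ?thesis
  proof (rule nn_integral_limit_le)
    show "(\<lambda>X. ennreal (\<bar>h (\<phi> n X)\<bar> powr p)) \<in> borel_measurable M" for n by measurable
    show "(\<integral>\<^sup>+X. ennreal (\<bar>h (\<phi> n X)\<bar> powr p) \<partial>M) \<le> ennreal (C * e n powr (p / 2))" for n
      using S[OF hn] unfolding e_def .
    show "(\<lambda>n. C * e n powr (p / 2)) \<longlonglongrightarrow> C * (LINT X|M. (h' (u X))\<^sup>2 * (norm (U X))\<^sup>2) powr (p / 2)"
      using p by (intro tendsto_mult tendsto_const tendsto_powr' elim) (auto simp: e_def)
    have "(\<lambda>n. \<bar>h (\<phi> n X)\<bar> powr p) \<longlonglongrightarrow> \<bar>h (u X)\<bar> powr p" if "(\<lambda>n. \<phi> n X) \<longlonglongrightarrow> u X" for X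
      using p isCont_tendsto_compose[OF DERIV_isCont[OF D] that]
      by (intro tendsto_powr' tendsto_rabs tendsto_const) auto
    then show "AE X in M. (\<lambda>n. ennreal (\<bar>h (\<phi> n X)\<bar> powr p)) \<longlonglongrightarrow> ennreal (\<bar>h (u X)\<bar> powr p)"
      using \<phi>_lim by (auto elim!: eventually_mono intro: tendsto_ennrealI)
  qed
qed

end

text \<open>H is measured, h is tested with. Sobolev bounds H(u) by the integral of H'(u)^2 |U|^2,
  the pointwise inequality replaces H'^2 by h', and the energy identity turns the result into the
  right-hand side of the equation. The estimate no longer mentions \<open>U\<close>.\<close>

lemma key_estimate:
  assumes C: "C > 0" and p: "p > 0"
    and S: "\<And>v. v \<in> C1_0 \<Omega> \<Longrightarrow> (\<integral>\<^sup>+X. ennreal (\<bar>v X\<bar> powr p) \<partial>M)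
       \<le> ennreal (C * (LINT X|M. (norm (quasi_grad lam v X))\<^sup>2) powr (p / 2))"
    and H: "\<And>t. (H has_real_derivative H' t) (at t)" "continuous_on UNIV H'" "\<And>t. \<bar>H' t\<bar> \<le> L" "H 0 = 0"
    and h: "\<And>t. (h has_real_derivative h' t) (at t)" "continuous_on UNIV h'" "\<And>t. \<bar>h' t\<bar> \<le> K" "h 0 = 0"
    and le: "\<And>t. (H' t)\<^sup>2 \<le> h' t"
  shows "integrable M (\<lambda>X. w X * h (u X))"
    and "integrable M (\<lambda>X. \<bar>H (u X)\<bar> powr p)"
    and "(LINT X|M. \<bar>H (u X)\<bar> powr p) \<le> C * (LINT X|M. w X * h (u X)) powr (p / 2)"
proof -
  show "integrable M (\<lambda>X. w X * h (u X))" by (rule energy_identity(1)[OF h])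
  have H2: "\<bar>(H' t)\<^sup>2\<bar> \<le> L\<^sup>2" for t using power_mono[OF H(3)[of t], of 2] by simp
  have c2: "continuous_on UNIV (\<lambda>t. (H' t)\<^sup>2)" by (intro continuous_intros H)
  have [measurable]: "H \<in> borel_measurable borel"
    using H(1) by (auto intro!: borel_measurable_continuous_onI continuous_at_imp_continuous_on DERIV_isCont)
  have "(\<integral>\<^sup>+X. ennreal (\<bar>H (u X)\<bar> powr p) \<partial>M) \<le> ennreal (C * (LINT X|M. (H' (u X))\<^sup>2 * (norm (U X))\<^sup>2) powr (p / 2))"
    by (rule sobolev_compose[OF H C p S])
  also have "\<dots> \<le> ennreal (C * (LINT X|M. h' (u X) * (norm (U X))\<^sup>2) powr (p / 2))"
    using C p bounded_weight(2)[OF c2 H2] bounded_weight(2)[OF h(2,3)]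
    by (intro ennreal_leI mult_left_mono powr_mono2 integral_mono mult_right_mono le) auto
  also have "(LINT X|M. h' (u X) * (norm (U X))\<^sup>2) = (LINT X|M. w X * h (u X))"
    by (rule energy_identity(2)[OF h])
  finally have *: "(\<integral>\<^sup>+X. ennreal (\<bar>H (u X)\<bar> powr p) \<partial>M) \<le> ennreal (C * (LINT X|M. w X * h (u X)) powr (p / 2))" .
  show int: "integrable M (\<lambda>X. \<bar>H (u X)\<bar> powr p)"
  proof (rule integrableI_bounded)
    show "(\<integral>\<^sup>+X. ennreal (norm (\<bar>H (u X)\<bar> powr p)) \<partial>M) < \<infinity>"
      using le_less_trans[OF * ennreal_less_top] by simp
  qed measurable
  show "(LINT X|M. \<bar>H (u X)\<bar> powr p) \<le> C * (LINT X|M. w X * h (u X)) powr (p / 2)"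
    using * C unfolding nn_integral_eq_integral[OF int AE_I2[OF powr_ge_zero]]
    by (subst (asm) ennreal_le_iff) auto
qed

end

section \<open>Iteration and saturated powers\<close>

text \<open>Along the levels k0 + D (1 - 2^(-n)) the function a decays like 2^(-\<mu> n): since
  \<beta> > 1, the power on the right beats the loss from the shrinking increments. By monotonicity
  a (k0 + D) lies below all these values.\<close>

lemma stampacchia_iteration:
  fixes a :: "real \<Rightarrow> real"
  assumes nn: "\<And>k. a k \<ge> 0" and mono: "\<And>k l. k \<le> l \<Longrightarrow> a l \<le> a k"
    and K: "K > 0" and p: "p > 0" and \<beta>: "\<beta> > 1"
    and decay: "\<And>k \<delta>. k \<ge> k0 \<Longrightarrow> \<delta> > 0 \<Longrightarrow> \<delta> powr p * a (k + \<delta>) \<le> K * a k powr \<beta>"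
  shows "\<exists>D>0. a (k0 + D) = 0"
proof -
  \<comment> \<open>The rate at which the powers of 2 balance, p = \<mu> (\<beta> - 1).\<close>
  define \<mu> where "\<mu> = p / (\<beta> - 1)"
  have \<mu>: "\<mu> > 0" using p \<beta> by (simp add: \<mu>_def)
  have p\<mu>: "p = \<mu> * (\<beta> - 1)" using \<beta> by (simp add: \<mu>_def)
  \<comment> \<open>D^p has to absorb K a(k0)^(\<beta>-1) and the factor 2^(p+\<mu>) caused by
    passing from n to n + 1. The summand 1 keeps D positive when a(k0) = 0.\<close>
  define R where "R = K * 2 powr (p + \<mu>) * (a k0 powr (\<beta> - 1) + 1)"
  have R: "R > 0" using K by (simp add: R_def add_nonneg_pos)
  define D where "D = R powr (1 / p)"
  have D: "D > 0" "D powr p = R" using R p by (auto simp: D_def powr_powr)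
  define k where "k n = k0 + D * (1 - 2 powr (- real n))" for n
  have claim: "a (k n) \<le> a k0 * 2 powr (- \<mu> * real n)" for n
  proof (induction n)
    case 0
    then show ?case by (simp add: k_def)
  next
    case (Suc n)
    define \<delta> where "\<delta> = D * 2 powr (- real (Suc n))"
    have \<delta>: "\<delta> > 0" using D by (simp add: \<delta>_def)
    have kS: "k (Suc n) = k n + \<delta>"
      by (simp add: k_def \<delta>_def powr_diff powr_minus field_simps powr_add)
    have kn: "k n \<ge> k0" using D powr_mono[of "- real n" 0 2] by (simp add: k_def)
    have "\<delta> powr p * a (k (Suc n)) \<le> K * a (k n) powr \<beta>"
      unfolding kS by (rule decay[OF kn \<delta>])
    also have "\<dots> \<le> K * (a k0 * 2 powr (- \<mu> * real n)) powr \<beta>"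
      using K \<beta> nn Suc by (intro mult_left_mono powr_mono2) auto
    also have "\<dots> = K * (a k0 powr \<beta> * 2 powr (- \<mu> * real n * \<beta>))"
      using nn[of k0] by (simp add: powr_mult powr_powr)
    also have "a k0 powr \<beta> = a k0 powr (\<beta> - 1) * a k0"
      using nn[of k0] \<beta> powr_add[of "a k0" "\<beta> - 1" 1] by (cases "a k0 = 0") auto
    also have "K * (a k0 powr (\<beta> - 1) * a k0 * 2 powr (- \<mu> * real n * \<beta>))
       \<le> K * ((a k0 powr (\<beta> - 1) + 1) * a k0 * 2 powr (- \<mu> * real n * \<beta>))"
      using K nn[of k0] by (intro mult_left_mono mult_right_mono) auto
    also have "\<dots> = R * 2 powr (- p * real (Suc n)) * (a k0 * 2 powr (- \<mu> * real (Suc n)))"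
    proof -
      have "- \<mu> * real n * \<beta> = (p + \<mu>) + (- p * real (Suc n)) + (- \<mu> * real (Suc n))"
        unfolding p\<mu> by (simp add: algebra_simps)
      then have "2 powr (- \<mu> * real n * \<beta>) = 2 powr (p + \<mu>) * 2 powr (- p * real (Suc n)) * 2 powr (- \<mu> * real (Suc n))"
        by (simp only: powr_add)
      then show ?thesis unfolding R_def by (simp only: mult_ac)
    qed
    also have "R * 2 powr (- p * real (Suc n)) = \<delta> powr p"
      using D by (simp add: \<delta>_def powr_mult powr_powr algebra_simps)
    finally have "\<delta> powr p * a (k (Suc n)) \<le> \<delta> powr p * (a k0 * 2 powr (- \<mu> * real (Suc n)))" .
    then show ?case using \<delta> by simp
  qed
  have "(\<lambda>n. (2 powr (- \<mu>)) ^ n) \<longlonglongrightarrow> 0"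
    using \<mu> powr_less_mono[of "- \<mu>" 0 2] by (intro LIMSEQ_power_zero) simp
  then have "(\<lambda>n. a k0 * (2 powr (- \<mu>)) ^ n) \<longlonglongrightarrow> a k0 * 0"
    by (rule tendsto_mult[OF tendsto_const])
  moreover have "a (k0 + D) \<le> a k0 * (2 powr (- \<mu>)) ^ n" for n
  proof -
    have "k n \<le> k0 + D" using D by (simp add: k_def mult_left_le)
    then have "a (k0 + D) \<le> a (k n)" by (rule mono)
    also have "\<dots> \<le> a k0 * 2 powr (- \<mu> * real n)" by (rule claim)
    also have "2 powr (- \<mu> * real n) = (2 powr (- \<mu>)) ^ n"
      using powr_realpow[of "2 powr - \<mu>" n] by (simp add: powr_powr)
    finally show ?thesis .
  qed
  ultimately have "a (k0 + D) \<le> 0" by (intro LIMSEQ_le_const) auto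
  then show ?thesis using nn[of "k0 + D"] D by (intro exI[of _ D]) auto
qed

text \<open>
  The power of the saturation \<open>t / (1 + e t)\<close> is bounded with bounded derivative and tends to \<open>t\<^sup>\<alpha>\<close> as
  \<open>e \<rightarrow> 0\<close>. The square of its derivative is controlled by the derivative of another such power, which
  is what the key estimate asks for.
\<close>
definition satpow :: "real \<Rightarrow> real \<Rightarrow> real \<Rightarrow> real" where
  "satpow e \<alpha> t = (if t > 0 then (t / (1 + e * t)) powr \<alpha> else 0)"

definition satpow' :: "real \<Rightarrow> real \<Rightarrow> real \<Rightarrow> real" where
  "satpow' e \<alpha> t = (if t > 0 then \<alpha> * (t / (1 + e * t)) powr (\<alpha> - 1) / (1 + e * t)\<^sup>2 else 0)"

lemma satpow_le:
  assumes "e > 0" "\<alpha> > 0" "t > 0"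
  shows "satpow e \<alpha> t \<le> t powr \<alpha>" "satpow e \<alpha> t \<le> (1 / e) powr \<alpha>"
proof -
  have et: "0 < e * t" "0 < 1 + e * t" "0 < t * (e * t)" using assms by (auto simp: add_pos_pos)
  then have "t / (1 + e * t) \<le> t" "t / (1 + e * t) \<le> 1 / e" "0 \<le> t / (1 + e * t)"
    using assms by (auto simp: pos_divide_le_eq distrib_left)
  then show "satpow e \<alpha> t \<le> t powr \<alpha>" "satpow e \<alpha> t \<le> (1 / e) powr \<alpha>"
    using assms by (auto simp: satpow_def intro!: powr_mono2)
qed

text \<open>At 0 the difference quotient is at most |h|^(\<alpha>-1), which tends to 0 as \<alpha> >
  1; exponent 1 would leave a kink.\<close>

lemma DERIV_satpow:
  assumes e: "e > 0" and \<alpha>: "\<alpha> > 1"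
  shows "(satpow e \<alpha> has_real_derivative satpow' e \<alpha> t) (at t)"
proof -
  consider "t < 0" | "t > 0" | "t = 0" by linarith
  then show ?thesis
  proof cases
    case 1
    have "((\<lambda>s. 0) has_real_derivative 0) (at t)" by simp
    then have "(satpow e \<alpha> has_real_derivative 0) (at t)"
      by (rule has_field_derivative_transform_within_open[where S = "{..<0}"]) (use 1 in \<open>auto simp: satpow_def\<close>)
    then show ?thesis using 1 by (simp add: satpow'_def)
  next
    case 2
    have p: "1 + e * t > 0" using e 2 by (simp add: add_pos_pos)
    have "((\<lambda>t. t / (1 + e * t)) has_real_derivative 1 / (1 + e * t)\<^sup>2) (at t)"
      using p by (auto intro!: derivative_eq_intros simp: power2_eq_square field_simps)
    from DERIV_powr[OF this _ DERIV_const, of \<alpha>]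
    have "((\<lambda>t. (t / (1 + e * t)) powr \<alpha>) has_real_derivative
      (t / (1 + e * t)) powr \<alpha> * (0 * ln (t / (1 + e * t)) + 1 / (1 + e * t)\<^sup>2 * \<alpha> / (t / (1 + e * t)))) (at t)"
      using p 2 by simp
    moreover have "(t / (1 + e * t)) powr \<alpha> * (0 * ln (t / (1 + e * t)) + 1 / (1 + e * t)\<^sup>2 * \<alpha> / (t / (1 + e * t))) = satpow' e \<alpha> t"
      using p 2 by (simp add: satpow'_def powr_diff mult_ac)
    ultimately have "((\<lambda>t. (t / (1 + e * t)) powr \<alpha>) has_real_derivative satpow' e \<alpha> t) (at t)" by simp
    then show ?thesis
      by (rule has_field_derivative_transform_within_open[where S = "{0<..}"]) (use 2 in \<open>auto simp: satpow_def\<close>)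
  next
    case 3
    have "((\<lambda>h. satpow e \<alpha> h / h) \<longlongrightarrow> 0) (at 0)"
    proof (rule Lim_null_comparison)
      have "norm (satpow e \<alpha> h / h) \<le> \<bar>h\<bar> powr (\<alpha> - 1)" for h
      proof (cases "h > 0")
        case True
        then have "satpow e \<alpha> h / h \<le> h powr \<alpha> / h" using satpow_le(1)[OF e] \<alpha> by (intro divide_right_mono) auto
        moreover have "satpow e \<alpha> h / h \<ge> 0" using True by (simp add: satpow_def)
        ultimately show ?thesis using True by (simp add: powr_diff)
      qed (simp add: satpow_def)
      then show "\<forall>\<^sub>F h in at 0. norm (satpow e \<alpha> h / h) \<le> \<bar>h\<bar> powr (\<alpha> - 1)" by (intro always_eventually allI)
      have "((\<lambda>h. \<bar>h\<bar> powr (\<alpha> - 1)) \<longlongrightarrow> \<bar>0\<bar> powr (\<alpha> - 1)) (at (0::real))"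
        using \<alpha> by (intro tendsto_powr' tendsto_rabs tendsto_ident_at tendsto_const) auto
      then show "((\<lambda>h. \<bar>h\<bar> powr (\<alpha> - 1)) \<longlongrightarrow> 0) (at (0::real))" by simp
    qed
    then show ?thesis unfolding DERIV_def by (simp add: 3 satpow_def satpow'_def)
  qed
qed

lemma satpow'_bounds:
  assumes e: "e > 0" and \<alpha>: "\<alpha> > 1"
  shows "0 \<le> satpow' e \<alpha> t" "\<bar>satpow' e \<alpha> t\<bar> \<le> \<alpha> * (1 / e) powr (\<alpha> - 1)"
proof -
  show nn: "0 \<le> satpow' e \<alpha> t" using \<alpha> by (simp add: satpow'_def)
  show "\<bar>satpow' e \<alpha> t\<bar> \<le> \<alpha> * (1 / e) powr (\<alpha> - 1)"
  proof (cases "t > 0")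
    case True
    have "1 \<le> (1 + e * t)\<^sup>2" using e True by (simp add: one_le_power)
    then have "satpow' e \<alpha> t \<le> \<alpha> * (t / (1 + e * t)) powr (\<alpha> - 1)"
      using True \<alpha> by (simp add: satpow'_def divide_le_eq mult_left_le)
    also have "\<dots> \<le> \<alpha> * (1 / e) powr (\<alpha> - 1)"
      using satpow_le(2)[OF e, of "\<alpha> - 1" t] True \<alpha> by (simp add: satpow_def)
    finally show ?thesis using nn by simp
  qed (use \<alpha> e in \<open>simp add: satpow'_def\<close>)
qed

lemma continuous_on_satpow':
  assumes e: "e > 0" and \<alpha>: "\<alpha> > 1"
  shows "continuous_on UNIV (satpow' e \<alpha>)"
proof -
  \<comment> \<open>With \<open>max 0 t\<close> the case distinction disappears because
    \<open>0 powr x = 0\<close>, and a composition of continuous functions remains.\<close>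
  have eq: "satpow' e \<alpha> t = \<alpha> * (max 0 t / (1 + e * max 0 t)) powr (\<alpha> - 1) / (1 + e * max 0 t)\<^sup>2" for t
    using \<alpha> by (auto simp: satpow'_def max_def)
  have nz: "1 + e * max 0 t \<noteq> 0" for t :: real
    using e by (metis add_nonneg_eq_0_iff less_eq_real_def max.cobounded1 mult_nonneg_nonneg zero_le_one zero_neq_one)
  have nn: "0 \<le> max 0 t / (1 + e * max 0 t)" for t :: real using e by (intro divide_nonneg_nonneg add_nonneg_nonneg mult_nonneg_nonneg) auto
  show ?thesis unfolding eq[abs_def] using nz nn \<alpha>
    by (intro continuous_intros continuous_on_powr') auto
qed

text \<open>Both sides contain the same power of the saturation since 2 (g - 1) = (2 g - 1) - 1;
  this dictates the exponent 2 g - 1. The factor 1/(1 + e t)^2 of the chain rule, at most 1, occurs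
  squared on the left and once on the right.\<close>

lemma satpow'_square_le:
  assumes e: "e > 0" and g: "g > 1"
  shows "(satpow' e g t)\<^sup>2 \<le> g\<^sup>2 / (2 * g - 1) * satpow' e (2 * g - 1) t"
proof (cases "t > 0")
  case True
  define \<tau> where "\<tau> = t / (1 + e * t)"
  define q where "q = (1 + e * t)\<^sup>2"
  have "1 + e * t > 1" using e True by simp
  then have q: "q \<ge> 1" and \<tau>: "\<tau> > 0" using True by (auto simp: q_def \<tau>_def one_le_power)
  have "(\<tau> powr (g - 1))\<^sup>2 = \<tau> powr (2 * g - 1 - 1)"
    using \<tau> by (simp add: powr_powr powr_realpow[symmetric] mult.commute right_diff_distrib)
  then have "(satpow' e g t)\<^sup>2 = g\<^sup>2 * \<tau> powr (2 * g - 1 - 1) / q\<^sup>2"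
    using True by (simp add: satpow'_def \<tau>_def[symmetric] q_def[symmetric] power_mult_distrib power_divide)
  also have "\<dots> \<le> g\<^sup>2 * \<tau> powr (2 * g - 1 - 1) / q"
    using q by (intro divide_left_mono) (auto simp: power2_eq_square)
  also have "\<dots> = g\<^sup>2 / (2 * g - 1) * satpow' e (2 * g - 1) t"
    using True g by (simp add: satpow'_def \<tau>_def[symmetric] q_def[symmetric])
  finally show ?thesis .
qed (simp add: satpow'_def)

section \<open>Regularity of weak solutions\<close>

context grushin_weak_solution
begin

lemma finite_M: "finite_measure M"
proof (rule finite_measureI)
  have "emeasure M (space M) = emeasure lborel \<Omega>"
    using opn by (simp add: space_M emeasure_restrict_space)
  also have "\<dots> < \<infinity>" using bdd emeasure_bounded_finite by auto
  finally show "emeasure M (space M) \<noteq> \<infinity>" by simp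
qed

text \<open>Each bound on r has one purpose: the lower bound is equivalent to g >= 1, so that the
  power g is admissible, and r < Q/2 is equivalent to \<theta> < 1, so that the resulting inequality
  for Y is sublinear on the right.\<close>

lemma summability_gain:
  assumes C: "C > 0" and Q: "Q > 2" and p: "p = 2 * Q / (Q - 2)"
    and S: "\<And>v. v \<in> C1_0 \<Omega> \<Longrightarrow> (\<integral>\<^sup>+X. ennreal (\<bar>v X\<bar> powr p) \<partial>M)
       \<le> ennreal (C * (LINT X|M. (norm (quasi_grad lam v X))\<^sup>2) powr (p / 2))"
    and r: "holder_conjugate (p / (1 - \<nu>)) \<le> r" "r < Q / 2" "r > 1"
    and fr: "integrable M (\<lambda>X. \<bar>f X\<bar> powr r)"
  shows "integrable M (\<lambda>X. \<bar>u X\<bar> powr (Q * r * (\<nu> + 1) / (Q - 2 * r)))"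
proof -
  interpret finite_measure M by (rule finite_M)
  define s where "s = Q * r * (\<nu> + 1) / (Q - 2 * r)"
  define g where "g = s / p"
  have p2: "p > 2" using Q unfolding p by (simp add: field_simps)
  have Qr: "Q - 2 * r > 0" using r by simp
  have sg: "s = g * p" using p2 by (simp add: g_def)
  have g_eq: "g = r * (\<nu> + 1) * (Q - 2) / (2 * (Q - 2 * r))"
    using Q by (simp add: g_def s_def p mult_ac)
  have g1: "g \<ge> 1"
  proof -
    have den: "Q + 2 + \<nu> * (Q - 2) > 0" using Q nu by (simp add: add_pos_pos)
    have "holder_conjugate (p / (1 - \<nu>)) = 2 * Q / (Q + 2 + \<nu> * (Q - 2))"
    proof -
      define Z where "Z = (1 - \<nu>) * (Q - 2)"
      have Z: "Z > 0" using Q nu by (simp add: Z_def)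
      have "p / (1 - \<nu>) = 2 * Q / Z" unfolding p Z_def by (simp add: mult.commute)
      moreover have "2 * Q / Z - 1 = (Q + 2 + \<nu> * (Q - 2)) / Z"
        using Z by (simp add: divide_simps) (simp add: Z_def algebra_simps)
      ultimately show ?thesis using Z by (simp add: holder_conjugate_def)
    qed
    then have "2 * Q / (Q + 2 + \<nu> * (Q - 2)) \<le> r" using r by simp
    then have "2 * Q \<le> r * (Q + 2 + \<nu> * (Q - 2))" using den by (simp add: pos_divide_le_eq)
    then show ?thesis unfolding g_eq using Qr by (simp add: le_divide_eq algebra_simps)
  qed
  show ?thesis
  \<comment> \<open>At the endpoint s = p the Sobolev inequality for u itself is the claim, and the
    identity serves as both H and h; \<open>satpow\<close> with exponent 1 is not C^1.\<close>
  proof (cases "g = 1")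
    case True
    have "integrable M (\<lambda>X. \<bar>u X\<bar> powr p)"
      by (rule key_estimate(2)[where H = "\<lambda>t. t" and h = "\<lambda>t. t" and H' = "\<lambda>_. 1" and h' = "\<lambda>_. 1" and L = 1 and K = 1, OF C _ S])
         (use p2 in auto)
    then show ?thesis using sg True by (simp add: s_def)
  next
    case False
    then have g: "g > 1" using g1 by simp
    define r' where "r' = r / (r - 1)"
    have r': "r' > 1" "1 / r + 1 / r' = 1" using r by (auto simp: r'_def field_simps)
    \<comment> \<open>\<open>g\<close> is chosen such that the Hoelder power of the right-hand side reproduces the left-hand side.\<close>
    have s_r': "(2 * g - 1 - \<nu>) * r' = s"
    proof -
      have "2 * g = r * (\<nu> + 1) * (Q - 2) / (Q - 2 * r)"
      proof -
        have "2 * (x / (2 * y)) = x / y" for x y :: real by simp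
        then show ?thesis unfolding g_eq .
      qed
      then have "2 * g - 1 - \<nu> = (1 + \<nu>) * Q * (r - 1) / (Q - 2 * r)"
        using Qr by (simp add: field_simps)
      then show ?thesis using r Qr by (simp add: r'_def s_def mult_ac add.commute)
    qed
    define \<theta> where "\<theta> = (p / 2) * (1 / r')"
    have \<theta>: "\<theta> < 1"
    proof -
      have "p / 2 = Q / (Q - 2)" using Q by (simp add: p field_simps)
      moreover have "1 / r' = (r - 1) / r" by (simp add: r'_def)
      ultimately have "\<theta> = Q * (r - 1) / ((Q - 2) * r)" by (simp only: \<theta>_def times_divide_times_eq)
      moreover have "Q * (r - 1) < (Q - 2) * r" using r by (simp add: algebra_simps)
      ultimately show ?thesis using r Q by (simp add: divide_less_eq)
    qed
    define \<kappa> where "\<kappa> = g\<^sup>2 / (2 * g - 1)"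
    have \<kappa>: "\<kappa> > 0" using g by (simp add: \<kappa>_def)
    define F where "F = (LINT X|M. \<bar>f X\<bar> powr r) powr (1 / r)"
    have F: "F \<ge> 0" by (simp add: F_def)
    define Y0 where "Y0 = (C * (\<kappa> * F) powr (p / 2)) powr (1 / (1 - \<theta>))"
    have bound: "(\<integral>\<^sup>+X. ennreal (satpow e s (u X)) \<partial>M) \<le> ennreal Y0" if e: "e > 0" for e
    proof -
      have g2: "2 * g - 1 > 1" using g by simp
      let ?H = "satpow e g" and ?h = "\<lambda>t. \<kappa> * satpow e (2 * g - 1) t"
      define Kc where "Kc = \<kappa> * ((2 * g - 1) * (1 / e) powr (2 * g - 1 - 1))"
      note key = key_estimate[where H = ?H and H' = "satpow' e g" and h = ?h and h' = "\<lambda>t. \<kappa> * satpow' e (2 * g - 1) t"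
         and L = "g * (1 / e) powr (g - 1)" and K = Kc, OF C _ S]
      have prem: "\<bar>\<kappa> * satpow' e (2 * g - 1) t\<bar> \<le> Kc" for t
        using satpow'_bounds(2)[OF e g2, of t] \<kappa> by (simp add: abs_mult Kc_def)
      have Hs: "\<bar>?H t\<bar> powr p = satpow e s t" for t
        by (simp add: satpow_def powr_powr sg)
      have k1: "integrable M (\<lambda>X. w X * ?h (u X))"
        by (rule key(1)) (use p2 in \<open>auto intro!: DERIV_satpow e g g2 DERIV_cmult continuous_on_satpow' continuous_intros
          satpow'_bounds(2) prem satpow'_square_le[OF e g, folded \<kappa>_def] simp: satpow_def[of _ _ 0]\<close>)
      have k2: "integrable M (\<lambda>X. satpow e s (u X))"
        unfolding Hs[symmetric]
        by (rule key(2)) (use p2 in \<open>auto intro!: DERIV_satpow e g g2 DERIV_cmult continuous_on_satpow' continuous_intros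
          satpow'_bounds(2) prem satpow'_square_le[OF e g, folded \<kappa>_def] simp: satpow_def[of _ _ 0]\<close>)
      define Y where "Y = (LINT X|M. satpow e s (u X))"
      have snn: "satpow e s t \<ge> 0" for t by (simp add: satpow_def)
      have Y: "Y \<ge> 0" unfolding Y_def by (intro Bochner_Integration.integral_nonneg snn)
      have k3: "Y \<le> C * (LINT X|M. w X * ?h (u X)) powr (p / 2)"
        unfolding Y_def Hs[symmetric]
        by (rule key(3)) (use p2 in \<open>auto intro!: DERIV_satpow e g g2 DERIV_cmult continuous_on_satpow' continuous_intros
          satpow'_bounds(2) prem satpow'_square_le[OF e g, folded \<kappa>_def] simp: satpow_def[of _ _ 0]\<close>)
      define t where "t X = satpow e (2 * g - 1 - \<nu>) (u X)" for X
      have t_meas [measurable]: "t \<in> borel_measurable M" unfolding t_def satpow_def by measurable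
      have tr: "t X powr r' = satpow e s (u X)" for X
        by (simp add: t_def satpow_def powr_powr s_r')
      have "(\<lambda>X. \<bar>f X\<bar>) \<in> borel_measurable M" "AE X in M. 0 \<le> \<bar>f X\<bar>" "AE X in M. 0 \<le> t X"
        "integrable M (\<lambda>X. t X powr r')"
        using k2 by (simp, simp, simp add: t_def satpow_def, simp only: tr)
      note hold = Hoelder_integral[OF this(1) t_meas this(2,3) r(3) r' fr this(4)]
      have "(LINT X|M. w X * ?h (u X)) \<le> (LINT X|M. \<kappa> * (\<bar>f X\<bar> * t X))"
      proof (rule integral_mono_AE[OF k1])
        show "integrable M (\<lambda>X. \<kappa> * (\<bar>f X\<bar> * t X))" using hold(1) by simp
        show "AE X in M. w X * ?h (u X) \<le> \<kappa> * (\<bar>f X\<bar> * t X)"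
          using u_pos f_nn
        proof eventually_elim
          case (elim X)
          define \<tau> where "\<tau> = u X / (1 + e * u X)"
          have eu: "e * u X > 0" using e elim by simp
          then have \<tau>: "\<tau> > 0" using elim by (simp add: \<tau>_def)
          \<comment> \<open>Saturation only decreases u, so u^(-\<nu>) is at most \<tau>^(-\<nu>)
            and merges with the saturated power. The estimate thus stays closed in terms of Y, with
            no unsaturated u left.\<close>
          have "\<tau> \<le> u X" unfolding \<tau>_def using eu elim by (simp add: pos_divide_le_eq distrib_left)
          then have le: "\<tau> powr \<nu> \<le> u X powr \<nu>" using \<tau> nu by (intro powr_mono2) auto
          have "f X / u X powr \<nu> * \<tau> powr (2 * g - 1) \<le> f X / \<tau> powr \<nu> * \<tau> powr (2 * g - 1)"
            using le \<tau> elim by (intro mult_right_mono divide_left_mono) auto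
          also have "\<dots> = f X * \<tau> powr (2 * g - 1 - \<nu>)" using \<tau> by (simp add: powr_diff)
          finally have "\<kappa> * (f X / u X powr \<nu> * \<tau> powr (2 * g - 1)) \<le> \<kappa> * (f X * \<tau> powr (2 * g - 1 - \<nu>))"
            using \<kappa> by (intro mult_left_mono) auto
          then show ?case using elim by (simp add: w_def t_def satpow_def \<tau>_def mult_ac)
        qed
      qed
      also have "\<dots> \<le> \<kappa> * (F * Y powr (1 / r'))"
        using hold(2) \<kappa> by (simp add: tr F_def Y_def)
      finally have w1: "(LINT X|M. w X * ?h (u X)) \<le> \<kappa> * F * Y powr (1 / r')" by (simp add: mult.assoc)
      have w0: "0 \<le> (LINT X|M. w X * ?h (u X))"
        using w_nn \<kappa> by (intro integral_nonneg_AE) (auto elim!: eventually_mono simp: satpow_def)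
      have "Y \<le> C * (\<kappa> * F * Y powr (1 / r')) powr (p / 2)"
        using k3 w1 w0 C p2 by (elim order_trans) (intro mult_left_mono powr_mono2, auto)
      also have "\<dots> = C * (\<kappa> * F) powr (p / 2) * Y powr \<theta>"
        using \<kappa> F by (simp add: powr_mult powr_powr \<theta>_def mult.commute)
      finally have main: "Y \<le> C * (\<kappa> * F) powr (p / 2) * Y powr \<theta>" .
      \<comment> \<open>\<open>Y\<close> is finite and \<open>\<theta> < 1\<close>, so \<open>Y\<close> can be absorbed, uniformly in \<open>e\<close>.\<close>
      have "Y \<le> Y0"
      proof (cases "Y = 0")
        case False
        then have "Y powr (1 - \<theta>) \<le> C * (\<kappa> * F) powr (p / 2)"
          using main Y by (simp add: powr_diff divide_le_eq)
        then have "(Y powr (1 - \<theta>)) powr (1 / (1 - \<theta>)) \<le> Y0"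
          unfolding Y0_def using \<theta> by (intro powr_mono2) auto
        then show ?thesis using \<theta> Y by (simp add: powr_powr)
      qed (simp add: Y0_def)
      then show ?thesis
        unfolding nn_integral_eq_integral[OF k2 AE_I2[OF snn]] Y_def by (rule ennreal_leI)
    qed
    have "s > 0" using sg g p2 by simp
    have "(\<integral>\<^sup>+X. ennreal (\<bar>u X\<bar> powr s) \<partial>M) \<le> ennreal Y0"
    proof (rule nn_integral_limit_le[OF _ _ bound tendsto_const])
      show "1 / real (Suc n) > 0" for n by simp
      show "(\<lambda>X. ennreal (satpow (1 / real (Suc n)) s (u X))) \<in> borel_measurable M" for n
        unfolding satpow_def by measurable
      show "AE X in M. (\<lambda>n. ennreal (satpow (1 / real (Suc n)) s (u X))) \<longlonglongrightarrow> ennreal (\<bar>u X\<bar> powr s)"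
        using u_pos
      proof eventually_elim
        case (elim X)
        have "(\<lambda>n. 1 / real (Suc n)) \<longlonglongrightarrow> 0" using LIMSEQ_inverse_real_of_nat by (simp add: divide_inverse)
        then have "(\<lambda>n. (u X / (1 + 1 / real (Suc n) * u X)) powr s) \<longlonglongrightarrow> (u X / (1 + 0 * u X)) powr s"
          using elim by (intro tendsto_intros) auto
        then show ?case using elim by (intro tendsto_ennrealI) (simp add: satpow_def)
      qed
    qed
    then have "(\<integral>\<^sup>+X. ennreal (norm (\<bar>u X\<bar> powr s)) \<partial>M) < \<infinity>"
      by (simp add: le_less_trans[OF _ ennreal_less_top])
    then have "integrable M (\<lambda>X. \<bar>u X\<bar> powr s)" by (intro integrableI_bounded) measurable
    then show ?thesis by (simp add: s_def)
  qed
qed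

end

context grushin_weak_solution
begin

text \<open>At levels k >= 1 one has u^\<nu> >= 1 on {u > k}, so w is at most f there. Hoelder with
  f in L^r, and once more with the indicator of {u > k}, bounds Z by a constant times Z^(1/2)
  a(k)^(\<beta>/2), hence by a constant times a(k)^\<beta>. The condition r > Q/2 amounts to 2 r' <
  p, that is \<beta> > 1.\<close>

lemma boundedness:
  assumes C: "C > 0" and Q: "Q > 2" and p: "p = 2 * Q / (Q - 2)"
    and S: "\<And>v. v \<in> C1_0 \<Omega> \<Longrightarrow> (\<integral>\<^sup>+X. ennreal (\<bar>v X\<bar> powr p) \<partial>M)
       \<le> ennreal (C * (LINT X|M. (norm (quasi_grad lam v X))\<^sup>2) powr (p / 2))"
    and r: "r > Q / 2"
    and fr: "integrable M (\<lambda>X. \<bar>f X\<bar> powr r)"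
  shows "\<exists>B. AE X in M. \<bar>u X\<bar> \<le> B"
proof -
  interpret finite_measure M by (rule finite_M)
  have p2: "p > 2" using Q unfolding p by (simp add: field_simps)
  define r' where "r' = r / (r - 1)"
  have r1: "r > 1" using r Q by simp
  have r': "r' > 1" "1 / r + 1 / r' = 1" using r1 by (auto simp: r'_def field_simps)
  have r'p: "2 * r' < p"
  proof -
    have "r * (Q - 2) < Q * (r - 1)" using r by (simp add: algebra_simps)
    then show ?thesis unfolding r'_def p using r1 Q by (simp add: divide_simps)
  qed
  define F where "F = (LINT X|M. \<bar>f X\<bar> powr r) powr (1 / r)"
  have F: "F \<ge> 0" by (simp add: F_def)
  define a where "a k = measure M {X\<in>space M. k < u X}" for k
  define \<beta> where "\<beta> = p / r' - 1"
  have \<beta>: "\<beta> > 1" using r'p r' by (simp add: \<beta>_def less_divide_eq)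
  \<comment> \<open>2^p compensates the lower bound \<delta>/2, instead of \<delta>, of the smoothed
    truncation; the summand 1 guarantees K > 0.\<close>
  define K where "K = 2 powr p * ((C * F powr (p / 2))\<^sup>2 + 1)"
  have K: "K > 0" by (simp add: K_def add_nonneg_pos)
  have decay: "\<delta> powr p * a (k + \<delta>) \<le> K * a k powr \<beta>" if k: "k \<ge> 1" and \<delta>: "\<delta> > 0" for k \<delta>
  proof -
    \<comment> \<open>A C^1 version of (t - k)^+, whose slope rises linearly from 0 at k to 1 at k +
      \<delta>. Slopes in [0, 1] satisfy H'^2 <= H', so H can play both parts in the key
      estimate.\<close>
    define H where "H t = ((max 0 (t - k))\<^sup>2 - (max 0 (t - (k + \<delta>)))\<^sup>2) / (2 * \<delta>)" for t
    define H' where "H' t = (max 0 (t - k) - max 0 (t - (k + \<delta>))) / \<delta>" for t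
    have H'01: "0 \<le> H' t" "H' t \<le> 1" for t using \<delta> by (auto simp: H'_def max_def field_simps)
    have D: "(H has_real_derivative H' t) (at t)" for t
    proof -
      have "(H has_real_derivative (2 * max 0 (t - k) - 2 * max 0 (t - (k + \<delta>))) / (2 * \<delta>)) (at t)"
        unfolding H_def[abs_def] by (intro DERIV_cdivide DERIV_diff DERIV_sqplus)
      moreover have "(2 * max 0 (t - k) - 2 * max 0 (t - (k + \<delta>))) / (2 * \<delta>) = H' t"
        using \<delta> by (simp add: H'_def field_simps)
      ultimately show ?thesis by simp
    qed
    have c: "continuous_on UNIV H'" unfolding H'_def using \<delta> by (intro continuous_intros) auto
    have Hnn: "H t \<ge> 0" for t
      unfolding H_def using \<delta> by (intro divide_nonneg_nonneg) (auto intro!: power_mono)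
    have H0: "H t = 0" if "t \<le> k" for t using that \<delta> by (simp add: H_def)
    have Hlow: "H t \<ge> \<delta> / 2" if "t > k + \<delta>" for t
    proof -
      have "H t = (\<delta> + 2 * (t - (k + \<delta>))) / 2"
        using that \<delta> by (simp add: H_def field_simps power2_eq_square)
      then show ?thesis using that by simp
    qed
    have L: "\<bar>H' t\<bar> \<le> 1" for t using H'01[of t] by simp
    have H'2: "(H' t)\<^sup>2 \<le> H' t" for t
      using H'01[of t] by (simp add: power2_eq_square mult_left_le)
    have pp: "p > 0" using p2 by simp
    have H00: "H 0 = 0" using k by (intro H0) simp
    note key = key_estimate[OF C pp S D c L H00 D c L H00 H'2]
    have Hb [measurable]: "H \<in> borel_measurable borel" unfolding H_def by measurable
    define Z where "Z = (LINT X|M. \<bar>H (u X)\<bar> powr p)"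
    have Z: "Z \<ge> 0" by (simp add: Z_def)
    have a0: "a k \<ge> 0" for k by (simp add: a_def)
    let ?A = "{X\<in>space M. k < u X}"
    define I where "I = indicat_real ?A"
    have I_meas [measurable]: "I \<in> borel_measurable M" unfolding I_def by measurable
    have I01: "0 \<le> I X" "I X powr b = I X" for X b by (auto simp: I_def indicator_def)
    have I_int: "integrable M I" "(LINT X|M. I X) = a k"
    proof -
      have A: "?A \<in> sets M" by measurable
      then show "integrable M I" unfolding I_def
        by (rule integrable_real_indicator) (simp add: emeasure_finite less_top[symmetric])
      have "(LINT X|M. I X) = measure M (?A \<inter> space M)" unfolding I_def by (rule Bochner_Integration.integral_indicator)
      also have "?A \<inter> space M = ?A" by blast
      finally show "(LINT X|M. I X) = a k" by (simp only: a_def)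
    qed
    have HI: "H (u X) = H (u X) * I X" if "X \<in> space M" for X
      using H0[of "u X"] that by (auto simp: I_def indicator_def)
    define b where "b = p / r'"
    have b: "b > 1" using \<beta> by (simp add: b_def \<beta>_def)
    define b' where "b' = b / (b - 1)"
    have b': "b' > 1" "1 / b + 1 / b' = 1" using b by (auto simp: b'_def field_simps)
    have "(H (u X) powr r') powr b = \<bar>H (u X)\<bar> powr p" for X
      using r' Hnn by (simp add: powr_powr b_def)
    note e1 = this
    have "(\<lambda>X. H (u X) powr r') \<in> borel_measurable M" "AE X in M. 0 \<le> H (u X) powr r'" "AE X in M. 0 \<le> I X"
      "integrable M (\<lambda>X. (H (u X) powr r') powr b)" "integrable M (\<lambda>X. I X powr b')"
      using key(2) I_int by (auto simp: e1 I01)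
    note h1 = Hoelder_integral[OF this(1) I_meas this(2,3) b b' this(4,5)]
    \<comment> \<open>H(u) vanishes off {u > k}, so the indicator can be inserted; through it the
      measure a(k) enters the estimate.\<close>
    have eqI: "(LINT X|M. H (u X) powr r') = (LINT X|M. H (u X) powr r' * I X)"
      using H0 r' by (intro Bochner_Integration.integral_cong) (auto simp: I_def indicator_def)
    have intr': "integrable M (\<lambda>X. H (u X) powr r')"
      using h1(1) by (rule Bochner_Integration.integrable_cong[THEN iffD1, rotated -1])
        (use H0 r' in \<open>auto simp: I_def indicator_def\<close>)
    have h1': "(LINT X|M. H (u X) powr r') \<le> Z powr (1 / b) * a k powr (1 / b')"
      using h1(2) by (simp add: eqI e1 Z_def I01 I_int)
    have "(\<lambda>X. \<bar>f X\<bar>) \<in> borel_measurable M" "(\<lambda>X. H (u X)) \<in> borel_measurable M"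
      "AE X in M. 0 \<le> \<bar>f X\<bar>" "AE X in M. 0 \<le> H (u X)"
      by (auto simp: Hnn)
    note h2 = Hoelder_integral[OF this r1 r' fr intr']
    have "(LINT X|M. w X * H (u X)) \<le> (LINT X|M. \<bar>f X\<bar> * H (u X))"
    proof (rule integral_mono_AE[OF key(1) h2(1)])
      show "AE X in M. w X * H (u X) \<le> \<bar>f X\<bar> * H (u X)"
        using f_nn
      proof eventually_elim
        case (elim X)
        show ?case
        proof (cases "u X \<le> k")
          case False
          then have "1 \<le> u X" using k by simp
          then have "1 powr \<nu> \<le> u X powr \<nu>" using nu by (intro powr_mono2) auto
          then have "w X \<le> \<bar>f X\<bar>" using elim mult_left_mono[of 1 "u X powr \<nu>" "f X"] by (simp add: w_def divide_le_eq)
          then show ?thesis using Hnn by (intro mult_right_mono)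
        qed (simp add: H0)
      qed
    qed
    also have "\<dots> \<le> F * (Z powr (1 / b) * a k powr (1 / b')) powr (1 / r')"
      using h1' F r' Hnn by (intro order_trans[OF h2(2)]) (auto simp: F_def[symmetric] intro!: mult_left_mono powr_mono2 Bochner_Integration.integral_nonneg)
    also have "\<dots> = F * (Z powr (1 / p) * a k powr (\<beta> / p))"
    proof -
      have "1 / b * (1 / r') = 1 / p" using r' p2 by (simp add: b_def)
      moreover have "1 / b' * (1 / r') = \<beta> / p"
      proof -
        have "1 / b' = (b - 1) / b" using b by (simp add: b'_def)
        then have "1 / b' * (1 / r') = (b - 1) / (b * r')" by simp
        also have "b * r' = p" using r' by (simp add: b_def)
        finally show ?thesis by (simp add: \<beta>_def b_def)
      qed
      ultimately show ?thesis using a0[of k] Z by (simp add: powr_mult powr_powr)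
    qed
    finally have w1: "(LINT X|M. w X * H (u X)) \<le> F * (Z powr (1 / p) * a k powr (\<beta> / p))" .
    have w0: "0 \<le> (LINT X|M. w X * H (u X))"
      using w_nn Hnn by (intro integral_nonneg_AE) (auto elim!: eventually_mono)
    have "Z \<le> C * (LINT X|M. w X * H (u X)) powr (p / 2)" using key(3) by (simp add: Z_def)
    also have "\<dots> \<le> C * (F * (Z powr (1 / p) * a k powr (\<beta> / p))) powr (p / 2)"
      using C w0 w1 p2 by (intro mult_left_mono powr_mono2) auto
    also have "\<dots> = C * F powr (p / 2) * sqrt (a k powr \<beta>) * sqrt Z"
      using F Z a0[of k] p2 by (simp add: powr_mult powr_powr powr_half_sqrt[symmetric] mult_ac)
    finally have ZZ: "Z \<le> C * F powr (p / 2) * sqrt (a k powr \<beta>) * sqrt Z" .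
    have "sqrt Z \<le> C * F powr (p / 2) * sqrt (a k powr \<beta>)"
    proof (cases "Z = 0")
      case True then show ?thesis using C F by simp
    next
      case False
      then have "sqrt Z > 0" using Z by simp
      moreover have "sqrt Z * sqrt Z \<le> C * F powr (p / 2) * sqrt (a k powr \<beta>) * sqrt Z" using ZZ Z by simp
      ultimately show ?thesis by (rule mult_right_le_imp_le[rotated])
    qed
    then have "(sqrt Z)\<^sup>2 \<le> (C * F powr (p / 2) * sqrt (a k powr \<beta>))\<^sup>2" using Z by (intro power_mono) auto
    then have Z1: "Z \<le> (C * F powr (p / 2))\<^sup>2 * a k powr \<beta>" using Z by (simp add: power_mult_distrib)
    have "(\<delta> / 2) powr p * a (k + \<delta>) = (LINT X|M. (\<delta> / 2) powr p * indicat_real {X\<in>space M. k + \<delta> < u X} X)"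
    proof -
      have "{X\<in>space M. k + \<delta> < u X} \<inter> space M = {X\<in>space M. k + \<delta> < u X}" by blast
      then show ?thesis by (simp only: a_def integral_mult_right_zero Bochner_Integration.integral_indicator)
    qed
    also have "\<dots> \<le> Z"
      unfolding Z_def
    proof (rule integral_mono[OF _ key(2)])
      show "integrable M (\<lambda>X. (\<delta> / 2) powr p * indicat_real {X\<in>space M. k + \<delta> < u X} X)"
      proof (intro integrable_mult_right integrable_real_indicator)
        show "{X\<in>space M. k + \<delta> < u X} \<in> sets M" by measurable
      qed (simp add: emeasure_finite less_top[symmetric])
      show "(\<delta> / 2) powr p * indicat_real {X\<in>space M. k + \<delta> < u X} X \<le> \<bar>H (u X)\<bar> powr p" for X
        using Hlow[of "u X"] \<delta> p2 by (auto simp: indicator_def intro!: powr_mono2)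
    qed
    finally have "(\<delta> / 2) powr p * a (k + \<delta>) \<le> (C * F powr (p / 2))\<^sup>2 * a k powr \<beta>" using Z1 by simp
    then have "2 powr p * ((\<delta> / 2) powr p * a (k + \<delta>)) \<le> 2 powr p * ((C * F powr (p / 2))\<^sup>2 * a k powr \<beta>)"
      by (intro mult_left_mono) auto
    also have "2 powr p * ((\<delta> / 2) powr p * a (k + \<delta>)) = \<delta> powr p * a (k + \<delta>)"
      using \<delta> by (simp add: powr_divide)
    also have "2 powr p * ((C * F powr (p / 2))\<^sup>2 * a k powr \<beta>) \<le> K * a k powr \<beta>"
      by (simp add: K_def mult.assoc[symmetric] mult_right_mono)
    finally show ?thesis .
  qed
  have "\<exists>D>0. a (1 + D) = 0"
  proof (rule stampacchia_iteration[OF _ _ K _ \<beta> decay])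
    show "a l \<le> a k" if "k \<le> l" for k l unfolding a_def
    proof (rule finite_measure_mono)
      show "{X\<in>space M. k < u X} \<in> sets M" by measurable
    qed (use that in auto)
  qed (use p2 in \<open>auto simp: a_def\<close>)
  then obtain D where "a (1 + D) = 0" by blast
  then have "emeasure M {X\<in>space M. 1 + D < u X} = 0" by (simp add: a_def emeasure_eq_measure)
  then have "AE X in M. \<not> 1 + D < u X"
  proof (subst AE_iff_measurable[where N = "{X\<in>space M. 1 + D < u X}"])
    show "{X\<in>space M. 1 + D < u X} \<in> sets M" by measurable
  qed auto
  then have "AE X in M. \<bar>u X\<bar> \<le> 1 + D" using u_pos by eventually_elim simp
  then show ?thesis by blast
qed

end

section \<open>From the hypotheses of the theorem to the locale\<close>

lemma integrable_powr_le:
  fixes f :: "'a \<Rightarrow> real"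
  assumes "finite_measure M" and [measurable]: "f \<in> borel_measurable M"
    and I: "integrable M (\<lambda>x. \<bar>f x\<bar> powr b)" and ab: "0 \<le> a" "a \<le> b"
  shows "integrable M (\<lambda>x. \<bar>f x\<bar> powr a)"
proof -
  interpret finite_measure M by fact
  have "\<bar>f x\<bar> powr a \<le> 1 + \<bar>f x\<bar> powr b" for x
  proof (cases "\<bar>f x\<bar> \<le> 1")
    case True
    then have "\<bar>f x\<bar> powr a \<le> 1" using ab by (intro powr_le1) auto
    then show ?thesis by (simp add: add_increasing2)
  next
    case False
    then have "\<bar>f x\<bar> powr a \<le> \<bar>f x\<bar> powr b" using ab by (intro powr_mono) auto
    then show ?thesis by simp
  qed
  note le = this
  show ?thesis
  proof (rule Bochner_Integration.integrable_bound)
    show "integrable M (\<lambda>x. 1 + \<bar>f x\<bar> powr b)" using I by simp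
    show "AE x in M. norm (\<bar>f x\<bar> powr a) \<le> norm (1 + \<bar>f x\<bar> powr b)" using le by (intro AE_I2) simp
  qed measurable
qed

text \<open>Finite measure makes the spaces nested, so the extended exponent r, possibly infinite,
  can be traded for a real one.\<close>

lemma Lp_integrable_powr:
  assumes fin: "finite_measure (lebesgue_on \<Omega>)" and f: "f \<in> Lp \<Omega> r"
    and a: "0 < a" "ereal a \<le> r"
  shows "integrable (lebesgue_on \<Omega>) (\<lambda>X. \<bar>f X\<bar> powr a)"
proof -
  interpret finite_measure "lebesgue_on \<Omega>" by (rule fin)
  have [measurable]: "f \<in> borel_measurable (lebesgue_on \<Omega>)" using f by (simp add: Lp_def)
  show ?thesis
  proof (cases "r = \<infinity>")
    case True
    then obtain B where B: "AE X in lebesgue_on \<Omega>. norm (f X) \<le> B" using f by (auto simp: Lp_def)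
    show ?thesis
    proof (rule integrable_const_bound)
      show "AE X in lebesgue_on \<Omega>. norm (\<bar>f X\<bar> powr a) \<le> \<bar>B\<bar> powr a"
        using B by eventually_elim (use a in \<open>auto intro!: powr_mono2\<close>)
    qed measurable
  next
    case False
    with a obtain b where b: "r = ereal b" "a \<le> b" by (cases r) auto
    have "integrable (lebesgue_on \<Omega>) (\<lambda>X. \<bar>f X\<bar> powr b)" using f b by (simp add: Lp_def)
    from integrable_powr_le[OF fin _ this, of a] show ?thesis using a b by simp
  qed
qed

text \<open>A quasi-gradient is given only up to null sets and without measurability. Completeness
  of Lebesgue measure supplies the measurability that comparing the integrals demands.\<close>

lemma borel_measurable_lebesgue_on_AE_cong:
  fixes f g :: "'a::euclidean_space \<Rightarrow> 'b::euclidean_space"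
  assumes \<Omega>: "\<Omega> \<in> sets lebesgue" and f: "f \<in> borel_measurable (lebesgue_on \<Omega>)"
    and ae: "AE X in lebesgue_on \<Omega>. f X = g X"
  shows "g \<in> borel_measurable (lebesgue_on \<Omega>)"
proof -
  have "(\<lambda>X. if X \<in> \<Omega> then f X else 0) \<in> borel_measurable lebesgue"
    using f \<Omega> by (simp add: borel_measurable_if)
  moreover have "AE X in lebesgue. (if X \<in> \<Omega> then f X else 0) = (if X \<in> \<Omega> then g X else 0)"
    using ae \<Omega> by (auto simp: AE_restrict_space_iff elim!: eventually_mono)
  ultimately have "(\<lambda>X. if X \<in> \<Omega> then g X else 0) \<in> borel_measurable lebesgue" by (rule borel_measurable_AE)
  then show ?thesis by (rule borel_measurable_if_D)
qed

text \<open>True on x = 0 as well, where the convention \<open>0 powr y = 0\<close> makes the fibre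
  parts of both sides vanish.\<close>

lemma grushin_A_sqrtA_inv:
  "grushin_A lam X (grushin_sqrtA_inv lam X Z) \<bullet> W = Z \<bullet> grushin_sqrtA lam X W"
proof -
  have "\<bar>x\<bar> powr (2 * lam) * \<bar>x\<bar> powr (- lam) = \<bar>x\<bar> powr lam" for x :: real
    by (simp add: powr_add[symmetric])
  then show ?thesis
    by (simp add: grushin_A_def grushin_sqrtA_inv_def grushin_sqrtA_def inner_prod_def)
qed

lemma weak_solution_imp_locale:
  fixes \<Omega> :: "(real \<times> (real ^ 'm)) set"
  assumes opn: "open \<Omega>" and bdd: "bounded \<Omega>" and lam: "lam \<ge> 1" and nu: "0 < \<nu>" "\<nu> < 1"
    and f: "integrable (lebesgue_on \<Omega>) f" "AE X in lebesgue_on \<Omega>. 0 \<le> f X"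
    and ws: "weak_solution lam \<nu> \<Omega> f u"
  shows "\<exists>\<phi> U. grushin_weak_solution lam \<nu> \<Omega> f u \<phi> U"
proof -
  have \<Omega>: "\<Omega> \<in> sets lebesgue" using opn by simp
  have low: "\<And>\<Omega>'. compactly_inside \<Omega>' \<Omega> \<Longrightarrow> \<exists>C>0. AE X in lebesgue_on \<Omega>. X \<in> \<Omega>' \<longrightarrow> C \<le> u X"
    using ws by (simp add: weak_solution_def)
  from ws obtain G where G: "has_quasi_gradient lam \<Omega> u G" and
    wk: "\<And>v. v \<in> C1_0 \<Omega> \<Longrightarrow> (LINT X|lebesgue_on \<Omega>. grushin_A lam X (G X) \<bullet> gradient v X) =
           (LINT X|lebesgue_on \<Omega>. f X * v X / u X powr \<nu>)"
    by (auto simp: weak_solution_def)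
  from G obtain \<phi> U where rep: "H0_represents lam \<Omega> \<phi> u"
    and L2U: "L2_tendsto \<Omega> (\<lambda>n. quasi_grad lam (\<phi> n)) U"
    and GU: "AE X in lebesgue_on \<Omega>. G X = grushin_sqrtA_inv lam X (U X)"
    by (auto simp: has_quasi_gradient_def)
  have \<phi>: "\<phi> n \<in> C1_0 \<Omega>" for n using rep by (simp add: H0_represents_def)
  have L2u: "L2_tendsto \<Omega> \<phi> u" using rep by (simp add: H0_represents_def)
  have um: "u \<in> borel_measurable (lebesgue_on \<Omega>)" and ui: "integrable (lebesgue_on \<Omega>) (\<lambda>X. (norm (u X))\<^sup>2)"
    and \<phi>m: "\<phi> n \<in> borel_measurable (lebesgue_on \<Omega>)" and \<phi>i: "integrable (lebesgue_on \<Omega>) (\<lambda>X. (norm (\<phi> n X))\<^sup>2)"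
    and \<phi>l: "(\<lambda>n. LINT X|lebesgue_on \<Omega>. (norm (\<phi> n X - u X))\<^sup>2) \<longlonglongrightarrow> 0" for n
    using L2u unfolding L2_tendsto_def Lp_2_iff by simp_all
  have Um: "U \<in> borel_measurable (lebesgue_on \<Omega>)" and Ui: "integrable (lebesgue_on \<Omega>) (\<lambda>X. (norm (U X))\<^sup>2)"
    and Ul: "(\<lambda>n. LINT X|lebesgue_on \<Omega>. (norm (quasi_grad lam (\<phi> n) X - U X))\<^sup>2) \<longlonglongrightarrow> 0"
    using L2U unfolding L2_tendsto_def Lp_2_iff by simp_all
  \<comment> \<open>The squared differences tend to 0 in L^1, so a subsequence of them tends to 0
    almost everywhere.\<close>
  have "\<exists>s. strict_mono s \<and> (AE X in lebesgue_on \<Omega>. (\<lambda>n. (norm (\<phi> (s n) X - u X))\<^sup>2) \<longlonglongrightarrow> 0)"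
    by (rule tendsto_L1_AE_subseq[where u = "\<lambda>n X. (norm (\<phi> n X - u X))\<^sup>2"])
       (use \<phi>l L2_diff(1)[OF \<phi>m um \<phi>i ui] in auto)
  then obtain s :: "nat \<Rightarrow> nat" where s: "strict_mono s"
    "AE X in lebesgue_on \<Omega>. (\<lambda>n. (norm (\<phi> (s n) X - u X))\<^sup>2) \<longlonglongrightarrow> 0" by blast
  have lim: "AE X in lebesgue_on \<Omega>. (\<lambda>n. \<phi> (s n) X) \<longlonglongrightarrow> u X"
    using s(2)
  proof eventually_elim
    case (elim X)
    then have "(\<lambda>n. sqrt ((norm (\<phi> (s n) X - u X))\<^sup>2)) \<longlonglongrightarrow> sqrt 0" by (rule tendsto_real_sqrt)
    then have "(\<lambda>n. norm (\<phi> (s n) X - u X)) \<longlonglongrightarrow> 0" by simp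
    then have "(\<lambda>n. \<phi> (s n) X - u X) \<longlonglongrightarrow> 0" by (rule tendsto_norm_zero_cancel)
    then show ?case by (rule LIM_zero_cancel)
  qed
  have upos: "AE X in lebesgue_on \<Omega>. 0 < u X"
  proof -
    \<comment> \<open>The lower bound depends on the compact set and may degenerate towards the
      boundary. A countable exhaustion by compact sets still yields u > 0 almost everywhere.\<close>
    have "\<exists>K::nat \<Rightarrow> (real \<times> (real ^ 'm)) set. (\<forall>n. compact (K n) \<and> K n \<subseteq> \<Omega>) \<and> \<Union>(range K) = \<Omega>"
    proof (rule open_Union_compact_subsets[OF opn])
      fix C :: "nat \<Rightarrow> (real \<times> (real ^ 'm)) set"
      assume C: "\<And>n. compact (C n)" "\<And>n. C n \<subseteq> \<Omega>" "\<Union>(range C) = \<Omega>"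
      show ?thesis by (intro exI[of _ C] conjI allI C)
    qed
    then obtain K :: "nat \<Rightarrow> (real \<times> (real ^ 'm)) set"
      where K: "\<forall>n. compact (K n) \<and> K n \<subseteq> \<Omega>" "\<Union>(range K) = \<Omega>" by blast
    have "AE X in lebesgue_on \<Omega>. X \<in> K n \<longrightarrow> 0 < u X" for n
    proof -
      have "compactly_inside (K n) \<Omega>" using K(1) by (simp add: compactly_inside_def compact_imp_closed)
      from low[OF this] obtain C where C: "C > 0" "AE X in lebesgue_on \<Omega>. X \<in> K n \<longrightarrow> C \<le> u X" by blast
      show ?thesis using C(2) by eventually_elim (use C(1) in auto)
    qed
    then have "AE X in lebesgue_on \<Omega>. \<forall>n. X \<in> K n \<longrightarrow> 0 < u X" unfolding AE_all_countable by blast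
    then show ?thesis using AE_space
    proof eventually_elim
      case (elim X)
      then have "X \<in> \<Union>(range K)" unfolding K(2) by (simp add: space_restrict_space)
      then show ?case using elim by blast
    qed
  qed
  have lam0: "lam > 0" using lam by simp
  have weak: "(LINT X|lebesgue_on \<Omega>. U X \<bullet> quasi_grad lam v X) = (LINT X|lebesgue_on \<Omega>. f X / u X powr \<nu> * v X)"
    if v: "v \<in> C1_0 \<Omega>" for v
  proof -
    have m: "(\<lambda>X. U X \<bullet> quasi_grad lam v X) \<in> borel_measurable (lebesgue_on \<Omega>)"
      by (rule borel_measurable_inner[OF Um C1_0_energy_integrable(1)[OF v opn lam0]])
    have ae: "AE X in lebesgue_on \<Omega>. U X \<bullet> quasi_grad lam v X = grushin_A lam X (G X) \<bullet> gradient v X"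
      using GU by eventually_elim (simp add: grushin_A_sqrtA_inv)
    have "(LINT X|lebesgue_on \<Omega>. U X \<bullet> quasi_grad lam v X) = (LINT X|lebesgue_on \<Omega>. grushin_A lam X (G X) \<bullet> gradient v X)"
      by (rule integral_cong_AE[OF m borel_measurable_lebesgue_on_AE_cong[OF \<Omega> m ae] ae])
    then show ?thesis using wk[OF v] by simp
  qed
  have "(\<lambda>n. LINT X|lebesgue_on \<Omega>. (norm (quasi_grad lam (\<phi> (s n)) X - U X))\<^sup>2) \<longlonglongrightarrow> 0"
    using LIMSEQ_subseq_LIMSEQ[OF Ul s(1)] by (simp add: o_def)
  then have "grushin_weak_solution lam \<nu> \<Omega> f u (\<lambda>n. \<phi> (s n)) U"
    by (intro grushin_weak_solution.intro opn bdd lam nu f \<phi> um lim Um Ui upos low weak)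
  then show ?thesis by blast
qed

theorem theorem3p6:
  fixes lam \<nu> Q two_star :: real
    and r :: ereal
    and \<Omega> :: "(real \<times> (real ^ 'm)) set"
    and f u :: "real \<times> (real ^ 'm) \<Rightarrow> real"
  assumes "lam \<ge> 1"
    and "0 < \<nu>" and "\<nu> < 1"
    and "Q = (real CARD('m) + 1) + lam * real CARD('m)"
    and "two_star = 2 * Q / (Q - 2)"
    and "open \<Omega>" and "bounded \<Omega>" and "Lambda_connected lam \<Omega>"
    and "r \<ge> ereal (holder_conjugate (two_star / (1 - \<nu>)))"
    and "f \<in> Lp \<Omega> r"
    and "AE X in lebesgue_on \<Omega>. 0 \<le> f X"
    and "\<not> (AE X in lebesgue_on \<Omega>. f X = 0)"
    and "weak_solution lam \<nu> \<Omega> f u"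
  shows "(r > ereal (Q / 2) \<longrightarrow> u \<in> Lp \<Omega> \<infinity>) \<and>
         (ereal (holder_conjugate (two_star / (1 - \<nu>))) \<le> r \<and> r < ereal (Q / 2) \<longrightarrow>
            u \<in> Lp \<Omega> (ereal (Q * real_of_ereal r * (\<nu> + 1) / (Q - 2 * real_of_ereal r))))"
proof -
  note lam = assms(1) and nu = assms(2,3) and p = assms(5)
  have m: "real CARD('m) \<ge> 1" by (simp add: Suc_le_eq)
  \<comment> \<open>With m >= 1 this gives Q >= 3, so the critical exponent is finite and larger
    than 2.\<close>
  have "lam * real CARD('m) \<ge> 1 * 1" using lam m by (intro mult_mono) auto
  then have Q2: "Q > 2" using m unfolding assms(4) by linarith
  have Q: "Q = 1 + real CARD('m) + lam * real CARD('m)" using assms(4) by simp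
  have "two_star > 2" using Q2 unfolding p by (simp add: field_simps)
  moreover have "two_star \<le> two_star / (1 - \<nu>)" using nu calculation by (simp add: le_divide_eq mult_left_le)
  ultimately have "two_star / (1 - \<nu>) > 1" by linarith
  moreover have "holder_conjugate x > 1" if "x > 1" for x
    using that by (simp add: holder_conjugate_def less_divide_eq)
  ultimately have "holder_conjugate (two_star / (1 - \<nu>)) > 1" by blast
  then have r1: "r > ereal 1" using assms(9) by (meson ereal_less(2) less_ereal.simps(1) order_less_le_trans)
  have fin: "finite_measure (lebesgue_on \<Omega>)"
    by (rule finite_measureI)
       (use assms(6,7) emeasure_bounded_finite in \<open>auto simp: space_restrict_space emeasure_restrict_space less_top\<close>)
  have fm: "f \<in> borel_measurable (lebesgue_on \<Omega>)" using assms(10) by (simp add: Lp_def)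
  have "integrable (lebesgue_on \<Omega>) (\<lambda>X. \<bar>f X\<bar> powr 1)"
    by (rule Lp_integrable_powr[OF fin assms(10)]) (use r1 in auto)
  then have fi: "integrable (lebesgue_on \<Omega>) f" using fm by (simp add: integrable_abs_iff)
  obtain \<phi> U where "grushin_weak_solution lam \<nu> \<Omega> f u \<phi> U"
    using weak_solution_imp_locale[OF assms(6,7) lam nu fi assms(11,13)] by blast
  then interpret grushin_weak_solution lam \<nu> \<Omega> f u \<phi> U .
  obtain C where C: "C > 0" "\<And>v. v \<in> C1_0 \<Omega> \<Longrightarrow> (\<integral>\<^sup>+X. ennreal (\<bar>v X\<bar> powr two_star) \<partial>lebesgue_on \<Omega>)
       \<le> ennreal (C * (LINT X|lebesgue_on \<Omega>. (norm (quasi_grad lam v X))\<^sup>2) powr (two_star / 2))"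
    using sobolev_C1_0[OF assms(6) lam0 Q Q2 p] by blast
  show ?thesis
  proof (intro conjI impI)
    assume "r > ereal (Q / 2)"
    \<comment> \<open>r may be infinite; a real exponent strictly between Q/2 and r does the same
      service.\<close>
    then obtain a where a: "ereal (Q / 2) < ereal a" "ereal a < r" using ereal_dense2 by metis
    have "integrable (lebesgue_on \<Omega>) (\<lambda>X. \<bar>f X\<bar> powr a)"
      by (rule Lp_integrable_powr[OF fin assms(10)]) (use a Q2 in auto)
    then have "\<exists>B. AE X in lebesgue_on \<Omega>. \<bar>u X\<bar> \<le> B"
      using a(1) by (intro boundedness[OF C(1) Q2 p C(2)]) auto
    then show "u \<in> Lp \<Omega> \<infinity>" using u_meas by (simp add: Lp_def)
  next
    assume *: "ereal (holder_conjugate (two_star / (1 - \<nu>))) \<le> r \<and> r < ereal (Q / 2)"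
    then obtain b where b: "r = ereal b" by (cases r) auto
    have "integrable (lebesgue_on \<Omega>) (\<lambda>X. \<bar>f X\<bar> powr b)"
      by (rule Lp_integrable_powr[OF fin assms(10)]) (use b r1 in auto)
    then have "integrable (lebesgue_on \<Omega>) (\<lambda>X. \<bar>u X\<bar> powr (Q * b * (\<nu> + 1) / (Q - 2 * b)))"
      using * b r1 by (intro summability_gain[OF C(1) Q2 p C(2)]) auto
    then show "u \<in> Lp \<Omega> (ereal (Q * real_of_ereal r * (\<nu> + 1) / (Q - 2 * real_of_ereal r)))"
      using u_meas b by (simp add: Lp_def)
  qed
qed

end
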